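(* Let $a^+(f),a^-(f)$ ($f\in\mathcal H$) be the standard creation and annihilation operators in the $Q$-symmetric Fock space $\mathcal F^Q(\mathcal H)$ and $\tau(\cdot)=(\cdot\,\Omega,\Omega)_{\mathcal F^Q(\mathcal H)}$ the Fock (vacuum) state. Let $n\in\mathbb N$ and $f_1,f_1',\dots,f_{2n},f_{2n}'\in\mathcal H$. Then $$\tau\big((a^+(f_1)+a^-(f_1'))\cdots(a^+(f_{2n-1})+a^-(f_{2n-1}'))\big)=0$$ and $$\tau\big((a^+(f_1)+a^-(f_1'))\cdots(a^+(f_{2n})+a^-(f_{2n}'))\big)=\sum_{\xi\in\mathcal P^{(2n)}}\int_{X^{2n}}\bigotimes_{\{i,j\}\in\xi,\,i<j}\sigma^{(2)}(dx_i\,dx_j)\ \mathbb T^{(2n)}(\xi)\,Q(\xi;x_1,\dots,x_{2n})\,h_1(x_1)\otimes\cdots\otimes h_{2n}(x_{2n}),$$ where, for the given $\xi$ (written as in the context with sets $I,J$), $h_k=f_k'$ if $k\in I$ and $h_k=f_k$ if $k\in J$.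
   Context: $d\ge2$, $X=\mathbb R^d\ni x=(y,z)$ with $y\in\mathbb R$. $V=\mathbb C^r$ with standard basis $e_i$, $J$ complex conjugation, $\langle u,v\rangle_V=(u,Jv)_V=\sum_k u^kv^k$. $Q:\mathbb R^2\to\mathcal L(V^{\otimes2})$ continuous, unitary-valued, $Q(y_1,y_2)^*=Q(y_2,y_1)$, satisfying $Q_1(y_1,y_2)Q_2(y_1,y_3)Q_1(y_2,y_3)=Q_2(y_2,y_3)Q_1(y_1,y_3)Q_2(y_1,y_2)$; $Q(x_1,x_2):=Q(y_1,y_2)$. For $C\in\mathcal L(V^{\otimes2})$, $C_i$ acts on factors $i,i+1$ and $C[i,j]$ ($i<j$) acts on factors $i$ and $j$ of $V^{\otimes m}$. Fock space: $\mathcal H=L^2(X;V)$, $\mathcal H^{\otimes n}=L^2(X^n;V^{\otimes n})$. $U$ on $\mathcal H^{\otimes2}$: $(Uf)(x_1,x_2)=Q(x_1,x_2)f(x_2,x_1)$; $U_i$ = $U$ on components $i,i+1$; $U_\pi:=U_{i_1}\cdots U_{i_k}$ for $\pi=\pi_{i_1}\cdots\pi_{i_k}$ (adjacent transpositions; well defined); $P_n=\frac1{n!}\sum_{\pi\in S_n}U_\pi$ is an orthogonal projection with image $\mathcal H^{\circledast n}$, $\mathcal H^{\circledast0}=\mathbb C$. $\mathcal F^Q(\mathcal H)=\bigoplus_n\mathcal H^{\circledast n}n!$ (norm $\sum\|f^{(n)}\|^2n!$), vacuum $\Omega=(1,0,\dots)$, $\mathcal F^Q_{\rm fin}$ finite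 sequences. $a^+(f)f^{(n)}=P_{n+1}(f\otimes f^{(n)})$; $(a^-(f)f^{(n)})(x_1..x_{n-1})=n\int_X\langle f^{(n)}(x,x_1..x_{n-1}),f(x)\rangle_V dx$, where $\langle u_1\otimes\cdots\otimes u_n,v\rangle_V:=\langle u_1,v\rangle_Vu_2\otimes\cdots\otimes u_n$. $\sigma^{(2)}$ is the measure on $X^2$ with $\int f(x_1,x_2)\sigma^{(2)}(dx_1dx_2)=\int_Xf(x,x)dx$. $\mathcal P^{(2n)}$ = partitions of $\{1..2n\}$ into $n$ two-element sets. Write $\xi=\{\{i_1,j_1\},..,\{i_n,j_n\}\}$ with $i_k<j_k$ and $i_1>i_2>\cdots>i_n=1$; $I=\{i_k\}$, $J=\{j_k\}$. $J^{(1)}=\{j\in J:i_1<j\le j_1\}$, $\mathbf J^{(1)}=\{j\in J:i_1<j\}$; for $k\ge2$: $J^{(k)}=\{j\in J:i_k<j\le j_k,\ j\notin\{j_1..j_{k-1}\}\}$, $\mathbf J^{(k)}=\{j\in J:i_k<j,\ j\ne\min\mathbf J^{(1)},..,\min\mathbf J^{(k-1)}\}$. Enumerate increasingly $J^{(k)}=\{j^{(k)}_1<\cdots<j^{(k)}_{l_k}\}$, $\mathbf J^{(k)}=\{\mathbf j^{(k)}_1<\cdots<\mathbf j^{(k)}_{m_k}\}$. $Q^{(k)}(\xi;x_1..x_{2n})$ is the identity if $l_k=1$, and otherwise $Q(x_{i_k},x_{j^{(k)}_1})[\mathbf j^{(k)}_1,\mathbf j^{(k)}_2]\,Q(x_{i_k},x_{j^{(k)}_2})[\mathbf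 j^{(k)}_2,\mathbf j^{(k)}_3]\cdots Q(x_{i_k},x_{j^{(k)}_{l_k-1}})[\mathbf j^{(k)}_{l_k-1},\mathbf j^{(k)}_{l_k}]$. $Q(\xi;x_1..x_{2n}):=Q^{(n)}(\xi;\cdot)Q^{(n-1)}(\xi;\cdot)\cdots Q^{(1)}(\xi;\cdot)$. $\mathbb T^{(2n)}(\xi):V^{\otimes2n}\to\mathbb C$, $\mathbb T^{(2n)}(\xi)v_1\otimes\cdots\otimes v_{2n}=\prod_{k=1}^n\langle v_{i_k},v_{\mathbf j^{(k)}_1}\rangle_V$. The integral over $X^{2n}$ is with respect to the product over pairs of the measures $\sigma^{(2)}$ in the coordinates $(x_i,x_j)$. *)

theory Defs
  imports "HOL-Analysis.Analysis" "HOL-Combinatorics.Permutations" "HOL-Library.Disjoint_Sets"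
begin

text \<open>Conventions.
  X = R x R^(d-1) is modelled as the type  real \<times> real^'e  (so d = 1 + CARD('e) \<ge> 2),
  the first component being y.  V = C^r is modelled by functions 'r \<Rightarrow> complex, 'r a finite
  type with r = CARD('r).  An n-particle function (element of L^2(X^n; V^{\<otimes>n})) is
  represented by its component function  X list \<Rightarrow> 'r list \<Rightarrow> complex  (positions 0..n-1),
  a Fock vector by the sequence of its n-particle components.
  An operator C on V\<otimes>V is given by its matrix C (a,b) (c,d), i.e.
  C (e_c \<otimes> e_d) = \<Sum>(a,b). C (a,b) (c,d) e_a \<otimes> e_b.  Q is given as a matrix-valued function of (y1,y2).\<close>

type_synonym 'e pt = "real \<times> (real ^ 'e)"
type_synonym 'r mat2 = "'r \<times> 'r \<Rightarrow> 'r \<times> 'r \<Rightarrow> complex"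
type_synonym ('e,'r) nfun = "'e pt list \<Rightarrow> 'r list \<Rightarrow> complex"
type_synonym ('e,'r) fock = "nat \<Rightarrow> ('e,'r) nfun"

definition mm :: "('i::finite \<Rightarrow> 'i \<Rightarrow> complex) \<Rightarrow> ('i \<Rightarrow> 'i \<Rightarrow> complex) \<Rightarrow> ('i \<Rightarrow> 'i \<Rightarrow> complex)" where
  "mm A B = (\<lambda>i k. \<Sum>j\<in>UNIV. A i j * B j k)"

definition idm :: "'i \<Rightarrow> 'i \<Rightarrow> complex" where
  "idm = (\<lambda>i j. if i = j then 1 else 0)"

definition adjm :: "('i \<Rightarrow> 'i \<Rightarrow> complex) \<Rightarrow> ('i \<Rightarrow> 'i \<Rightarrow> complex)" where
  "adjm A = (\<lambda>i j. cnj (A j i))"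

definition op1 :: "'r mat2 \<Rightarrow> ('r \<times> 'r \<times> 'r \<Rightarrow> 'r \<times> 'r \<times> 'r \<Rightarrow> complex)" where
  "op1 C = (\<lambda>(a,b,c) (a',b',c'). C (a,b) (a',b') * (if c = c' then 1 else 0))"

definition op2 :: "'r mat2 \<Rightarrow> ('r \<times> 'r \<times> 'r \<Rightarrow> 'r \<times> 'r \<times> 'r \<Rightarrow> complex)" where
  "op2 C = (\<lambda>(a,b,c) (a',b',c'). (if a = a' then 1 else 0) * C (b,c) (b',c'))"

definition Uop :: "(real \<Rightarrow> real \<Rightarrow> 'r::finite mat2) \<Rightarrow> nat \<Rightarrow> ('e,'r) nfun \<Rightarrow> ('e,'r) nfun" where
  "Uop Q i F = (\<lambda>xs \<alpha>. \<Sum>cd\<in>UNIV.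
      Q (fst (xs ! i)) (fst (xs ! Suc i)) (\<alpha> ! i, \<alpha> ! Suc i) cd
      * F (xs[i := xs ! Suc i, Suc i := xs ! i]) (\<alpha>[i := fst cd, Suc i := snd cd]))"

definition adj_swap :: "nat \<Rightarrow> nat \<Rightarrow> nat" where
  "adj_swap i = (\<lambda>m. if m = i then Suc i else if m = Suc i then i else m)"

definition word_perm :: "nat list \<Rightarrow> nat \<Rightarrow> nat" where
  "word_perm w = foldr (\<lambda>i p. adj_swap i \<circ> p) w id"

text \<open>a decomposition of \<pi> into adjacent transpositions (U_\<pi> is independent of the choice)\<close>
definition perm_word :: "nat \<Rightarrow> (nat \<Rightarrow> nat) \<Rightarrow> nat list" where
  "perm_word n \<pi> = (SOME w. (\<forall>i\<in>set w. Suc i < n) \<and> word_perm w = \<pi>)"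

definition Uword :: "(real \<Rightarrow> real \<Rightarrow> 'r::finite mat2) \<Rightarrow> nat list \<Rightarrow> ('e,'r) nfun \<Rightarrow> ('e,'r) nfun" where
  "Uword Q w F = foldr (\<lambda>i G. Uop Q i G) w F"

definition Pn :: "(real \<Rightarrow> real \<Rightarrow> 'r::finite mat2) \<Rightarrow> nat \<Rightarrow> ('e,'r) nfun \<Rightarrow> ('e,'r) nfun" where
  "Pn Q n F = (\<lambda>xs \<alpha>. (\<Sum>\<pi>\<in>{\<pi>. \<pi> permutes {0..<n}}. Uword Q (perm_word n \<pi>) F xs \<alpha>) / of_nat (fact n))"

definition vac :: "('e,'r) fock" where
  "vac = (\<lambda>n xs \<alpha>. if n = 0 then 1 else 0)"

definition cre :: "(real \<Rightarrow> real \<Rightarrow> 'r::finite mat2) \<Rightarrow> ('e pt \<Rightarrow> 'r \<Rightarrow> complex) \<Rightarrow> ('e,'r) fock \<Rightarrow> ('e,'r) fock" where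
  "cre Q f \<Phi> = (\<lambda>n. if n = 0 then (\<lambda>xs \<alpha>. 0)
      else Pn Q n (\<lambda>xs \<alpha>. f (hd xs) (hd \<alpha>) * \<Phi> (n - 1) (tl xs) (tl \<alpha>)))"

text \<open>annihilation; note the bilinear pairing \<langle>u,v\<rangle>_V = \<Sum>_k u^k v^k\<close>
definition ann :: "('e::finite pt \<Rightarrow> 'r::finite \<Rightarrow> complex) \<Rightarrow> ('e,'r) fock \<Rightarrow> ('e,'r) fock" where
  "ann f \<Phi> = (\<lambda>n xs \<alpha>. of_nat (Suc n) *
      (\<integral>x. (\<Sum>a\<in>UNIV. \<Phi> (Suc n) (x # xs) (a # \<alpha>) * f x a) \<partial>lborel))"

definition field_op :: "(real \<Rightarrow> real \<Rightarrow> 'r::finite mat2) \<Rightarrow> ('e::finite pt \<Rightarrow> 'r \<Rightarrow> complex) \<Rightarrow> ('e pt \<Rightarrow> 'r \<Rightarrow> complex) \<Rightarrow> ('e,'r) fock \<Rightarrow> ('e,'r) fock" where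
  "field_op Q f f' \<Phi> = (\<lambda>n xs \<alpha>. cre Q f \<Phi> n xs \<alpha> + ann f' \<Phi> n xs \<alpha>)"

text \<open>\<tau>((a^+(f_1)+a^-(f'_1)) \<cdots> (a^+(f_m)+a^-(f'_m))) = (A \<Omega>, \<Omega>), which is the 0-particle component of A \<Omega>\<close>
definition tau_prod :: "(real \<Rightarrow> real \<Rightarrow> 'r::finite mat2) \<Rightarrow> (nat \<Rightarrow> 'e::finite pt \<Rightarrow> 'r \<Rightarrow> complex) \<Rightarrow> (nat \<Rightarrow> 'e pt \<Rightarrow> 'r \<Rightarrow> complex) \<Rightarrow> nat \<Rightarrow> complex" where
  "tau_prod Q f f' m = foldr (\<lambda>k \<Phi>. field_op Q (f k) (f' k) \<Phi>) [1..<Suc m] vac 0 [] []"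

definition pair_partitions :: "nat \<Rightarrow> nat set set set" where
  "pair_partitions m = {\<xi>. partition_on {1..m} \<xi> \<and> (\<forall>b\<in>\<xi>. card b = 2)}"

definition Ix :: "nat set set \<Rightarrow> nat set" where "Ix \<xi> = Min ` \<xi>"
definition Jx :: "nat set set \<Rightarrow> nat set" where "Jx \<xi> = Max ` \<xi>"

definition ik :: "nat set set \<Rightarrow> nat \<Rightarrow> nat" where
  "ik \<xi> k = rev (sorted_list_of_set (Ix \<xi>)) ! (k - 1)"

definition blk :: "nat set set \<Rightarrow> nat \<Rightarrow> nat set" where
  "blk \<xi> m = (THE b. b \<in> \<xi> \<and> m \<in> b)"

definition jk :: "nat set set \<Rightarrow> nat \<Rightarrow> nat" where
  "jk \<xi> k = Max (blk \<xi> (ik \<xi> k))"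

definition Jsm :: "nat set set \<Rightarrow> nat \<Rightarrow> nat set" where
  "Jsm \<xi> k = {j \<in> Jx \<xi>. ik \<xi> k < j \<and> j \<le> jk \<xi> k \<and> j \<notin> jk \<xi> ` {1..<k}}"

text \<open>bexcl \<xi> k = {min bold-J^(1), ..., min bold-J^(k)}\<close>
primrec bexcl :: "nat set set \<Rightarrow> nat \<Rightarrow> nat set" where
  "bexcl \<xi> 0 = {}"
| "bexcl \<xi> (Suc k) = insert (Min {j \<in> Jx \<xi>. ik \<xi> (Suc k) < j \<and> j \<notin> bexcl \<xi> k}) (bexcl \<xi> k)"

definition bJ :: "nat set set \<Rightarrow> nat \<Rightarrow> nat set" where
  "bJ \<xi> k = {j \<in> Jx \<xi>. ik \<xi> k < j \<and> j \<notin> bexcl \<xi> (k - 1)}"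

definition jsm :: "nat set set \<Rightarrow> nat \<Rightarrow> nat \<Rightarrow> nat" where
  "jsm \<xi> k p = sorted_list_of_set (Jsm \<xi> k) ! (p - 1)"

definition bj :: "nat set set \<Rightarrow> nat \<Rightarrow> nat \<Rightarrow> nat" where
  "bj \<xi> k p = sorted_list_of_set (bJ \<xi> k) ! (p - 1)"

text \<open>C[i,j] on V^{\<otimes>m}; tensors are component functions (nat \<Rightarrow> 'r) \<Rightarrow> complex\<close>
definition apply_pair :: "'r::finite mat2 \<Rightarrow> nat \<Rightarrow> nat \<Rightarrow> ((nat \<Rightarrow> 'r) \<Rightarrow> complex) \<Rightarrow> ((nat \<Rightarrow> 'r) \<Rightarrow> complex)" where
  "apply_pair C i j F = (\<lambda>\<alpha>. \<Sum>cd\<in>UNIV. C (\<alpha> i, \<alpha> j) cd * F (\<alpha>(i := fst cd, j := snd cd)))"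

definition Qk :: "(real \<Rightarrow> real \<Rightarrow> 'r::finite mat2) \<Rightarrow> nat set set \<Rightarrow> nat \<Rightarrow> (nat \<Rightarrow> 'e pt)
    \<Rightarrow> ((nat \<Rightarrow> 'r) \<Rightarrow> complex) \<Rightarrow> ((nat \<Rightarrow> 'r) \<Rightarrow> complex)" where
  "Qk Q \<xi> k x F = foldr (\<lambda>p G. apply_pair (Q (fst (x (ik \<xi> k))) (fst (x (jsm \<xi> k p))))
                                          (bj \<xi> k p) (bj \<xi> k (Suc p)) G)
                   [1..<card (Jsm \<xi> k)] F"

definition Qxi :: "(real \<Rightarrow> real \<Rightarrow> 'r::finite mat2) \<Rightarrow> nat set set \<Rightarrow> nat \<Rightarrow> (nat \<Rightarrow> 'e pt)
    \<Rightarrow> ((nat \<Rightarrow> 'r) \<Rightarrow> complex) \<Rightarrow> ((nat \<Rightarrow> 'r) \<Rightarrow> complex)" where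
  "Qxi Q \<xi> n x F = foldr (\<lambda>k G. Qk Q \<xi> k x G) (rev [1..<Suc n]) F"

definition Txi :: "nat set set \<Rightarrow> nat \<Rightarrow> ((nat \<Rightarrow> 'r::finite) \<Rightarrow> complex) \<Rightarrow> complex" where
  "Txi \<xi> n F = (\<Sum>\<alpha>\<in>PiE {1..2*n} (\<lambda>_. UNIV).
      (\<Prod>k\<in>{1..n}. if \<alpha> (ik \<xi> k) = \<alpha> (bj \<xi> k 1) then 1 else 0) * F \<alpha>)"

definition htensor :: "nat set set \<Rightarrow> nat \<Rightarrow> (nat \<Rightarrow> 'e pt \<Rightarrow> 'r \<Rightarrow> complex) \<Rightarrow> (nat \<Rightarrow> 'e pt \<Rightarrow> 'r \<Rightarrow> complex)
    \<Rightarrow> (nat \<Rightarrow> 'e pt) \<Rightarrow> (nat \<Rightarrow> 'r) \<Rightarrow> complex" where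
  "htensor \<xi> n f f' x = (\<lambda>\<alpha>. \<Prod>m\<in>{1..2*n}. (if m \<in> Ix \<xi> then f' m else f m) (x m) (\<alpha> m))"

text \<open>Integration w.r.t. \<Otimes>_{b\<in>\<xi>} \<sigma>^(2): one variable u_b \<in> X per pair b, x_m = u_(block of m)\<close>
definition rhs_term :: "(real \<Rightarrow> real \<Rightarrow> 'r::finite mat2) \<Rightarrow> nat set set \<Rightarrow> nat
    \<Rightarrow> (nat \<Rightarrow> 'e::finite pt \<Rightarrow> 'r \<Rightarrow> complex) \<Rightarrow> (nat \<Rightarrow> 'e pt \<Rightarrow> 'r \<Rightarrow> complex) \<Rightarrow> complex" where
  "rhs_term Q \<xi> n f f' = (\<integral>u. (let x = (\<lambda>m. u (blk \<xi> m)) in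
       Txi \<xi> n (Qxi Q \<xi> n x (htensor \<xi> n f f' x))) \<partial>(PiM \<xi> (\<lambda>_. (lborel :: 'e pt measure))))"

end

theory Submission
  imports Defs
begin

text \<open>The operators act on the vacuum from the right, one label at a time. By the Coxeter presentation
  of the symmetric group $U_\pi$ is well defined, so the symmetriser inside a creation operator is
  absorbed by the outer one, and the coset decomposition
  $S_{n+1} = \bigcup_k S_n\,\pi_0 \cdots \pi_{k-1}$ turns the annihilation of a symmetrised
  function into a sum over the particle $k$ which $U_0 \cdots U_{k-1}$ moves to the front, where it is
  contracted. Every intermediate vector is therefore $P_p$ applied to a sum over partial pairings of
  the labels. Moving the variable of particle $k$ past its predecessors produces the product of
  $Q$'s in $Q^{(k)}$, but the contracted tensor slot is always the first one; this is why the variables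
  are indexed by $J^{(k)}$ and the slots by the bold $J^{(k)}$.\<close>

section \<open>Words in adjacent transpositions\<close>

text \<open>In the Fock computation each contraction happens as soon as an annihilation operator
  acts, whereas \<open>Txi\<close> contracts only after all the products \<open>Qk\<close> have been
  applied. The orders agree because each \<open>Qk\<close> acts only on slots not yet contracted, so
  the earlier Kronecker deltas are scalars for it. The link is \<open>amplitude\<close>, a recursion
  over the labels from \<open>m\<close> downwards: its integrals obey the recursion of the field
  operators, and partial contractions of the integrand of \<open>rhs_term\<close> obey its own
  recursion. At each stage the surviving variables (\<open>unpaired\<close>) and the surviving slots
  (\<open>slots\<close>) may be different sets of labels; they have equal size and are matched by
  rank. Functions are concrete representatives rather than L2 classes, so the identities are proved
  at every value of the free variables. This works because the dominating function is a product:
  each pair contributes two L2 factors in its own variable, the free variables a constant. As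
  \<open>perm_word\<close> picks an arbitrary word, the word problem for the Coxeter relations has
  to be solved: normal forms are closed under appending a letter and are told apart by their
  permutations.\<close>

lemma word_perm_simps [simp]:
  "word_perm [] = id"
  "word_perm (i # w) = adj_swap i \<circ> word_perm w"
  by (simp_all add: word_perm_def)

lemma word_perm_append [simp]: "word_perm (v @ w) = word_perm v \<circ> word_perm w"
  by (induction v) (simp_all add: comp_assoc)

lemma adj_swap_adj_swap [simp]: "adj_swap i (adj_swap i k) = k"
  by (simp add: adj_swap_def)

lemma bij_word_perm: "bij (word_perm w)"
proof (induction w)
  case (Cons i w)
  have "bij (adj_swap i)"
    by (rule o_bij[of "adj_swap i"]) (auto simp: fun_eq_iff)
  with Cons show ?case unfolding word_perm_simps using bij_comp by blast
qed (simp add: bij_id[unfolded id_def])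

lemma word_perm_permutes:
  assumes "\<forall>i\<in>set w. Suc i < n"
  shows "word_perm w permutes {0..<n}"
proof -
  have "word_perm w k = k" if "k \<ge> n" for k
    using assms that by (induction w) (auto simp: adj_swap_def)
  then show ?thesis
    using bij_word_perm[of w] unfolding permutes_def bij_iff by auto
qed

lemma word_perm_map_Suc [simp]:
  "word_perm (map Suc w) 0 = 0"
  "word_perm (map Suc w) (Suc k) = Suc (word_perm w k)"
  by (induction w) (auto simp: adj_swap_def)

text \<open>Shifted words fix 0, so the tail \<open>[0..<k]\<close> of a normal form can be read off
  its permutation: \<open>k\<close> is the preimage of 0. This separates the cosets.\<close>

lemma word_perm_upt: "word_perm [0..<k] k = 0"
  by (induction k) (auto simp: adj_swap_def)

text \<open>The bounds on the letters are part of the relations because the square and braid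
  relations for \<open>Uop\<close> are established only on lists that contain the positions
  involved.\<close>

inductive coxeter :: "nat \<Rightarrow> nat list \<Rightarrow> nat list \<Rightarrow> bool" for n where
  cox_refl: "coxeter n w w"
| cox_sym: "coxeter n v w \<Longrightarrow> coxeter n w v"
| cox_trans: "coxeter n u v \<Longrightarrow> coxeter n v w \<Longrightarrow> coxeter n u w"
| cox_append: "coxeter n v v' \<Longrightarrow> coxeter n w w' \<Longrightarrow> coxeter n (v @ w) (v' @ w')"
| cox_square: "Suc i < n \<Longrightarrow> coxeter n [i, i] []"
| cox_far: "Suc i < j \<Longrightarrow> Suc j < n \<Longrightarrow> coxeter n [i, j] [j, i]"
| cox_braid: "Suc (Suc i) < n \<Longrightarrow> coxeter n [i, Suc i, i] [Suc i, i, Suc i]"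

lemma coxeter_word_perm: "coxeter n v w \<Longrightarrow> word_perm v = word_perm w"
  by (induction rule: coxeter.induct) (auto simp: fun_eq_iff adj_swap_def)

lemma coxeter_map_Suc: "coxeter n v w \<Longrightarrow> coxeter (Suc n) (map Suc v) (map Suc w)"
  by (induction rule: coxeter.induct) (auto intro: coxeter.intros)

lemma coxeter_upt_far:
  assumes "k < j" "Suc j < n"
  shows "coxeter n ([0..<k] @ [j]) (j # [0..<k])"
  using assms
proof (induction k)
  case (Suc k)
  have "coxeter n ([0..<k] @ [k, j]) ([0..<k] @ [j, k])"
    using Suc.prems by (intro coxeter.cox_append coxeter.cox_refl coxeter.cox_far) auto
  moreover have "coxeter n (([0..<k] @ [j]) @ [k]) ((j # [0..<k]) @ [k])"
    using Suc by (intro coxeter.cox_append coxeter.cox_refl) auto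
  ultimately show ?case by (auto intro: coxeter.cox_trans)
qed (auto intro: coxeter.cox_refl)

text \<open>The letters to the right of \<open>Suc j\<close> commute with \<open>j\<close>; one
  braid move on \<open>[j, Suc j, j]\<close> then produces \<open>Suc j\<close> in front, which
  commutes with everything further left. The braid move is what raises the letter by one.\<close>

lemma coxeter_upt_less:
  assumes "Suc j < k" "k < n"
  shows "coxeter n ([0..<k] @ [j]) (Suc j # [0..<k])"
  using assms
proof (induction k)
  case (Suc k)
  show ?case
  proof (cases "Suc j = k")
    case True
    have "coxeter n ([0..<j] @ [j, Suc j, j]) ([0..<j] @ [Suc j, j, Suc j])"
      using Suc.prems True by (intro coxeter.cox_append coxeter.cox_refl coxeter.cox_braid) auto
    moreover have "coxeter n (([0..<j] @ [Suc j]) @ [j, Suc j]) ((Suc j # [0..<j]) @ [j, Suc j])"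
      using Suc.prems True by (intro coxeter.cox_append coxeter.cox_refl coxeter_upt_far) auto
    ultimately show ?thesis using True[symmetric] by (auto intro: coxeter.cox_trans)
  next
    case False
    have "coxeter n ([0..<k] @ [k, j]) ([0..<k] @ [j, k])"
      using Suc.prems False by (intro coxeter.cox_append coxeter.cox_refl coxeter.cox_far[THEN coxeter.cox_sym]) auto
    moreover have "coxeter n (([0..<k] @ [j]) @ [k]) ((Suc j # [0..<k]) @ [k])"
      using Suc False by (intro coxeter.cox_append coxeter.cox_refl) auto
    ultimately show ?thesis by (auto intro: coxeter.cox_trans)
  qed
qed auto

text \<open>Normal forms: the words \<^term>\<open>[0..<k]\<close> represent the right cosets of the stabiliser of 0,
  which is generated by the letters \<^term>\<open>Suc i\<close>.\<close>
primrec coset_words :: "nat \<Rightarrow> nat list set" where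
  "coset_words 0 = {[]}"
| "coset_words (Suc n) = (\<lambda>(h, k). map Suc h @ [0..<k]) ` (coset_words n \<times> {..n})"

lemma coset_words_letters: "w \<in> coset_words n \<Longrightarrow> i \<in> set w \<Longrightarrow> Suc i < n"
  by (induction n arbitrary: w i) fastforce+

lemma inj_on_word_perm: "inj_on word_perm (coset_words n)"
proof (induction n)
  case (Suc n)
  show ?case
  proof (rule inj_onI)
    fix v w assume vw: "v \<in> coset_words (Suc n)" "w \<in> coset_words (Suc n)" "word_perm v = word_perm w"
    obtain g k where v: "v = map Suc g @ [0..<k]" and g: "g \<in> coset_words n"
      using vw(1) by auto
    obtain h l where w: "w = map Suc h @ [0..<l]" and h: "h \<in> coset_words n"
      using vw(2) by auto
    have "word_perm v k = 0" "word_perm w l = 0"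
      by (simp_all add: v w word_perm_upt)
    \<comment> \<open>Both are the preimage of 0 under the common permutation.\<close>
    then have "k = l"
      using vw(3) bij_word_perm[of w] by (metis bij_pointE)
    have "word_perm (map Suc g) = word_perm (map Suc h)"
    proof
      fix i
      obtain j where "i = word_perm [0..<k] j"
        using bij_word_perm[of "[0..<k]"] by (metis bij_pointE)
      then show "word_perm (map Suc g) i = word_perm (map Suc h) i"
        using fun_cong[OF vw(3), of j] by (simp add: v w \<open>k = l\<close>)
    qed
    then have "word_perm g = word_perm h"
      by (metis word_perm_map_Suc(2) Suc_inject ext)
    then show "v = w"
      using Suc g h \<open>k = l\<close> by (simp add: v w inj_on_eq_iff)
  qed
qed simp

text \<open>The new letter extends the tail \<open>[0..<k]\<close>, cancels its last letter, or
  passes through it and comes out as a shifted letter, which \<open>h\<close> absorbs by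
  induction.\<close>

lemma coset_words_snoc:
  assumes "w \<in> coset_words n" "Suc j < n"
  shows "\<exists>w'\<in>coset_words n. coxeter n (w @ [j]) w'"
  using assms
proof (induction n arbitrary: w j)
  case (Suc n)
  obtain h k where w: "w = map Suc h @ [0..<k]" and h: "h \<in> coset_words n" and k: "k \<le> n"
    using Suc.prems by auto
  have step: "\<exists>w'\<in>coset_words (Suc n). coxeter (Suc n) (w @ [j]) w'"
    if j': "Suc j' < n" and c: "coxeter (Suc n) ([0..<k] @ [j]) (Suc j' # [0..<k])" for j'
  proof -
    obtain h' where h': "h' \<in> coset_words n" "coxeter n (h @ [j']) h'"
      using Suc.IH[OF h j'] by blast
    have "coxeter (Suc n) (w @ [j]) (map Suc h @ (Suc j' # [0..<k]))"
      unfolding w append_assoc by (intro coxeter.cox_append coxeter.cox_refl c)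
    moreover have "coxeter (Suc n) (map Suc (h @ [j']) @ [0..<k]) (map Suc h' @ [0..<k])"
      by (intro coxeter.cox_append coxeter.cox_refl coxeter_map_Suc h')
    ultimately have "coxeter (Suc n) (w @ [j]) (map Suc h' @ [0..<k])"
      by (auto intro: coxeter.cox_trans)
    then show ?thesis using h' k by force
  qed
  consider "j = k" | "k = Suc j" | "k < j" | "Suc j < k" by linarith
  then show ?case
  proof cases
    case 1
    then have "w @ [j] = (\<lambda>(h, k). map Suc h @ [0..<k]) (h, Suc k)" by (simp add: w)
    moreover have "(h, Suc k) \<in> coset_words n \<times> {..n}" using Suc.prems(2) h 1 by simp
    ultimately have "w @ [j] \<in> coset_words (Suc n)"
      unfolding coset_words.simps by (rule image_eqI)
    then show ?thesis by (blast intro: coxeter.cox_refl)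
  next
    case 2
    have "coxeter (Suc n) ((map Suc h @ [0..<j]) @ [j, j]) ((map Suc h @ [0..<j]) @ [])"
      using Suc.prems(2) by (intro coxeter.cox_append coxeter.cox_refl coxeter.cox_square)
    moreover have "map Suc h @ [0..<j] \<in> coset_words (Suc n)" using h k 2 by force
    moreover have "w @ [j] = (map Suc h @ [0..<j]) @ [j, j]" using 2 by (simp add: w)
    ultimately show ?thesis by (metis append_Nil2)
  next
    case 3
    \<comment> \<open>A letter above \<open>k\<close> passes unchanged and is therefore the shift of
      \<open>j - 1\<close>; in the last case it comes out raised, as the shift of \<open>j\<close>
      itself.\<close>
    then show ?thesis using Suc.prems coxeter_upt_far[OF 3, of "Suc n"]
      by (intro step[of "j - 1"]) auto
  next
    case 4
    then show ?thesis using k coxeter_upt_less[OF 4, of "Suc n"] by (intro step[of j]) auto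
  qed
qed auto

lemma ex_coset_word:
  assumes "\<forall>i\<in>set w. Suc i < n"
  shows "\<exists>w'\<in>coset_words n. coxeter n w w'"
  using assms
proof (induction w rule: rev_induct)
  case Nil
  have "[] \<in> coset_words n" by (induction n) force+
  then show ?case by (blast intro: coxeter.cox_refl)
next
  case (snoc j w)
  then obtain w' where w': "w' \<in> coset_words n" "coxeter n w w'" by auto
  obtain w'' where "w'' \<in> coset_words n" "coxeter n (w' @ [j]) w''"
    using coset_words_snoc[OF w'(1), of j] snoc.prems by auto
  then show ?case
    using w' by (meson coxeter.cox_append coxeter.cox_refl coxeter.cox_trans)
qed

text \<open>Completeness of the Coxeter relations: the normal forms of the two words have the same
  permutation and hence coincide.\<close>

lemma coxeter_if_word_perm_eq:
  assumes "\<forall>i\<in>set v. Suc i < n" "\<forall>i\<in>set w. Suc i < n" "word_perm v = word_perm w"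
  shows "coxeter n v w"
proof -
  obtain v' w' where "v' \<in> coset_words n" "coxeter n v v'" "w' \<in> coset_words n" "coxeter n w w'"
    using ex_coset_word assms(1,2) by meson
  moreover from this have "v' = w'"
    using coxeter_word_perm assms(3) inj_on_word_perm by (metis inj_on_eq_iff)
  ultimately show ?thesis by (blast intro: coxeter.cox_trans coxeter.cox_sym)
qed

lemma finite_coset_words: "finite (coset_words n)"
  by (induction n) auto

lemma inj_on_coset_word: "inj_on (\<lambda>(h, k). map Suc h @ [0..<k]) (coset_words n \<times> {..n})"
proof (rule inj_onI, clarify)
  fix g k h l assume eq: "map Suc g @ [0..<k] = map Suc h @ [0..<l]"
  have "word_perm (map Suc g @ [0..<k]) k = 0" "word_perm (map Suc h @ [0..<l]) l = 0"
    by (simp_all add: word_perm_upt)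
  then have "k = l" using eq bij_word_perm by (metis bij_pointE)
  with eq show "g = h \<and> k = l" by simp
qed

lemma card_coset_words: "card (coset_words n) = fact n"
proof (induction n)
  case (Suc n)
  then show ?case
    by (simp only: coset_words.simps card_image[OF inj_on_coset_word]) (simp add: card_cartesian_product)
qed simp

text \<open>Surjectivity comes from counting: the n! normal forms have distinct
  permutations.\<close>

lemma bij_betw_word_perm: "bij_betw word_perm (coset_words n) {\<pi>. \<pi> permutes {0..<n}}"
proof -
  have "word_perm ` coset_words n \<subseteq> {\<pi>. \<pi> permutes {0..<n}}"
    using coset_words_letters word_perm_permutes by blast
  moreover have "card (word_perm ` coset_words n) = card {\<pi>. \<pi> permutes {0..<n}}"
    by (simp add: card_image[OF inj_on_word_perm] card_coset_words card_permutations)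
  ultimately have "word_perm ` coset_words n = {\<pi>. \<pi> permutes {0..<n}}"
    by (intro card_subset_eq finite_permutations) auto
  then show ?thesis using inj_on_word_perm by (simp add: bij_betw_def)
qed

lemma perm_word:
  assumes "\<pi> permutes {0..<n}"
  shows "\<forall>i\<in>set (perm_word n \<pi>). Suc i < n" "word_perm (perm_word n \<pi>) = \<pi>"
proof -
  have "\<pi> \<in> word_perm ` coset_words n"
    using assms bij_betw_word_perm[of n] by (simp add: bij_betw_def)
  then obtain w where "w \<in> coset_words n" "word_perm w = \<pi>" by blast
  then have "\<exists>w. (\<forall>i\<in>set w. Suc i < n) \<and> word_perm w = \<pi>"
    using coset_words_letters by blast
  from someI_ex[OF this]
  show "\<forall>i\<in>set (perm_word n \<pi>). Suc i < n" "word_perm (perm_word n \<pi>) = \<pi>"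
    unfolding perm_word_def by auto
qed

section \<open>The action of words on many-particle functions\<close>

text \<open>The matrix half of \<open>Uop\<close>, split off from the exchange of the variables; the
  analogue of \<open>apply_pair\<close> for indices stored by position instead of by label.\<close>

definition list_pair :: "'r::finite mat2 \<Rightarrow> nat \<Rightarrow> ('r list \<Rightarrow> complex) \<Rightarrow> 'r list \<Rightarrow> complex" where
  "list_pair C i g = (\<lambda>\<alpha>. \<Sum>cd\<in>UNIV. C (\<alpha> ! i, \<alpha> ! Suc i) cd * g (\<alpha>[i := fst cd, Suc i := snd cd]))"

lemma Uop_eq_list_pair:
  "Uop Q i F xs = list_pair (Q (fst (xs ! i)) (fst (xs ! Suc i))) i (F (xs[i := xs ! Suc i, Suc i := xs ! i]))"
  by (simp add: Uop_def list_pair_def)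

lemma Uword_Nil [simp]: "Uword Q [] F = F"
  and Uword_Cons [simp]: "Uword Q (i # w) F = Uop Q i (Uword Q w F)"
  and Uword_append: "Uword Q (v @ w) F = Uword Q v (Uword Q w F)"
  by (simp_all add: Uword_def)

lemma Uop_cong:
  assumes "\<And>ys \<beta>. length ys = length xs \<Longrightarrow> length \<beta> = length \<alpha> \<Longrightarrow> F ys \<beta> = G ys \<beta>"
  shows "Uop Q i F xs \<alpha> = Uop Q i G xs \<alpha>"
  unfolding Uop_def by (intro sum.cong refl arg_cong2[where f="(*)"] assms) simp_all

lemma Uword_cong:
  assumes "\<And>ys \<beta>. length ys = length xs \<Longrightarrow> length \<beta> = length \<alpha> \<Longrightarrow> F ys \<beta> = G ys \<beta>"
  shows "Uword Q w F xs \<alpha> = Uword Q w G xs \<alpha>"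
  using assms by (induction w arbitrary: xs \<alpha>) (auto intro: Uop_cong)

lemma Uop_Suc_Cons: "Uop Q (Suc i) F (x # xs) (a # \<alpha>) = Uop Q i (\<lambda>xs \<alpha>. F (x # xs) (a # \<alpha>)) xs \<alpha>"
  by (simp add: Uop_def)

lemma Uword_map_Suc_Cons:
  "Uword Q (map Suc w) F (x # xs) (a # \<alpha>) = Uword Q w (\<lambda>xs \<alpha>. F (x # xs) (a # \<alpha>)) xs \<alpha>"
proof (induction w arbitrary: xs \<alpha>)
  case (Cons i w)
  have "(\<lambda>xs \<alpha>. Uword Q (map Suc w) F (x # xs) (a # \<alpha>)) = Uword Q w (\<lambda>xs \<alpha>. F (x # xs) (a # \<alpha>))"
    by (intro ext) (rule Cons)
  then show ?case by (simp add: Uop_Suc_Cons)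
qed simp

lemma Uop_sum: "Uop Q i (\<lambda>xs \<alpha>. \<Sum>s\<in>S. F s xs \<alpha>) xs \<alpha> = (\<Sum>s\<in>S. Uop Q i (F s) xs \<alpha>)"
  unfolding Uop_def sum_distrib_left by (rule sum.swap)

lemma Uword_sum: "Uword Q w (\<lambda>xs \<alpha>. \<Sum>s\<in>S. F s xs \<alpha>) xs \<alpha> = (\<Sum>s\<in>S. Uword Q w (F s) xs \<alpha>)"
proof (induction w arbitrary: xs \<alpha>)
  case (Cons i w)
  have "Uword Q w (\<lambda>xs \<alpha>. \<Sum>s\<in>S. F s xs \<alpha>) = (\<lambda>xs \<alpha>. \<Sum>s\<in>S. Uword Q w (F s) xs \<alpha>)"
    by (intro ext) (rule Cons)
  then show ?case by (simp add: Uop_sum)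
qed simp

lemma Uop_mult: "Uop Q i (\<lambda>xs \<alpha>. c * F xs \<alpha>) xs \<alpha> = c * Uop Q i F xs \<alpha>"
  by (simp add: Uop_def sum_distrib_left mult_ac)

lemma Uword_mult: "Uword Q w (\<lambda>xs \<alpha>. c * F xs \<alpha>) xs \<alpha> = c * Uword Q w F xs \<alpha>"
proof (induction w arbitrary: xs \<alpha>)
  case (Cons i w)
  have "Uword Q w (\<lambda>xs \<alpha>. c * F xs \<alpha>) = (\<lambda>xs \<alpha>. c * Uword Q w F xs \<alpha>)"
    by (intro ext) (rule Cons)
  then show ?case by (simp add: Uop_mult)
qed simp

text \<open>The coefficients depend on \<open>xs\<close> but not on the integration variable, so
  linearity of the integral over finite sums suffices.\<close>

lemma
  assumes "\<And>ys \<beta>. length ys = length xs \<Longrightarrow> length \<beta> = length \<alpha> \<Longrightarrow> integrable M (\<lambda>x. G x ys \<beta>)"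
  shows integrable_Uword: "integrable M (\<lambda>x. Uword Q w (G x) xs \<alpha>)"
    and integral_Uword: "Uword Q w (\<lambda>xs \<alpha>. \<integral>x. G x xs \<alpha> \<partial>M) xs \<alpha> = (\<integral>x. Uword Q w (G x) xs \<alpha> \<partial>M)"
proof -
  have "integrable M (\<lambda>x. Uword Q w (G x) xs \<alpha>) \<and>
    Uword Q w (\<lambda>xs \<alpha>. \<integral>x. G x xs \<alpha> \<partial>M) xs \<alpha> = (\<integral>x. Uword Q w (G x) xs \<alpha> \<partial>M)"
    using assms
  proof (induction w arbitrary: xs \<alpha>)
    case (Cons i w)
    have IH: "integrable M (\<lambda>x. Uword Q w (G x) ys \<beta>)"
      "Uword Q w (\<lambda>xs \<alpha>. \<integral>x. G x xs \<alpha> \<partial>M) ys \<beta> = (\<integral>x. Uword Q w (G x) ys \<beta> \<partial>M)"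
      if "length ys = length xs" "length \<beta> = length \<alpha>" for ys \<beta>
      using Cons.IH[of ys \<beta>] Cons.prems that by auto
    have "Uop Q i (Uword Q w (\<lambda>xs \<alpha>. \<integral>x. G x xs \<alpha> \<partial>M)) xs \<alpha> =
        Uop Q i (\<lambda>ys \<beta>. \<integral>x. Uword Q w (G x) ys \<beta> \<partial>M) xs \<alpha>"
      by (rule Uop_cong) (rule IH(2))
    then show ?case
      by (auto simp: Uop_def IH(1) intro!: Bochner_Integration.integrable_sum)
  qed simp
  then show "integrable M (\<lambda>x. Uword Q w (G x) xs \<alpha>)"
    "Uword Q w (\<lambda>xs \<alpha>. \<integral>x. G x xs \<alpha> \<partial>M) xs \<alpha> = (\<integral>x. Uword Q w (G x) xs \<alpha> \<partial>M)" by auto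
qed

text \<open>Every exchange involves the same travelling particle \<open>x\<close>, so all matrices
  share it as first argument. This is the origin of the products in \<open>Qk\<close>.\<close>

lemma Uword_upt_Cons:
  assumes "q \<le> length xs"
  shows "Uword Q [0..<q] F (x # xs) \<alpha> =
    foldr (\<lambda>i. list_pair (Q (fst x) (fst (xs ! i))) i) [0..<q] (F (take q xs @ x # drop q xs)) \<alpha>"
  using assms
proof (induction q arbitrary: F)
  case (Suc q)
  let ?ys = "take q xs @ x # drop q xs"
  have nth: "?ys ! q = x" "?ys ! Suc q = xs ! q"
    using Suc.prems by (simp_all add: nth_append)
  have "?ys = take q xs @ x # xs ! q # drop (Suc q) xs"
    using Suc.prems by (simp add: Cons_nth_drop_Suc)
  then have "?ys[q := xs ! q, Suc q := x] = take (Suc q) xs @ x # drop (Suc q) xs"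
    using Suc.prems by (simp add: list_update_append take_Suc_conv_app_nth)
  then show ?case
    using Suc by (simp add: Uword_append Uop_eq_list_pair nth)
qed simp

section \<open>The Yang-Baxter equation in components\<close>

lemma sum_UNIV_Times:
  "(\<Sum>p\<in>(UNIV :: ('a::finite \<times> 'b::finite) set). g p) = (\<Sum>a\<in>UNIV. \<Sum>b\<in>UNIV. g (a, b))"
  by (simp add: sum.cartesian_product)

lemma sum_if_const: "(\<Sum>x\<in>A. if P then g x else 0) = (if P then sum g A else 0)"
  by simp

lemma mult_if_zero:
  fixes x y :: "'a::mult_zero"
  shows "x * (if P then y else 0) = (if P then x * y else 0)"
    "(if P then y else 0) * x = (if P then y * x else 0)"
  by simp_all

lemma sum_swap_triples:
  fixes g :: "'r::finite \<Rightarrow> 'r \<Rightarrow> 'r \<Rightarrow> 'r \<Rightarrow> 'r \<Rightarrow> 'r \<Rightarrow> 'a::comm_monoid_add"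
  shows "(\<Sum>a\<in>UNIV. \<Sum>b\<in>UNIV. \<Sum>c\<in>UNIV. \<Sum>p\<in>UNIV. \<Sum>q\<in>UNIV. \<Sum>r\<in>UNIV. g a b c p q r) =
    (\<Sum>p\<in>UNIV. \<Sum>q\<in>UNIV. \<Sum>r\<in>UNIV. \<Sum>a\<in>UNIV. \<Sum>b\<in>UNIV. \<Sum>c\<in>UNIV. g a b c p q r)"
  using sum.swap[of "\<lambda>(a, b, c) (p, q, r). g a b c p q r" UNIV UNIV] by (simp add: sum_UNIV_Times)

text \<open>The identity legs leave three internal indices. Their order is the one in which three
  nested \<open>Uop\<close> introduce them, so that a single swap of triples connects the
  two.\<close>

lemma mm_op1_op2_op1:
  "mm (mm (op1 A) (op2 B)) (op1 C) (a, b, c) (p, q, r) =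
    (\<Sum>t\<in>UNIV. \<Sum>u\<in>UNIV. \<Sum>s\<in>UNIV. A (a, b) (t, u) * B (u, c) (s, r) * C (t, s) (p, q))"
proof -
  have "mm (mm (op1 A) (op2 B)) (op1 C) (a, b, c) (p, q, r) =
     (\<Sum>t\<in>UNIV. \<Sum>s\<in>UNIV. \<Sum>u\<in>UNIV. A (a, b) (t, u) * B (u, c) (s, r) * C (t, s) (p, q))"
    by (simp add: mm_def op1_def op2_def sum_UNIV_Times mult_if_zero sum_if_const sum_distrib_right)
  also have "\<dots> = (\<Sum>t\<in>UNIV. \<Sum>u\<in>UNIV. \<Sum>s\<in>UNIV. A (a, b) (t, u) * B (u, c) (s, r) * C (t, s) (p, q))"
    by (intro sum.cong refl sum.swap)
  finally show ?thesis .
qed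

lemma mm_op2_op1_op2:
  "mm (mm (op2 A) (op1 B)) (op2 C) (a, b, c) (p, q, r) =
    (\<Sum>t\<in>UNIV. \<Sum>u\<in>UNIV. \<Sum>s\<in>UNIV. A (b, c) (t, u) * B (a, t) (p, s) * C (s, u) (q, r))"
proof -
  have "mm (mm (op2 A) (op1 B)) (op2 C) (a, b, c) (p, q, r) =
     (\<Sum>s\<in>UNIV. \<Sum>u\<in>UNIV. \<Sum>t\<in>UNIV. A (b, c) (t, u) * B (a, t) (p, s) * C (s, u) (q, r))"
    by (simp add: mm_def op1_def op2_def sum_UNIV_Times mult_if_zero sum_if_const sum_distrib_right)
  also have "\<dots> = (\<Sum>s\<in>UNIV. \<Sum>t\<in>UNIV. \<Sum>u\<in>UNIV. A (b, c) (t, u) * B (a, t) (p, s) * C (s, u) (q, r))"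
    by (intro sum.cong refl sum.swap)
  also have "\<dots> = (\<Sum>t\<in>UNIV. \<Sum>s\<in>UNIV. \<Sum>u\<in>UNIV. A (b, c) (t, u) * B (a, t) (p, s) * C (s, u) (q, r))"
    by (rule sum.swap)
  also have "\<dots> = (\<Sum>t\<in>UNIV. \<Sum>u\<in>UNIV. \<Sum>s\<in>UNIV. A (b, c) (t, u) * B (a, t) (p, s) * C (s, u) (q, r))"
    by (intro sum.cong refl sum.swap)
  finally show ?thesis .
qed

locale braided_kernel =
  fixes Q :: "real \<Rightarrow> real \<Rightarrow> 'r::finite mat2"
  assumes Q_cont: "\<And>a b. continuous_on UNIV (\<lambda>p::real \<times> real. Q (fst p) (snd p) a b)"
    and Q_unitary1: "\<And>y1 y2. mm (adjm (Q y1 y2)) (Q y1 y2) = idm"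
    and Q_unitary2: "\<And>y1 y2. mm (Q y1 y2) (adjm (Q y1 y2)) = idm"
    and Q_adj: "\<And>y1 y2. adjm (Q y1 y2) = Q y2 y1"
    and Q_braid: "\<And>y1 y2 y3. mm (mm (op1 (Q y1 y2)) (op2 (Q y1 y3))) (op1 (Q y2 y3))
                              = mm (mm (op2 (Q y2 y3)) (op1 (Q y1 y3))) (op2 (Q y1 y2))"
begin

lemma list_update_pair_twice: "xs[i := a, Suc i := b, i := c, Suc i := d] = xs[i := c, Suc i := d]"
  by (metis list_update_overwrite list_update_swap n_not_Suc_n)

text \<open>The second exchange uses the matrix with swapped arguments, which by
  \<open>Q_adj\<close> is the adjoint and by unitarity the inverse of the first.\<close>

lemma Uop_square:
  assumes "Suc i < length xs" "Suc i < length \<alpha>"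
  shows "Uop Q i (Uop Q i F) xs \<alpha> = F xs \<alpha>"
proof -
  let ?y = "fst (xs ! i)" and ?z = "fst (xs ! Suc i)" and ?u = "(\<alpha> ! i, \<alpha> ! Suc i)"
  have "Uop Q i (Uop Q i F) xs \<alpha> =
      (\<Sum>v\<in>UNIV. \<Sum>w\<in>UNIV. Q ?y ?z ?u v * Q ?z ?y v w * F xs (\<alpha>[i := fst w, Suc i := snd w]))"
    using assms by (simp add: Uop_def sum_distrib_left mult.assoc list_update_pair_twice)
  also have "\<dots> = (\<Sum>w\<in>UNIV. mm (Q ?y ?z) (Q ?z ?y) ?u w * F xs (\<alpha>[i := fst w, Suc i := snd w]))"
    by (subst sum.swap) (simp add: mm_def sum_distrib_right)
  also have "\<dots> = (\<Sum>w\<in>UNIV. if w = ?u then F xs (\<alpha>[i := fst w, Suc i := snd w]) else 0)"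
    using Q_unitary2[of ?y ?z] unfolding Q_adj by (intro sum.cong) (auto simp: idm_def)
  also have "\<dots> = F xs \<alpha>" by simp
  finally show ?thesis .
qed

lemma Uop_far:
  assumes "Suc i < j"
  shows "Uop Q i (Uop Q j F) xs \<alpha> = Uop Q j (Uop Q i F) xs \<alpha>"
proof -
  have "Uop Q i (Uop Q j F) xs \<alpha> = (\<Sum>v\<in>UNIV. \<Sum>w\<in>UNIV.
      Q (fst (xs ! i)) (fst (xs ! Suc i)) (\<alpha> ! i, \<alpha> ! Suc i) v
    * (Q (fst (xs ! j)) (fst (xs ! Suc j)) (\<alpha> ! j, \<alpha> ! Suc j) w
    * F (xs[i := xs ! Suc i, Suc i := xs ! i, j := xs ! Suc j, Suc j := xs ! j])
        (\<alpha>[i := fst v, Suc i := snd v, j := fst w, Suc j := snd w])))"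
    using assms by (simp add: Uop_def sum_distrib_left)
  also have "\<dots> = (\<Sum>w\<in>UNIV. \<Sum>v\<in>UNIV.
      Q (fst (xs ! j)) (fst (xs ! Suc j)) (\<alpha> ! j, \<alpha> ! Suc j) w
    * (Q (fst (xs ! i)) (fst (xs ! Suc i)) (\<alpha> ! i, \<alpha> ! Suc i) v
    * F (xs[j := xs ! Suc j, Suc j := xs ! j, i := xs ! Suc i, Suc i := xs ! i])
        (\<alpha>[j := fst w, Suc j := snd w, i := fst v, Suc i := snd v])))"
    using assms by (subst sum.swap, intro sum.cong refl) (simp_all add: list_update_swap mult_ac)
  also have "\<dots> = Uop Q j (Uop Q i F) xs \<alpha>"
    using assms by (simp add: Uop_def sum_distrib_left)
  finally show ?thesis .
qed

text \<open>Both sides evaluate \<open>F\<close> at the same reversed triple of variables (this is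
  \<open>G\<close> below), and their coefficients are the two sides of
  \<open>Q_braid\<close>.\<close>

lemma Uop_braid:
  assumes "Suc (Suc i) < length xs" "Suc (Suc i) < length \<alpha>"
  shows "Uop Q i (Uop Q (Suc i) (Uop Q i F)) xs \<alpha> = Uop Q (Suc i) (Uop Q i (Uop Q (Suc i) F)) xs \<alpha>"
proof -
  define a b c where "a = \<alpha> ! i" and "b = \<alpha> ! Suc i" and "c = \<alpha> ! Suc (Suc i)"
  define x y z where "x = fst (xs ! i)" and "y = fst (xs ! Suc i)" and "z = fst (xs ! Suc (Suc i))"
  note abc = a_def b_def c_def x_def y_def z_def
  define G where "G p q r = F (xs[i := xs ! Suc (Suc i), Suc i := xs ! Suc i, Suc (Suc i) := xs ! i])
    (\<alpha>[i := p, Suc i := q, Suc (Suc i) := r])" for p q r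
  have nth_upd: "zs[l := u] ! k = (if l = k then u else zs ! k)" if "k < length zs" for zs :: "'z list" and l k u
    using that by (cases "l = k") simp_all
  have upd1: "zs[i := u1, Suc i := u2, Suc (Suc i) := u3, i := u4, Suc i := u5] =
      zs[i := u4, Suc i := u5, Suc (Suc i) := u3]" for zs :: "'z list" and u1 u2 u3 u4 u5
    by (rule nth_equalityI) (auto simp: nth_upd)
  have upd2: "zs[Suc i := u1, Suc (Suc i) := u2, i := u3, Suc i := u4, Suc (Suc i) := u5] =
      zs[i := u3, Suc i := u4, Suc (Suc i) := u5]" for zs :: "'z list" and u1 u2 u3 u4 u5
    by (rule nth_equalityI) (auto simp: nth_upd)
  have "Uop Q i (Uop Q (Suc i) (Uop Q i F)) xs \<alpha> =
    (\<Sum>t\<in>UNIV. \<Sum>u\<in>UNIV. \<Sum>s\<in>UNIV. \<Sum>r\<in>UNIV. \<Sum>p\<in>UNIV. \<Sum>q\<in>UNIV.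
      Q x y (a, b) (t, u) * Q x z (u, c) (s, r) * Q y z (t, s) (p, q) * G p q r)"
    using assms by (simp add: Uop_def sum_UNIV_Times sum_distrib_left upd1 G_def abc mult.assoc)
  also have "\<dots> = (\<Sum>r\<in>UNIV. \<Sum>p\<in>UNIV. \<Sum>q\<in>UNIV.
      mm (mm (op1 (Q x y)) (op2 (Q x z))) (op1 (Q y z)) (a, b, c) (p, q, r) * G p q r)"
    unfolding mm_op1_op2_op1 sum_distrib_right by (rule sum_swap_triples)
  also have "\<dots> = (\<Sum>r\<in>UNIV. \<Sum>p\<in>UNIV. \<Sum>q\<in>UNIV.
      mm (mm (op2 (Q y z)) (op1 (Q x z))) (op2 (Q x y)) (a, b, c) (p, q, r) * G p q r)"
    unfolding Q_braid ..
  also have "\<dots> = (\<Sum>t\<in>UNIV. \<Sum>u\<in>UNIV. \<Sum>s\<in>UNIV. \<Sum>r\<in>UNIV. \<Sum>p\<in>UNIV. \<Sum>q\<in>UNIV.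
      Q y z (b, c) (t, u) * Q x z (a, t) (p, s) * Q x y (s, u) (q, r) * G p q r)"
    unfolding mm_op2_op1_op2 sum_distrib_right by (rule sum_swap_triples)
  also have "\<dots> = (\<Sum>t\<in>UNIV. \<Sum>u\<in>UNIV. \<Sum>p\<in>UNIV. \<Sum>s\<in>UNIV. \<Sum>q\<in>UNIV. \<Sum>r\<in>UNIV.
      Q y z (b, c) (t, u) * Q x z (a, t) (p, s) * Q x y (s, u) (q, r) * G p q r)"
  \<comment> \<open>The nested \<open>Uop\<close> on the right introduce the index pairs
    \<open>(p, s)\<close> and \<open>(q, r)\<close>, so the sums are permuted into that
    order.\<close>
  proof (rule sum.cong[OF refl], rule sum.cong[OF refl])
    fix t u
    let ?f = "\<lambda>s r p q. Q y z (b, c) (t, u) * Q x z (a, t) (p, s) * Q x y (s, u) (q, r) * G p q r"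
    have "(\<Sum>s\<in>UNIV. \<Sum>r\<in>UNIV. \<Sum>p\<in>UNIV. \<Sum>q\<in>UNIV. ?f s r p q) =
        (\<Sum>s\<in>UNIV. \<Sum>p\<in>UNIV. \<Sum>r\<in>UNIV. \<Sum>q\<in>UNIV. ?f s r p q)"
      by (intro sum.cong refl sum.swap)
    also have "\<dots> = (\<Sum>p\<in>UNIV. \<Sum>s\<in>UNIV. \<Sum>r\<in>UNIV. \<Sum>q\<in>UNIV. ?f s r p q)"
      by (rule sum.swap)
    also have "\<dots> = (\<Sum>p\<in>UNIV. \<Sum>s\<in>UNIV. \<Sum>q\<in>UNIV. \<Sum>r\<in>UNIV. ?f s r p q)"
      by (intro sum.cong refl sum.swap)
    finally show "(\<Sum>s\<in>UNIV. \<Sum>r\<in>UNIV. \<Sum>p\<in>UNIV. \<Sum>q\<in>UNIV. ?f s r p q) =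
      (\<Sum>p\<in>UNIV. \<Sum>s\<in>UNIV. \<Sum>q\<in>UNIV. \<Sum>r\<in>UNIV. ?f s r p q)" .
  qed
  also have "\<dots> = Uop Q (Suc i) (Uop Q i (Uop Q (Suc i) F)) xs \<alpha>"
    using assms by (simp add: Uop_def sum_UNIV_Times sum_distrib_left upd2 G_def abc mult.assoc)
  finally show ?thesis .
qed

text \<open>With \<open>coxeter_if_word_perm_eq\<close> this makes U_pi independent of the word
  chosen for pi.\<close>

lemma coxeter_Uword:
  assumes "coxeter n v w" "length xs = n" "length \<alpha> = n"
  shows "Uword Q v F xs \<alpha> = Uword Q w F xs \<alpha>"
  using assms
proof (induction arbitrary: F xs \<alpha> rule: coxeter.induct)
  case (cox_append v v' w w')
  have "Uword Q v (Uword Q w F) xs \<alpha> = Uword Q v (Uword Q w' F) xs \<alpha>"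
    using cox_append by (intro Uword_cong) simp
  then show ?case using cox_append by (simp add: Uword_append)
next
  case (cox_far i j)
  then show ?case using Uop_far[of i j F xs \<alpha>] by simp
qed (simp_all add: Uop_square Uop_braid)

text \<open>On lists of length \<open>n\<close> this is n! times \<open>Pn\<close>, with canonical
  words in place of those picked by \<open>SOME\<close>; factorials are kept outside.\<close>

definition symmetrizer :: "nat \<Rightarrow> ('e,'r) nfun \<Rightarrow> ('e,'r) nfun" where
  "symmetrizer n F = (\<lambda>xs \<alpha>. \<Sum>w\<in>coset_words n. Uword Q w F xs \<alpha>)"

lemma Pn_eq_symmetrizer:
  assumes "length xs = n" "length \<alpha> = n"
  shows "Pn Q n F xs \<alpha> = symmetrizer n F xs \<alpha> / fact n"
proof -
  have "Uword Q (perm_word n (word_perm w)) F xs \<alpha> = Uword Q w F xs \<alpha>" if w: "w \<in> coset_words n" for w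
  proof -
    have l: "\<forall>i\<in>set w. Suc i < n" using w coset_words_letters by blast
    show ?thesis
      using assms l perm_word[OF word_perm_permutes[OF l]]
      by (intro coxeter_Uword[OF coxeter_if_word_perm_eq])
  qed
  then show ?thesis
    by (simp add: Pn_def symmetrizer_def sum.reindex_bij_betw[OF bij_betw_word_perm, symmetric])
qed

text \<open>The shifted part of a normal form never touches the head, so it symmetrises the tail
  alone; \<open>[0..<k]\<close> inserts the head at position \<open>k\<close> of
  \<open>F\<close>.\<close>

lemma symmetrizer_Cons:
  "symmetrizer (Suc n) F (x # xs) (a # \<alpha>) =
    symmetrizer n (\<lambda>xs \<alpha>. \<Sum>k\<le>n. Uword Q [0..<k] F (x # xs) (a # \<alpha>)) xs \<alpha>"
  unfolding symmetrizer_def coset_words.simps sum.reindex[OF inj_on_coset_word]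
  by (simp add: Uword_sum sum.cartesian_product Uword_append Uword_map_Suc_Cons case_prod_beta comp_def)

text \<open>Right multiplication by a transposition permutes the normal forms up to Coxeter
  congruence.\<close>

lemma symmetrizer_Uop:
  assumes "Suc i < n" "length xs = n" "length \<alpha> = n"
  shows "symmetrizer n (Uop Q i F) xs \<alpha> = symmetrizer n F xs \<alpha>"
proof -
  have "\<exists>c. \<forall>w\<in>coset_words n. c w \<in> coset_words n \<and> coxeter n (w @ [i]) (c w)"
    using coset_words_snoc[OF _ assms(1)] by (intro bchoice) blast
  then obtain c where c: "\<And>w. w \<in> coset_words n \<Longrightarrow> c w \<in> coset_words n"
    "\<And>w. w \<in> coset_words n \<Longrightarrow> coxeter n (w @ [i]) (c w)" by blast
  have "inj_on c (coset_words n)"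
  proof (rule inj_onI)
    fix v w assume vw: "v \<in> coset_words n" "w \<in> coset_words n" "c v = c w"
    then have "word_perm (v @ [i]) = word_perm (w @ [i])"
      by (metis c(2) coxeter_word_perm)
    then have "word_perm v (adj_swap i k) = word_perm w (adj_swap i k)" for k
      by (simp add: fun_eq_iff)
    then have "word_perm v = word_perm w"
      by (metis adj_swap_adj_swap ext)
    then show "v = w" using vw inj_onD[OF inj_on_word_perm] by blast
  qed
  then have bij: "bij_betw c (coset_words n) (coset_words n)"
    using c(1) finite_coset_words by (simp add: bij_betw_def endo_inj_surj image_subset_iff)
  have "symmetrizer n (Uop Q i F) xs \<alpha> = (\<Sum>w\<in>coset_words n. Uword Q (w @ [i]) F xs \<alpha>)"
    by (simp add: symmetrizer_def Uword_append)
  also have "\<dots> = (\<Sum>w\<in>coset_words n. Uword Q (c w) F xs \<alpha>)"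
    using c(2) assms by (intro sum.cong refl coxeter_Uword)
  also have "\<dots> = symmetrizer n F xs \<alpha>"
    unfolding symmetrizer_def by (rule sum.reindex_bij_betw[OF bij])
  finally show ?thesis .
qed

lemma symmetrizer_Uword:
  assumes "\<forall>i\<in>set w. Suc i < n" "length xs = n" "length \<alpha> = n"
  shows "symmetrizer n (Uword Q w F) xs \<alpha> = symmetrizer n F xs \<alpha>"
  using assms by (induction w) (simp_all add: symmetrizer_Uop)

lemma symmetrizer_cong:
  assumes "\<And>ys \<beta>. length ys = length xs \<Longrightarrow> length \<beta> = length \<alpha> \<Longrightarrow> F ys \<beta> = G ys \<beta>"
  shows "symmetrizer n F xs \<alpha> = symmetrizer n G xs \<alpha>"
  unfolding symmetrizer_def by (rule sum.cong[OF refl Uword_cong[OF assms]])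

text \<open>Permuting all particles but the first is the action of a shifted word, which the larger
  symmetriser absorbs; \<open>fact n\<close> counts these words.\<close>

lemma symmetrizer_tensor:
  assumes "length xs = Suc n" "length \<alpha> = Suc n"
  shows "symmetrizer (Suc n) (\<lambda>xs \<alpha>. f (hd xs) (hd \<alpha>) * symmetrizer n F (tl xs) (tl \<alpha>)) xs \<alpha> =
    fact n * symmetrizer (Suc n) (\<lambda>xs \<alpha>. f (hd xs) (hd \<alpha>) * F (tl xs) (tl \<alpha>)) xs \<alpha>"
proof -
  let ?F = "\<lambda>xs \<alpha>. f (hd xs) (hd \<alpha>) * F (tl xs) (tl \<alpha>)"
  have tensor: "f (hd ys) (hd \<beta>) * Uword Q w F (tl ys) (tl \<beta>) = Uword Q (map Suc w) ?F ys \<beta>"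
    if "length ys = length xs" "length \<beta> = length \<alpha>" for ys \<beta> w
    using that assms by (cases ys; cases \<beta>) (simp_all add: Uword_map_Suc_Cons Uword_mult)
  have "symmetrizer (Suc n) (\<lambda>xs \<alpha>. f (hd xs) (hd \<alpha>) * symmetrizer n F (tl xs) (tl \<alpha>)) xs \<alpha> =
      symmetrizer (Suc n) (\<lambda>xs \<alpha>. \<Sum>w\<in>coset_words n. Uword Q (map Suc w) ?F xs \<alpha>) xs \<alpha>"
    by (rule symmetrizer_cong) (simp add: symmetrizer_def[of n] sum_distrib_left tensor)
  also have "\<dots> = (\<Sum>w\<in>coset_words n. symmetrizer (Suc n) (Uword Q (map Suc w) ?F) xs \<alpha>)"
    unfolding symmetrizer_def Uword_sum by (rule sum.swap)
  also have "\<dots> = (\<Sum>w\<in>coset_words n. symmetrizer (Suc n) ?F xs \<alpha>)"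
    using assms coset_words_letters by (intro sum.cong refl symmetrizer_Uword) auto
  finally show ?thesis by (simp add: card_coset_words)
qed

lemma Pn_cong:
  assumes "\<And>ys \<beta>. length ys = length xs \<Longrightarrow> length \<beta> = length \<alpha> \<Longrightarrow> F ys \<beta> = G ys \<beta>"
  shows "Pn Q n F xs \<alpha> = Pn Q n G xs \<alpha>"
  unfolding Pn_def by (rule arg_cong2[where f="(/)", OF sum.cong[OF refl Uword_cong[OF assms]] refl])

lemma Pn_tensor_Pn:
  assumes "length xs = Suc n" "length \<alpha> = Suc n"
  shows "Pn Q (Suc n) (\<lambda>xs \<alpha>. f (hd xs) (hd \<alpha>) * Pn Q n F (tl xs) (tl \<alpha>)) xs \<alpha> =
    Pn Q (Suc n) (\<lambda>xs \<alpha>. f (hd xs) (hd \<alpha>) * F (tl xs) (tl \<alpha>)) xs \<alpha>"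
proof -
  let ?G = "\<lambda>xs \<alpha>. f (hd xs) (hd \<alpha>) * symmetrizer n F (tl xs) (tl \<alpha>)"
  have "Pn Q (Suc n) (\<lambda>xs \<alpha>. f (hd xs) (hd \<alpha>) * Pn Q n F (tl xs) (tl \<alpha>)) xs \<alpha> =
      symmetrizer (Suc n) (\<lambda>xs \<alpha>. (1 / fact n) * ?G xs \<alpha>) xs \<alpha> / fact (Suc n)"
    using assms by (subst Pn_eq_symmetrizer) (auto intro!: symmetrizer_cong simp: Pn_eq_symmetrizer)
  also have "\<dots> = 1 / fact n * symmetrizer (Suc n) ?G xs \<alpha> / fact (Suc n)"
    by (simp only: symmetrizer_def[of "Suc n"] Uword_mult sum_distrib_left)
  also have "\<dots> = Pn Q (Suc n) (\<lambda>xs \<alpha>. f (hd xs) (hd \<alpha>) * F (tl xs) (tl \<alpha>)) xs \<alpha>"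
    using assms by (simp add: symmetrizer_tensor Pn_eq_symmetrizer)
  finally show ?thesis .
qed

lemma Pn_sum: "Pn Q n (\<lambda>xs \<alpha>. \<Sum>s\<in>S. F s xs \<alpha>) xs \<alpha> = (\<Sum>s\<in>S. Pn Q n (F s) xs \<alpha>)"
  unfolding Pn_def Uword_sum sum_divide_distrib[symmetric] by (subst sum.swap) simp

end

section \<open>Partial pairings\<close>

lemma card_less_nth_sorted_list_of_set:
  fixes A :: "'a::linorder set"
  assumes "finite A" "i < card A"
  shows "card {l\<in>A. l < sorted_list_of_set A ! i} = i"
proof -
  let ?L = "sorted_list_of_set A"
  have lt: "?L ! k < ?L ! k' \<longleftrightarrow> k < k'" if "k < card A" "k' < card A" for k k'
    using that strict_sorted_list_of_set[of A]
    by (metis length_sorted_list_of_set linorder_neqE_nat order_less_asym order_less_irrefl sorted_wrt_nth_less)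
  have A: "A = (!) ?L ` {..<card A}"
    using assms(1) by (metis length_sorted_list_of_set lessThan_atLeast0 nth_image order_refl set_sorted_list_of_set take_all_iff)
  have "{l\<in>A. l < ?L ! i} = (!) ?L ` {..<i}"
    using assms(2) lt by (subst (1) A) auto
  moreover have "inj_on ((!) ?L) {..<i}"
    using assms by (intro inj_on_nth) auto
  ultimately show ?thesis by (simp add: card_image)
qed

lemma bij_betw_nth_sorted_list_of_set:
  "finite A \<Longrightarrow> bij_betw ((!) (sorted_list_of_set A)) {..<card A} A"
  by (intro bij_betw_nth) auto

lemma nth_sorted_list_of_set_card_less:
  assumes "finite A" "l \<in> A"
  shows "sorted_list_of_set A ! card {l'\<in>A. l' < l} = l"
proof -
  obtain i where "i < card A" "l = sorted_list_of_set A ! i"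
    using assms bij_betw_nth_sorted_list_of_set[of A] by (auto simp: bij_betw_def)
  then show ?thesis using card_less_nth_sorted_list_of_set[of A i] assms by simp
qed

lemma card_less_lt_card: "finite A \<Longrightarrow> l \<in> A \<Longrightarrow> card {l'\<in>A. l' < l} < card (A :: 'a::order set)"
  by (intro psubset_card_mono) auto

lemma blk_eq:
  assumes "disjoint \<xi>" "b \<in> \<xi>" "k \<in> b"
  shows "blk \<xi> k = b"
  unfolding blk_def using assms by (intro the_equality) (auto simp: disjoint_def)

text \<open>The contractions that the operators with labels above \<open>t\<close> can have
  performed among themselves.\<close>

definition partial_pairings :: "nat \<Rightarrow> nat \<Rightarrow> nat set set set" where
  "partial_pairings m t = {\<xi>. disjoint \<xi> \<and> (\<forall>b\<in>\<xi>. b \<subseteq> {t<..m} \<and> card b = 2)}"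

text \<open>For a complete pairing \<^term>\<open>\<xi>\<close> these are the labels above \<^term>\<open>t\<close> whose creation
  operator has not yet been annihilated when the operators \<^term>\<open>Suc t\<close>, \dots, \<^term>\<open>m\<close> have acted.\<close>
definition unpaired :: "nat \<Rightarrow> nat \<Rightarrow> nat set set \<Rightarrow> nat set" where
  "unpaired m t \<xi> = {t<..m} - \<Union>{b\<in>\<xi>. b \<subseteq> {t<..}}"

lemma finite_unpaired [simp]: "finite (unpaired m t \<xi>)"
  by (simp add: unpaired_def)

lemma unpaired_subset: "unpaired m t \<xi> \<subseteq> {t<..m}"
  by (auto simp: unpaired_def)

lemma partial_pairings_pair:
  assumes "\<xi> \<in> partial_pairings m t" "b \<in> \<xi>"
  obtains i j where "b = {i, j}" "t < i" "i < j" "j \<le> m"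
proof -
  have "card b = 2" "b \<subseteq> {t<..m}" using assms by (auto simp: partial_pairings_def)
  then obtain i j where "b = {i, j}" "i \<noteq> j" by (meson card_2_iff)
  with \<open>b \<subseteq> {t<..m}\<close> show thesis
    by (cases "i < j") (auto intro: that[of i j] that[of j i])
qed

lemma unpaired_eq:
  assumes "\<xi> \<in> partial_pairings m t"
  shows "unpaired m t \<xi> = {t<..m} - \<Union>\<xi>"
proof -
  have "{b\<in>\<xi>. b \<subseteq> {t<..}} = \<xi>"
    using assms by (force simp: partial_pairings_def)
  then show ?thesis by (simp add: unpaired_def)
qed

lemma finite_partial_pairings: "finite (partial_pairings m t)"
  by (rule finite_subset[of _ "Pow (Pow {t<..m})"]) (auto simp: partial_pairings_def)

lemma partial_pairings_finite: "\<xi> \<in> partial_pairings m t \<Longrightarrow> finite \<xi>"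
  by (rule finite_subset[of _ "Pow {t<..m}"]) (auto simp: partial_pairings_def)

lemma partial_pairings_disjoint: "\<xi> \<in> partial_pairings m t \<Longrightarrow> disjoint \<xi>"
  by (simp add: partial_pairings_def)

lemma partial_pairings_Suc_subset: "partial_pairings m (Suc t) \<subseteq> partial_pairings m t"
  by (fastforce simp: partial_pairings_def)

lemma partial_pairings_top: "partial_pairings m m = {{}}"
  by (auto simp: partial_pairings_def)

lemma pair_partitions_eq: "pair_partitions m = {\<xi> \<in> partial_pairings m 0. unpaired m 0 \<xi> = {}}"
proof -
  have "\<xi> \<in> pair_partitions m \<longleftrightarrow> \<xi> \<in> partial_pairings m 0 \<and> {0<..m} \<subseteq> \<Union>\<xi>" for \<xi>
    unfolding pair_partitions_def partial_pairings_def partition_on_def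
    by (auto simp: Suc_le_eq subset_iff)
  then show ?thesis using unpaired_eq[of _ m 0] by blast
qed

lemma card_partial_pairing:
  assumes "\<xi> \<in> partial_pairings m t"
  shows "card (unpaired m t \<xi>) + 2 * card \<xi> = m - t"
proof -
  have "card (\<Union>\<xi>) = sum card \<xi>"
    using assms by (intro card_Union_disjoint) (auto simp: partial_pairings_def intro: finite_subset)
  also have "\<dots> = 2 * card \<xi>"
    using assms by (simp add: partial_pairings_def)
  finally have "card (\<Union>\<xi>) = 2 * card \<xi>" .
  moreover have "\<Union>\<xi> \<subseteq> {t<..m}" using assms by (auto simp: partial_pairings_def)
  ultimately show ?thesis
    using unpaired_eq[OF assms] card_mono[of "{t<..m}" "\<Union>\<xi>"]
    by (simp add: card_Diff_subset finite_subset)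
qed

context
  fixes m t :: nat and \<xi> :: "nat set set"
  assumes \<xi>: "\<xi> \<in> partial_pairings m (Suc t)" and tm: "t < m"
begin

lemma Suc_notin_pairing: "Suc t \<notin> \<Union>\<xi>"
  using \<xi> by (fastforce simp: partial_pairings_def)

lemma Suc_notin_Ix: "Suc t \<notin> Ix \<xi>"
proof
  assume "Suc t \<in> Ix \<xi>"
  then obtain b where b: "b \<in> \<xi>" "Suc t = Min b" by (auto simp: Ix_def)
  then have "Min b \<in> b" using \<xi> by (auto simp: partial_pairings_def intro!: Min_in intro: finite_subset)
  with b show False using Suc_notin_pairing by auto
qed

lemma unpaired_Suc: "unpaired m t \<xi> = insert (Suc t) (unpaired m (Suc t) \<xi>)"
proof -
  have "{t<..m} = insert (Suc t) {Suc t<..m}" using tm by auto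
  then show ?thesis
    using unpaired_eq[OF \<xi>] unpaired_eq[OF subsetD[OF partial_pairings_Suc_subset \<xi>]] Suc_notin_pairing
    by auto
qed

lemma insert_pair_in_partial_pairings:
  assumes "j \<in> unpaired m (Suc t) \<xi>"
  shows "insert {Suc t, j} \<xi> \<in> partial_pairings m t"
proof -
  have "j \<in> {Suc t<..m}" "j \<notin> \<Union>\<xi>" using assms by (auto simp: unpaired_eq[OF \<xi>])
  moreover have "\<xi> \<in> partial_pairings m t" using \<xi> partial_pairings_Suc_subset by blast
  ultimately show ?thesis
    using Suc_notin_pairing tm by (auto simp: partial_pairings_def disjoint_def card_2_iff)
qed

lemma unpaired_insert_pair:
  assumes "j \<in> unpaired m (Suc t) \<xi>"
  shows "unpaired m t (insert {Suc t, j} \<xi>) = unpaired m (Suc t) \<xi> - {j}"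
  unfolding unpaired_eq[OF \<xi>] unpaired_eq[OF insert_pair_in_partial_pairings[OF assms]]
  by auto

end

lemma partial_pairings_rec:
  assumes "t < m"
  shows "partial_pairings m t = partial_pairings m (Suc t) \<union>
    (\<lambda>(\<xi>, j). insert {Suc t, j} \<xi>) ` (SIGMA \<xi>:partial_pairings m (Suc t). unpaired m (Suc t) \<xi>)"
    (is "_ = ?A \<union> ?B")
proof (intro equalityI subsetI)
  fix \<xi> assume \<xi>: "\<xi> \<in> partial_pairings m t"
  show "\<xi> \<in> ?A \<union> ?B"
  proof (cases "Suc t \<in> \<Union>\<xi>")
    case False
    have "b \<subseteq> {Suc t<..m}" if "b \<in> \<xi>" for b
    proof
      fix k assume "k \<in> b"
      then have "k \<noteq> Suc t" "k \<in> {t<..m}" using False that \<xi> unfolding partial_pairings_def by blast+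
      then show "k \<in> {Suc t<..m}" by auto
    qed
    then have "\<xi> \<in> ?A" using \<xi> by (simp add: partial_pairings_def)
    then show ?thesis ..
  next
    case True
    then obtain b where b: "b \<in> \<xi>" "Suc t \<in> b" by auto
    obtain i j where ij: "b = {i, j}" "t < i" "i < j" "j \<le> m"
      using partial_pairings_pair[OF \<xi> b(1)] .
    then have "i = Suc t" using b(2) by auto
    have disj: "b' \<inter> b = {}" if "b' \<in> \<xi> - {b}" for b'
      using that b(1) \<xi> by (auto simp: partial_pairings_def disjoint_def)
    have "b' \<subseteq> {Suc t<..m}" if "b' \<in> \<xi> - {b}" for b'
    proof
      fix k assume "k \<in> b'"
      then have "k \<noteq> Suc t" "k \<in> {t<..m}"
        using disj[OF that] b(2) that \<xi> unfolding partial_pairings_def by blast+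
      then show "k \<in> {Suc t<..m}" by auto
    qed
    then have *: "\<xi> - {b} \<in> ?A" using \<xi> by (auto simp: partial_pairings_def disjoint_def)
    moreover have "j \<in> unpaired m (Suc t) (\<xi> - {b})"
      unfolding unpaired_eq[OF *] using ij disj \<open>i = Suc t\<close> by auto
    moreover have "\<xi> = insert {Suc t, j} (\<xi> - {b})" using b(1) ij(1) \<open>i = Suc t\<close> by auto
    ultimately show ?thesis by (auto intro!: image_eqI[where x = "(\<xi> - {b}, j)"])
  qed
next
  fix \<xi> assume "\<xi> \<in> ?A \<union> ?B"
  then show "\<xi> \<in> partial_pairings m t"
    using partial_pairings_Suc_subset insert_pair_in_partial_pairings[OF _ assms] by auto
qed

text \<open>The combinatorial shadow of \<open>field_op\<close>: the label \<open>Suc t\<close>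
  stays unpaired (creation, arriving from \<open>p - 1\<close> particles) or takes one of the
  unpaired labels as partner (annihilation, arriving from \<open>Suc p\<close>).\<close>

lemma sum_partial_pairings_rec:
  assumes "t < m"
  shows "(\<Sum>\<xi>\<in>{\<xi>\<in>partial_pairings m t. card (unpaired m t \<xi>) = p}. g \<xi>) =
    (\<Sum>\<xi>\<in>{\<xi>\<in>partial_pairings m (Suc t). Suc (card (unpaired m (Suc t) \<xi>)) = p}. g \<xi>) +
    (\<Sum>\<xi>\<in>{\<xi>\<in>partial_pairings m (Suc t). card (unpaired m (Suc t) \<xi>) = Suc p}.
       \<Sum>j\<in>unpaired m (Suc t) \<xi>. g (insert {Suc t, j} \<xi>))"
proof -
  let ?P = "partial_pairings m (Suc t)" and ?ins = "\<lambda>(\<xi>, j). insert {Suc t, j} \<xi>"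
  let ?A = "{\<xi>\<in>?P. Suc (card (unpaired m (Suc t) \<xi>)) = p}"
  let ?B = "{\<xi>\<in>?P. card (unpaired m (Suc t) \<xi>) = Suc p}"
  let ?S = "SIGMA \<xi>:?B. unpaired m (Suc t) \<xi>"
  have keep: "card (unpaired m t \<xi>) = Suc (card (unpaired m (Suc t) \<xi>))" if "\<xi> \<in> ?P" for \<xi>
    using that unpaired_subset[of m "Suc t" \<xi>] by (subst unpaired_Suc[OF that assms]) (auto intro!: card_insert_disjoint)
  have ins: "card (unpaired m t (insert {Suc t, j} \<xi>)) = card (unpaired m (Suc t) \<xi>) - 1"
    if "\<xi> \<in> ?P" "j \<in> unpaired m (Suc t) \<xi>" for \<xi> j
    using that by (simp add: unpaired_insert_pair[OF that(1) assms that(2)])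
  have pos: "card (unpaired m (Suc t) \<xi>) > 0" if "j \<in> unpaired m (Suc t) \<xi>" for \<xi> j
    using that by (auto simp: card_gt_0_iff)
  have eq: "{\<xi>\<in>partial_pairings m t. card (unpaired m t \<xi>) = p} = ?A \<union> ?ins ` ?S"
  proof (intro equalityI subsetI)
    fix \<xi> assume "\<xi> \<in> {\<xi>\<in>partial_pairings m t. card (unpaired m t \<xi>) = p}"
    then have "\<xi> \<in> ?P \<union> ?ins ` (SIGMA \<xi>:?P. unpaired m (Suc t) \<xi>)" "card (unpaired m t \<xi>) = p"
      using partial_pairings_rec[OF assms] by auto
    then show "\<xi> \<in> ?A \<union> ?ins ` ?S"
    proof (elim UnE imageE)
      assume "\<xi> \<in> ?P" "card (unpaired m t \<xi>) = p"
      then show ?thesis using keep by auto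
    next
      fix y assume y: "card (unpaired m t \<xi>) = p" "\<xi> = ?ins y" "y \<in> (SIGMA \<xi>:?P. unpaired m (Suc t) \<xi>)"
      obtain \<zeta> j where y': "y = (\<zeta>, j)" by (cases y)
      then have "card (unpaired m (Suc t) \<zeta>) = Suc p" using y ins[of \<zeta> j] pos[of j \<zeta>] by auto
      then show ?thesis using y y' by (auto intro!: image_eqI[where x = "(\<zeta>, j)"])
    qed
  next
    fix \<xi> assume "\<xi> \<in> ?A \<union> ?ins ` ?S"
    then show "\<xi> \<in> {\<xi>\<in>partial_pairings m t. card (unpaired m t \<xi>) = p}"
    proof (elim UnE imageE)
      assume "\<xi> \<in> ?A"
      then show ?thesis using keep partial_pairings_Suc_subset by auto
    next
      fix y assume "\<xi> = ?ins y" "y \<in> ?S"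
      then show ?thesis using ins insert_pair_in_partial_pairings[OF _ assms] by (cases y) auto
    qed
  qed
  have disj: "?A \<inter> ?ins ` ?S = {}"
    using Suc_notin_pairing[OF _ assms] by fastforce
  have inj: "inj_on ?ins ?S"
  proof (rule inj_onI, clarify)
    fix \<xi> j \<zeta> k assume *: "\<xi> \<in> ?P" "\<zeta> \<in> ?P" "insert {Suc t, j} \<xi> = insert {Suc t, k} \<zeta>"
    have n: "{Suc t, j} \<notin> \<xi>" "{Suc t, k} \<notin> \<zeta>" "{Suc t, j} \<notin> \<zeta>"
      using Suc_notin_pairing[OF *(1) assms] Suc_notin_pairing[OF *(2) assms] by auto
    then have e: "{Suc t, j} = {Suc t, k}" using *(3) by blast
    then have "j = k" by (auto simp: doubleton_eq_iff)
    moreover have "\<xi> = \<zeta>" using *(3) n e by (metis insert_ident)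
    ultimately show "\<xi> = \<zeta> \<and> j = k" by simp
  qed
  have fin: "finite ?A" "finite ?B" "finite ?S"
    using finite_partial_pairings by auto
  have "(\<Sum>\<xi>\<in>?A \<union> ?ins ` ?S. g \<xi>) = sum g ?A + sum g (?ins ` ?S)"
    using fin disj by (intro sum.union_disjoint) auto
  also have "sum g (?ins ` ?S) = (\<Sum>(\<xi>, j)\<in>?S. g (insert {Suc t, j} \<xi>))"
    unfolding sum.reindex[OF inj] by (simp add: case_prod_beta)
  also have "\<dots> = (\<Sum>\<xi>\<in>?B. \<Sum>j\<in>unpaired m (Suc t) \<xi>. g (insert {Suc t, j} \<xi>))"
    using fin by (subst sum.Sigma) auto
  finally show ?thesis unfolding eq .
qed

section \<open>Amplitudes of partial pairings\<close>

lemma norm_list_pair_le: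
  fixes C :: "'r::finite mat2" and B :: real
  assumes "\<And>u v. norm (C u v) \<le> 1" "\<And>\<beta>. norm (g \<beta>) \<le> B"
  shows "norm (list_pair C i g \<alpha>) \<le> real (CARD('r \<times> 'r)) * B"
proof -
  have "norm (list_pair C i g \<alpha>) \<le> (\<Sum>v\<in>(UNIV :: ('r \<times> 'r) set). 1 * B)"
    unfolding list_pair_def
  proof (rule order.trans[OF norm_sum sum_mono])
    fix v
    show "norm (C (\<alpha> ! i, \<alpha> ! Suc i) v * g (\<alpha>[i := fst v, Suc i := snd v])) \<le> 1 * B"
      unfolding norm_mult by (rule mult_mono[OF assms]) simp_all
  qed
  then show ?thesis by simp
qed

lemma norm_foldr_list_pair_le:
  fixes C :: "nat \<Rightarrow> 'r::finite mat2" and B :: real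
  assumes "\<And>i u v. norm (C i u v) \<le> 1" "\<And>\<beta>. norm (g \<beta>) \<le> B"
  shows "norm (foldr (\<lambda>i. list_pair (C i) i) is g \<alpha>) \<le> real (CARD('r \<times> 'r)) ^ length is * B"
proof (induction "is" arbitrary: \<alpha>)
  case (Cons i "is")
  then show ?case
    using norm_list_pair_le[of "C i", OF assms(1) Cons] by (simp add: mult.assoc)
qed (simp add: assms)

lemma
  fixes C :: "nat \<Rightarrow> 'r::finite mat2"
  assumes "\<And>\<beta>. integrable M (\<lambda>u. g u \<beta>)"
  shows integrable_foldr_list_pair: "integrable M (\<lambda>u. foldr (\<lambda>i. list_pair (C i) i) is (g u) \<alpha>)"
    and integral_foldr_list_pair: "foldr (\<lambda>i. list_pair (C i) i) is (\<lambda>\<beta>. \<integral>u. g u \<beta> \<partial>M) \<alpha> =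
      (\<integral>u. foldr (\<lambda>i. list_pair (C i) i) is (g u) \<alpha> \<partial>M)"
proof -
  have "(\<forall>\<alpha>. integrable M (\<lambda>u. foldr (\<lambda>i. list_pair (C i) i) is (g u) \<alpha>)) \<and>
    foldr (\<lambda>i. list_pair (C i) i) is (\<lambda>\<beta>. \<integral>u. g u \<beta> \<partial>M) =
      (\<lambda>\<alpha>. \<integral>u. foldr (\<lambda>i. list_pair (C i) i) is (g u) \<alpha> \<partial>M)"
  proof (induction "is")
    case (Cons i "is")
    then show ?case
      by (auto simp: list_pair_def fun_eq_iff intro!: Bochner_Integration.integrable_sum)
  qed (simp add: assms)
  then show "integrable M (\<lambda>u. foldr (\<lambda>i. list_pair (C i) i) is (g u) \<alpha>)"
    "foldr (\<lambda>i. list_pair (C i) i) is (\<lambda>\<beta>. \<integral>u. g u \<beta> \<partial>M) \<alpha> =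
      (\<integral>u. foldr (\<lambda>i. list_pair (C i) i) is (g u) \<alpha> \<partial>M)" by simp_all
qed

lemma borel_measurable_foldr_list_pair:
  fixes C :: "'w \<Rightarrow> nat \<Rightarrow> 'r::finite mat2"
  assumes "\<And>i u v. (\<lambda>w. C w i u v) \<in> borel_measurable M" "\<And>\<beta>. (\<lambda>w. g w \<beta>) \<in> borel_measurable M"
  shows "(\<lambda>w. foldr (\<lambda>i. list_pair (C w i) i) is (g w) \<alpha>) \<in> borel_measurable M"
proof (induction "is" arbitrary: \<alpha>)
  case (Cons i "is")
  then show ?case using assms by (simp add: list_pair_def)
qed (simp add: assms)

lemma foldr_list_pair_cong:
  assumes "\<And>i. i \<in> set is \<Longrightarrow> C i = D i"
  shows "foldr (\<lambda>i. list_pair (C i) i) is g = foldr (\<lambda>i. list_pair (D i) i) is g"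
  using assms by (intro foldr_cong refl) simp

lemma integrable_norm_mult_L2:
  fixes g h :: "'a \<Rightarrow> complex"
  assumes "g \<in> borel_measurable M" "integrable M (\<lambda>x. (norm (g x))\<^sup>2)"
    and "h \<in> borel_measurable M" "integrable M (\<lambda>x. (norm (h x))\<^sup>2)"
  shows "integrable M (\<lambda>x. norm (g x) * norm (h x))"
proof (rule Bochner_Integration.integrable_bound)
  show "integrable M (\<lambda>x. (norm (g x))\<^sup>2 + (norm (h x))\<^sup>2)" using assms by simp
  show "(\<lambda>x. norm (g x) * norm (h x)) \<in> borel_measurable M" using assms by measurable
  have "norm (g x) * norm (h x) \<le> (norm (g x))\<^sup>2 + (norm (h x))\<^sup>2" for x
    using sum_squares_bound[of "norm (g x)" "norm (h x)"]
      mult_nonneg_nonneg[OF norm_ge_zero norm_ge_zero, of "g x" "h x"] by linarith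
  then show "AE x in M. norm (norm (g x) * norm (h x)) \<le> norm ((norm (g x))\<^sup>2 + (norm (h x))\<^sup>2)"
    by simp
qed

context braided_kernel
begin

text \<open>The columns of a unitary matrix are unit vectors.\<close>

lemma norm_Q_le_1: "norm (Q y z u v) \<le> 1"
proof -
  have "(\<Sum>w\<in>UNIV. (norm (Q y z w v))\<^sup>2) = 1"
  proof -
    have "complex_of_real (\<Sum>w\<in>UNIV. (norm (Q y z w v))\<^sup>2) = (\<Sum>w\<in>UNIV. cnj (Q y z w v) * Q y z w v)"
      by (simp add: complex_norm_square mult.commute del: of_real_power)
    also have "\<dots> = 1"
      using fun_cong[OF fun_cong[OF Q_unitary1[of y z]], of v v] by (simp add: mm_def adjm_def idm_def)
    finally show ?thesis by (metis of_real_eq_1_iff)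
  qed
  moreover have "(norm (Q y z u v))\<^sup>2 \<le> (\<Sum>w\<in>UNIV. (norm (Q y z w v))\<^sup>2)"
    by (rule member_le_sum) auto
  ultimately have "(norm (Q y z u v))\<^sup>2 \<le> 1\<^sup>2" by simp
  then show ?thesis by (rule power2_le_imp_le) simp
qed

lemma borel_measurable_Q:
  assumes "g \<in> borel_measurable M" "h \<in> borel_measurable M"
  shows "(\<lambda>w. Q (g w) (h w) u v) \<in> borel_measurable M"
proof -
  have Q: "(\<lambda>p::real \<times> real. Q (fst p) (snd p) u v) \<in> borel_measurable borel"
    using Q_cont by (rule borel_measurable_continuous_onI)
  have "(\<lambda>w. (g w, h w)) \<in> borel_measurable M" using assms by measurable
  from measurable_compose[OF this Q] show ?thesis by simp
qed

end

locale field_product = braided_kernel Q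
  for Q :: "real \<Rightarrow> real \<Rightarrow> 'r::finite mat2" +
  fixes f f' :: "nat \<Rightarrow> 'e::finite pt \<Rightarrow> 'r \<Rightarrow> complex" and m :: nat
  assumes f_meas: "\<And>k a. k \<in> {1..m} \<Longrightarrow> (\<lambda>x. f k x a) \<in> borel_measurable lborel"
    and f_L2: "\<And>k a. k \<in> {1..m} \<Longrightarrow> integrable lborel (\<lambda>x. (cmod (f k x a))\<^sup>2)"
    and f'_meas: "\<And>k a. k \<in> {1..m} \<Longrightarrow> (\<lambda>x. f' k x a) \<in> borel_measurable lborel"
    and f'_L2: "\<And>k a. k \<in> {1..m} \<Longrightarrow> integrable lborel (\<lambda>x. (cmod (f' k x a))\<^sup>2)"
begin

text \<open>Effect of the operator with label \<open>k\<close> on the integrand. The partner of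
  \<open>k\<close> sits at the position given by its rank among the unpaired labels; after the
  exchanges the contracted index \<open>a\<close> is always the head.\<close>

definition wick_step :: "nat set set \<Rightarrow> (nat \<Rightarrow> 'e pt) \<Rightarrow> nat \<Rightarrow> ('r list \<Rightarrow> complex) \<Rightarrow> 'r list \<Rightarrow> complex" where
  "wick_step \<xi> x k g \<alpha> =
    (if k \<in> Ix \<xi>
     then \<Sum>a\<in>UNIV. f' k (x k) a *
       foldr (\<lambda>i. list_pair (Q (fst (x k)) (fst (x (sorted_list_of_set (unpaired m k \<xi>) ! i)))) i)
         [0..<card {l \<in> unpaired m k \<xi>. l < Max (blk \<xi> k)}] g (a # \<alpha>)
     else f k (x k) (hd \<alpha>) * g (tl \<alpha>))"

text \<open>Variables are addressed by label, tensor indices by position. This is the separation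
  that later appears as \<open>Jsm\<close> versus \<open>bJ\<close>.\<close>

definition amplitude :: "nat set set \<Rightarrow> nat \<Rightarrow> (nat \<Rightarrow> 'e pt) \<Rightarrow> 'r list \<Rightarrow> complex" where
  "amplitude \<xi> t x = foldr (wick_step \<xi> x) [Suc t..<Suc m] (\<lambda>\<alpha>. 1)"

lemma amplitude_top: "amplitude \<xi> m x = (\<lambda>\<alpha>. 1)"
  by (simp add: amplitude_def)

lemma amplitude_rec: "t < m \<Longrightarrow> amplitude \<xi> t x = wick_step \<xi> x (Suc t) (amplitude \<xi> (Suc t) x)"
  by (simp add: amplitude_def upt_conv_Cons del: upt_Suc)

lemma amplitude_cong:
  assumes "t \<le> m"
    and "\<And>l. l \<in> {t<..m} \<Longrightarrow> x l = x' l"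
    and "\<And>k. k \<in> {t<..m} \<Longrightarrow> k \<in> Ix \<xi> \<longleftrightarrow> k \<in> Ix \<xi>'"
    and "\<And>k. k \<in> {t<..m} \<Longrightarrow> k \<in> Ix \<xi> \<Longrightarrow> Max (blk \<xi> k) = Max (blk \<xi>' k)"
    and "\<And>k. k \<in> {t<..m} \<Longrightarrow> unpaired m k \<xi> = unpaired m k \<xi>'"
  shows "amplitude \<xi> t x = amplitude \<xi>' t x'"
  using assms
proof (induction t rule: inc_induct)
  case base
  show ?case by (simp add: amplitude_top)
next
  case (step t)
  have IH: "amplitude \<xi> (Suc t) x = amplitude \<xi>' (Suc t) x'"
    by (rule step.IH) (simp_all add: step.prems)
  let ?k = "Suc t" let ?U = "unpaired m ?k \<xi>'"
  have k: "?k \<in> {t<..m}" using step.hyps by simp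
  note eqs = step.prems(1-2)[OF k] step.prems(4)[OF k]
  have nth: "x (sorted_list_of_set ?U ! i) = x' (sorted_list_of_set ?U ! i)"
    if "i < card {l \<in> ?U. l < j}" for i j
  proof -
    have "card {l \<in> ?U. l < j} \<le> card ?U" by (intro card_mono) auto
    then have "sorted_list_of_set ?U ! i \<in> ?U"
      using that bij_betw_nth_sorted_list_of_set[of ?U] by (auto simp: bij_betw_def)
    then show ?thesis using unpaired_subset[of m ?k \<xi>'] by (intro step.prems) auto
  qed
  let ?step = "\<lambda>x g. foldr (\<lambda>i. list_pair (Q (fst (x ?k)) (fst (x (sorted_list_of_set ?U ! i)))) i)
      [0..<card {l \<in> ?U. l < Max (blk \<xi>' ?k)}] g"
  have "?step x g = ?step x' g" for g
    by (rule foldr_list_pair_cong) (simp add: nth[of _ "Max (blk \<xi>' ?k)"] eqs)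
  then show ?case
    using step.hyps step.prems(3)[OF k]
    by (simp add: amplitude_rec IH wick_step_def eqs fun_eq_iff)
qed

lemma borel_measurable_amplitude:
  assumes "t \<le> m" and X: "\<And>l. (\<lambda>w. X w l) \<in> borel_measurable M"
  shows "(\<lambda>w. amplitude \<xi> t (X w) \<alpha>) \<in> borel_measurable M"
  using assms(1)
proof (induction t arbitrary: \<alpha> rule: inc_induct)
  case (step t)
  have k: "Suc t \<in> {1..m}" using step.hyps by simp
  have f: "(\<lambda>w. f (Suc t) (X w (Suc t)) a) \<in> borel_measurable M"
    "(\<lambda>w. f' (Suc t) (X w (Suc t)) a) \<in> borel_measurable M" for a
    using f_meas[OF k, of a] f'_meas[OF k, of a] X[of "Suc t"] measurable_compose
    by (auto simp: measurable_compose)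
  have fst: "(\<lambda>w. fst (X w l)) \<in> borel_measurable M" for l
    by (rule measurable_compose[OF X borel_measurable_continuous_onI[OF continuous_on_fst[OF continuous_on_id]]])
  have "(\<lambda>w. \<Sum>a\<in>UNIV. f' (Suc t) (X w (Suc t)) a *
      foldr (\<lambda>i. list_pair (Q (fst (X w (Suc t))) (fst (X w (L ! i)))) i) is (amplitude \<xi> (Suc t) (X w)) (a # \<alpha>))
    \<in> borel_measurable M" for L "is" \<alpha>
    by (intro borel_measurable_sum borel_measurable_times f borel_measurable_foldr_list_pair
        borel_measurable_Q fst step.IH)
  moreover have "(\<lambda>w. f (Suc t) (X w (Suc t)) (hd \<alpha>) * amplitude \<xi> (Suc t) (X w) (tl \<alpha>)) \<in> borel_measurable M"
    by (intro borel_measurable_times f step.IH)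
  ultimately show ?case
    using step.hyps by (cases "Suc t \<in> Ix \<xi>") (simp_all add: amplitude_rec wick_step_def)
qed (simp add: amplitude_top)

text \<open>Dominates every component of both functions of a label, so one bound serves creation and
  annihilation.\<close>

definition envelope :: "nat \<Rightarrow> 'e pt \<Rightarrow> real" where
  "envelope l y = (\<Sum>a\<in>UNIV. norm (f l y a) + norm (f' l y a))"

lemma envelope_nonneg: "envelope l y \<ge> 0"
  by (simp add: envelope_def sum_nonneg)

lemma norm_le_envelope: "norm (f l y a) \<le> envelope l y" "norm (f' l y a) \<le> envelope l y"
proof -
  have "norm (f l y a) + norm (f' l y a) \<le> envelope l y"
    unfolding envelope_def by (rule member_le_sum) auto
  then show "norm (f l y a) \<le> envelope l y" "norm (f' l y a) \<le> envelope l y"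
    using norm_ge_zero[of "f l y a"] norm_ge_zero[of "f' l y a"] by linarith+
qed

lemma integrable_envelope_mult:
  assumes "i \<in> {1..m}" "j \<in> {1..m}"
  shows "integrable lborel (\<lambda>y. envelope i y * envelope j y)"
  unfolding envelope_def sum_product distrib_left distrib_right
  using assms by (intro Bochner_Integration.integrable_sum Bochner_Integration.integrable_add
      integrable_norm_mult_L2 f_meas f'_meas f_L2 f'_L2)

text \<open>Entries of \<open>Q\<close> are bounded by 1, so passing \<open>q\<close> particles
  costs at most a factor \<open>CARD('r \<times> 'r) ^ q\<close> and a contraction a further
  \<open>CARD('r)\<close>.\<close>

lemma amplitude_bound:
  assumes "t \<le> m"
  shows "\<exists>C. \<forall>x \<alpha>. norm (amplitude \<xi> t x \<alpha>) \<le> C * (\<Prod>l\<in>{t<..m}. envelope l (x l))"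
  using assms
proof (induction t rule: inc_induct)
  case base
  show ?case by (intro exI[of _ 1]) (simp add: amplitude_top)
next
  case (step t)
  then obtain C where C: "norm (amplitude \<xi> (Suc t) x \<alpha>) \<le> C * (\<Prod>l\<in>{Suc t<..m}. envelope l (x l))" for x \<alpha>
    by blast
  let ?q = "card {l \<in> unpaired m (Suc t) \<xi>. l < Max (blk \<xi> (Suc t))}"
  \<comment> \<open>The constants of the annihilating and the creating branch are added, so that one
    constant covers both.\<close>
  let ?D = "CARD('r) * (real (CARD('r \<times> 'r)) ^ ?q * C) + C"
  have "norm (amplitude \<xi> t x \<alpha>) \<le> ?D * (\<Prod>l\<in>{t<..m}. envelope l (x l))" for x \<alpha>
  proof -
    let ?P = "\<Prod>l\<in>{Suc t<..m}. envelope l (x l)" and ?e = "envelope (Suc t) (x (Suc t))"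
    have ins: "{t<..m} = insert (Suc t) {Suc t<..m}" using step.hyps by auto
    have P: "?P \<ge> 0" by (intro prod_nonneg) (simp add: envelope_nonneg)
    \<comment> \<open>The sign of \<open>C\<close> is not recorded, but \<open>C * ?P\<close> bounds
      a norm.\<close>
    have CP: "0 \<le> C * ?P" using C[of x \<alpha>] by (meson norm_ge_zero order_trans)
    have eCP: "0 \<le> ?e * (C * ?P)" using CP by (simp add: envelope_nonneg)
    have K: "0 \<le> CARD('r) * (real (CARD('r \<times> 'r)) ^ ?q * (?e * (C * ?P)))"
      by (rule mult_nonneg_nonneg[OF of_nat_0_le_iff mult_nonneg_nonneg[OF zero_le_power[OF of_nat_0_le_iff] eCP]])
    have D: "?D * (?e * ?P) = CARD('r) * (real (CARD('r \<times> 'r)) ^ ?q * (?e * (C * ?P))) + ?e * (C * ?P)"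
      by (simp add: algebra_simps)
    let ?g = "\<lambda>a. foldr (\<lambda>i. list_pair (Q (fst (x (Suc t)))
        (fst (x (sorted_list_of_set (unpaired m (Suc t) \<xi>) ! i)))) i) [0..<?q] (amplitude \<xi> (Suc t) x) (a # \<alpha>)"
    have "norm (?g a) \<le> real (CARD('r \<times> 'r)) ^ ?q * (C * ?P)" for a
      using norm_foldr_list_pair_le[of "\<lambda>i. Q (fst (x (Suc t))) (fst (x (sorted_list_of_set (unpaired m (Suc t) \<xi>) ! i)))"
          "amplitude \<xi> (Suc t) x" "C * ?P" "[0..<?q]" "a # \<alpha>"] norm_Q_le_1 C by simp
    then have "norm (\<Sum>a\<in>UNIV. f' (Suc t) (x (Suc t)) a * ?g a) \<le>
        (\<Sum>a\<in>(UNIV :: 'r set). ?e * (real (CARD('r \<times> 'r)) ^ ?q * (C * ?P)))"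
      by (intro order.trans[OF norm_sum] sum_mono) (simp add: norm_mult mult_mono norm_le_envelope envelope_nonneg)
    also have "\<dots> = CARD('r) * (real (CARD('r \<times> 'r)) ^ ?q * (?e * (C * ?P)))"
      by (simp add: mult_ac)
    also have "\<dots> \<le> ?D * (?e * ?P)"
      using eCP unfolding D by linarith
    finally have 1: "norm (\<Sum>a\<in>UNIV. f' (Suc t) (x (Suc t)) a * ?g a) \<le> ?D * (?e * ?P)" .
    have "norm (f (Suc t) (x (Suc t)) (hd \<alpha>) * amplitude \<xi> (Suc t) x (tl \<alpha>)) \<le> ?e * (C * ?P)"
      unfolding norm_mult using CP by (intro mult_mono C norm_le_envelope envelope_nonneg) auto
    also have "\<dots> \<le> ?D * (?e * ?P)"
      using K unfolding D by linarith
    finally show ?thesis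
      using 1 step.hyps by (simp add: amplitude_rec wick_step_def ins)
  qed
  then show ?case by blast
qed

text \<open>Paired labels share the integration variable of their block; the unpaired ones take the free
  variables in increasing order.\<close>
definition assign :: "nat set set \<Rightarrow> nat \<Rightarrow> 'e pt list \<Rightarrow> (nat set \<Rightarrow> 'e pt) \<Rightarrow> nat \<Rightarrow> 'e pt" where
  "assign \<xi> t xs u l =
    (if l \<in> \<Union>\<xi> then u (blk \<xi> l) else xs ! card {l' \<in> unpaired m t \<xi>. l' < l})"

abbreviation pair_measure :: "nat set set \<Rightarrow> (nat set \<Rightarrow> 'e pt) measure" where
  "pair_measure \<xi> \<equiv> PiM \<xi> (\<lambda>_. lborel)"

lemma borel_measurable_assign:
  assumes "disjoint \<xi>"
  shows "(\<lambda>u. assign \<xi> t xs u l) \<in> borel_measurable (pair_measure \<xi>)"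
proof (cases "l \<in> \<Union>\<xi>")
  case True
  then have "blk \<xi> l \<in> \<xi>" using blk_eq[OF assms] by auto
  then have "(\<lambda>u. u (blk \<xi> l)) \<in> measurable (pair_measure \<xi>) lborel"
    by (rule measurable_component_singleton)
  then show ?thesis using True by (simp add: assign_def)
qed (simp add: assign_def)

text \<open>The dominating function factorises over the blocks into products of two L2 envelopes in
  one variable. The free variables enter only through \<open>?c\<close>, hence integrability for
  every \<open>xs\<close> and not merely almost every one.\<close>

lemma integrable_amplitude:
  assumes "t \<le> m" "\<xi> \<in> partial_pairings m t"
  shows "integrable (pair_measure \<xi>) (\<lambda>u. amplitude \<xi> t (assign \<xi> t xs u) \<alpha>)"
proof -
  interpret product_sigma_finite "\<lambda>_::nat set. lborel :: 'e pt measure" by standard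
  note disj = partial_pairings_disjoint[OF assms(2)]
  obtain C where C: "\<And>x \<alpha>. norm (amplitude \<xi> t x \<alpha>) \<le> C * (\<Prod>l\<in>{t<..m}. envelope l (x l))"
    using amplitude_bound[OF assms(1)] by blast
  let ?c = "\<Prod>l\<in>unpaired m t \<xi>. envelope l (xs ! card {l' \<in> unpaired m t \<xi>. l' < l})"
  have *: "(\<Prod>l\<in>{t<..m}. envelope l (assign \<xi> t xs u l)) = (\<Prod>b\<in>\<xi>. \<Prod>l\<in>b. envelope l (u b)) * ?c" for u
  proof -
    have sub: "\<Union>\<xi> \<subseteq> {t<..m}" using assms(2) by (auto simp: partial_pairings_def)
    then have split: "{t<..m} = \<Union>\<xi> \<union> unpaired m t \<xi>" "\<Union>\<xi> \<inter> unpaired m t \<xi> = {}"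
      by (auto simp: unpaired_eq[OF assms(2)])
    have "finite (\<Union>\<xi>)" using sub by (rule finite_subset) simp
    have "(\<Prod>l\<in>{t<..m}. envelope l (assign \<xi> t xs u l)) =
        (\<Prod>l\<in>\<Union>\<xi>. envelope l (assign \<xi> t xs u l)) * (\<Prod>l\<in>unpaired m t \<xi>. envelope l (assign \<xi> t xs u l))"
      unfolding split(1) by (rule prod.union_disjoint[OF \<open>finite (\<Union>\<xi>)\<close> finite_unpaired split(2)])
    also have "(\<Prod>l\<in>\<Union>\<xi>. envelope l (assign \<xi> t xs u l)) = (\<Prod>b\<in>\<xi>. \<Prod>l\<in>b. envelope l (assign \<xi> t xs u l))"
    proof -
      have "\<forall>b\<in>\<xi>. finite b" using \<open>finite (\<Union>\<xi>)\<close> by (meson Sup_upper finite_subset)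
      moreover have "\<forall>b\<in>\<xi>. \<forall>b'\<in>\<xi>. b \<noteq> b' \<longrightarrow> b \<inter> b' = {}" using disj by (auto simp: disjoint_def)
      ultimately show ?thesis by (simp add: prod.Union_disjoint)
    qed
    also have "\<dots> = (\<Prod>b\<in>\<xi>. \<Prod>l\<in>b. envelope l (u b))"
      using blk_eq[OF disj] by (intro prod.cong refl) (auto simp: assign_def)
    also have "(\<Prod>l\<in>unpaired m t \<xi>. envelope l (assign \<xi> t xs u l)) = ?c"
      by (intro prod.cong refl) (auto simp: assign_def unpaired_eq[OF assms(2)])
    finally show ?thesis .
  qed
  have "integrable (pair_measure \<xi>) (\<lambda>u. \<Prod>b\<in>\<xi>. \<Prod>l\<in>b. envelope l (u b))"
  proof (rule product_integrable_prod)
    fix b assume "b \<in> \<xi>"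
    then obtain i j where "b = {i, j}" "t < i" "i < j" "j \<le> m"
      by (rule partial_pairings_pair[OF assms(2)])
    then show "integrable lborel (\<lambda>y. \<Prod>l\<in>b. envelope l y)"
      using integrable_envelope_mult[of i j] by simp
  qed (rule partial_pairings_finite[OF assms(2)])
  then have "integrable (pair_measure \<xi>) (\<lambda>u. C * ((\<Prod>b\<in>\<xi>. \<Prod>l\<in>b. envelope l (u b)) * ?c))"
    by simp
  then show ?thesis
  proof (rule Bochner_Integration.integrable_bound)
    show "(\<lambda>u. amplitude \<xi> t (assign \<xi> t xs u) \<alpha>) \<in> borel_measurable (pair_measure \<xi>)"
      using assms(1) borel_measurable_assign[OF disj] by (rule borel_measurable_amplitude)
    have "norm (amplitude \<xi> t (assign \<xi> t xs u) \<alpha>) \<le> norm (C * ((\<Prod>b\<in>\<xi>. \<Prod>l\<in>b. envelope l (u b)) * ?c))" for u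
      using C[of "assign \<xi> t xs u" \<alpha>] unfolding * real_norm_def by linarith
    then show "AE u in pair_measure \<xi>. norm (amplitude \<xi> t (assign \<xi> t xs u) \<alpha>)
        \<le> norm (C * ((\<Prod>b\<in>\<xi>. \<Prod>l\<in>b. envelope l (u b)) * ?c))" by simp
  qed
qed

end

section \<open>Products of field operators applied to the vacuum\<close>

text \<open>Fubini with the new variable integrated last, as annihilation does. The first part
  justifies exchanging that outer integral with finite sums.\<close>

lemma (in product_sigma_finite)
  fixes g :: "_ \<Rightarrow> _::{banach, second_countable_topology}"
  assumes "finite I" "i \<notin> I" and g: "integrable (PiM (insert i I) M) g"
  shows integrable_PiM_insert: "integrable (M i) (\<lambda>y. \<integral>x. g (x(i := y)) \<partial>PiM I M)"
    and product_integral_insert_rev: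
      "(\<integral>y. (\<integral>x. g (x(i := y)) \<partial>PiM I M) \<partial>M i) = integral\<^sup>L (PiM (insert i I) M) g"
proof -
  interpret I: finite_product_sigma_finite M I by standard fact
  interpret P: pair_sigma_finite "PiM I M" "M i" ..
  have [measurable]: "g \<in> borel_measurable (PiM (insert i I) M)" using g by auto
  \<comment> \<open>Tonelli for the norm carries integrability from the product over
    \<open>insert i I\<close> to the binary product.\<close>
  have "integrable (PiM I M \<Otimes>\<^sub>M M i) (\<lambda>(x, y). g (x(i := y)))"
  proof (rule integrableI_bounded)
    have "(\<integral>\<^sup>+z. ennreal (norm (case z of (x, y) \<Rightarrow> g (x(i := y)))) \<partial>(PiM I M \<Otimes>\<^sub>M M i)) =
        (\<integral>\<^sup>+x. \<integral>\<^sup>+y. ennreal (norm (g (x(i := y)))) \<partial>M i \<partial>PiM I M)"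
      by (subst M.nn_integral_fst[symmetric]) simp_all
    also have "\<dots> = (\<integral>\<^sup>+z. ennreal (norm (g z)) \<partial>PiM (insert i I) M)"
      using assms(1,2) by (subst product_nn_integral_insert) simp_all
    also have "\<dots> < \<infinity>" using g by (simp add: integrable_iff_bounded)
    finally show "(\<integral>\<^sup>+z. ennreal (norm (case z of (x, y) \<Rightarrow> g (x(i := y)))) \<partial>(PiM I M \<Otimes>\<^sub>M M i)) < \<infinity>" .
  qed measurable
  note int = this
  show "integrable (M i) (\<lambda>y. \<integral>x. g (x(i := y)) \<partial>PiM I M)"
    by (rule P.integrable_snd[OF int])
  show "(\<integral>y. (\<integral>x. g (x(i := y)) \<partial>PiM I M) \<partial>M i) = integral\<^sup>L (PiM (insert i I) M) g"
    by (simp add: P.Fubini_integral[OF int] product_integral_insert[OF assms])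
qed

lemma (in braided_kernel) Pn_add:
  "Pn Q n (\<lambda>xs \<alpha>. F xs \<alpha> + G xs \<alpha>) xs \<alpha> = Pn Q n F xs \<alpha> + Pn Q n G xs \<alpha>"
  using Pn_sum[of n "\<lambda>b. if b then F else G" "UNIV :: bool set" xs \<alpha>] by (simp add: UNIV_bool add.commute)

context field_product
begin

definition pairing_integral :: "nat set set \<Rightarrow> nat \<Rightarrow> 'e pt list \<Rightarrow> 'r list \<Rightarrow> complex" where
  "pairing_integral \<xi> t xs \<alpha> = (\<integral>u. amplitude \<xi> t (assign \<xi> t xs u) \<alpha> \<partial>pair_measure \<xi>)"

text \<open>The new label is smaller than all labels treated before, so it takes the first position
  and shifts the other ranks by one, as the tensor product with \<open>f\<close> in front
  does.\<close>

lemma pairing_integral_create: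
  assumes \<xi>: "\<xi> \<in> partial_pairings m (Suc t)" and tm: "t < m"
    and len: "length xs = Suc (card (unpaired m (Suc t) \<xi>))"
  shows "pairing_integral \<xi> t xs \<alpha> =
    f (Suc t) (hd xs) (hd \<alpha>) * pairing_integral \<xi> (Suc t) (tl xs) (tl \<alpha>)"
proof -
  let ?U = "unpaired m (Suc t) \<xi>"
  note U = unpaired_Suc[OF \<xi> tm] unpaired_eq[OF \<xi>]
  have "{l' \<in> unpaired m t \<xi>. l' < Suc t} = {}"
    using unpaired_subset[of m "Suc t" \<xi>] by (auto simp: U(1))
  then have "card {l' \<in> unpaired m t \<xi>. l' < Suc t} = 0" by (simp only: card.empty)
  moreover have "xs \<noteq> []" using len by auto
  ultimately have 1: "assign \<xi> t xs u (Suc t) = hd xs" for u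
    unfolding assign_def using Suc_notin_pairing[OF \<xi> tm] by (simp only: if_False) (simp add: hd_conv_nth)
  have 2: "assign \<xi> t xs u l = assign \<xi> (Suc t) (tl xs) u l" if "l \<in> {Suc t<..m}" for u l
  proof (cases "l \<in> \<Union>\<xi>")
    case False
    then have l: "l \<in> ?U" using that by (simp add: U(2))
    have "{l' \<in> unpaired m t \<xi>. l' < l} = insert (Suc t) {l' \<in> ?U. l' < l}"
      using that by (auto simp: U(1))
    moreover have "Suc t \<notin> ?U" using unpaired_subset[of m "Suc t" \<xi>] by auto
    ultimately have "card {l' \<in> unpaired m t \<xi>. l' < l} = Suc (card {l' \<in> ?U. l' < l})"
      by (simp add: card_insert_disjoint)
    moreover have "card {l' \<in> ?U. l' < l} < length (tl xs)"
      using card_less_lt_card[OF _ l] len by simp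
    ultimately show ?thesis using False by (simp add: assign_def nth_tl)
  qed (simp add: assign_def)
  have "amplitude \<xi> (Suc t) (assign \<xi> t xs u) = amplitude \<xi> (Suc t) (assign \<xi> (Suc t) (tl xs) u)" for u
    using tm 2 by (intro amplitude_cong) auto
  then show ?thesis
    using Suc_notin_Ix[OF \<xi> tm] tm
    by (simp add: pairing_integral_def amplitude_rec wick_step_def 1)
qed

context
  fixes \<xi> t q b j p
  assumes \<xi>: "\<xi> \<in> partial_pairings m (Suc t)" and tm: "t < m"
    and cardU: "card (unpaired m (Suc t) \<xi>) = Suc p" and q: "q \<le> p"
  defines "j \<equiv> sorted_list_of_set (unpaired m (Suc t) \<xi>) ! q"
    and "b \<equiv> {Suc t, j}"
begin

lemma j_unpaired: "j \<in> unpaired m (Suc t) \<xi>"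
  using bij_betw_nth_sorted_list_of_set[of "unpaired m (Suc t) \<xi>"] q cardU
  by (auto simp: j_def bij_betw_def)

lemma j_gt: "Suc t < j" "j \<le> m"
  using j_unpaired unpaired_subset[of m "Suc t" \<xi>] by auto

lemma rank_j: "card {l \<in> unpaired m (Suc t) \<xi>. l < j} = q"
  using q cardU by (simp add: j_def card_less_nth_sorted_list_of_set)

lemma insert_b: "insert b \<xi> \<in> partial_pairings m t"
  unfolding b_def by (rule insert_pair_in_partial_pairings[OF \<xi> tm j_unpaired])

lemma b_notin: "b \<notin> \<xi>"
  using Suc_notin_pairing[OF \<xi> tm] by (auto simp: b_def)

lemma blk_insert_b: "l \<in> b \<Longrightarrow> blk (insert b \<xi>) l = b" "l \<in> \<Union>\<xi> \<Longrightarrow> blk (insert b \<xi>) l = blk \<xi> l"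
  using blk_eq[OF partial_pairings_disjoint[OF insert_b]] blk_eq[OF partial_pairings_disjoint[OF \<xi>]]
  by auto

lemma j_notin: "j \<notin> \<Union>\<xi>"
  using j_unpaired by (simp add: unpaired_eq[OF \<xi>])

text \<open>The variable \<open>x\<close> of the new block has two roles: argument of the
  annihilating label, and the entry which the earlier stage sees at position
  \<open>q\<close>.\<close>

lemma assign_insert:
  assumes len: "length xs = p"
  shows "assign (insert b \<xi>) t xs (u(b := x)) (Suc t) = x"
    and "l \<in> {Suc t<..m} \<Longrightarrow>
      assign (insert b \<xi>) t xs (u(b := x)) l = assign \<xi> (Suc t) (take q xs @ x # drop q xs) u l"
proof -
  let ?U = "unpaired m (Suc t) \<xi>"
  show "assign (insert b \<xi>) t xs (u(b := x)) (Suc t) = x"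
    using blk_insert_b(1)[of "Suc t"] by (auto simp: assign_def b_def)
  assume l: "l \<in> {Suc t<..m}"
  have qlen: "length (take q xs) = q" using len q by simp
  consider "l \<in> \<Union>\<xi>" | "l = j" | "l \<noteq> j" "l \<in> ?U"
    using l by (auto simp: unpaired_eq[OF \<xi>])
  then show "assign (insert b \<xi>) t xs (u(b := x)) l = assign \<xi> (Suc t) (take q xs @ x # drop q xs) u l"
  proof cases
    case 1
    then have "blk \<xi> l \<in> \<xi>" using blk_eq[OF partial_pairings_disjoint[OF \<xi>]] by auto
    then show ?thesis using 1 b_notin by (auto simp: assign_def blk_insert_b)
  next
    case 2
    have "j \<in> b" by (simp add: b_def)
    then have "assign (insert b \<xi>) t xs (u(b := x)) l = x"
      using 2 blk_insert_b(1)[of j] by (auto simp: assign_def)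
    moreover have "assign \<xi> (Suc t) (take q xs @ x # drop q xs) u l = x"
      using 2 j_notin nth_append_length[of "take q xs" x "drop q xs"] unfolding qlen
      by (simp add: assign_def rank_j)
    ultimately show ?thesis by simp
  next
    case 3
    have nU: "l \<notin> \<Union>\<xi>" "l \<notin> b" using 3 l by (auto simp: unpaired_eq[OF \<xi>] b_def)
    have U': "unpaired m t (insert b \<xi>) = ?U - {j}"
      unfolding b_def by (rule unpaired_insert_pair[OF \<xi> tm j_unpaired])
    let ?r = "card {l' \<in> ?U. l' < l}"
    show ?thesis
    proof (cases "l < j")
      case True
      then have "{l' \<in> ?U - {j}. l' < l} = {l' \<in> ?U. l' < l}" by auto
      moreover have "?r < q"
        unfolding rank_j[symmetric] using True 3 by (intro psubset_card_mono) auto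
      ultimately show ?thesis using nU len q by (simp add: assign_def U' nth_append)
    next
      case False
      then have "{l' \<in> ?U. l' < l} = insert j {l' \<in> ?U - {j}. l' < l}" using 3 j_unpaired by auto
      \<comment> \<open>Removing \<open>j\<close> lowers the ranks of later labels by one, and
        inserting \<open>x\<close> raises their positions by one; the two shifts cancel.\<close>
      then have r: "?r = Suc (card {l' \<in> ?U - {j}. l' < l})" by (simp add: card_insert_disjoint)
      moreover have "q \<le> card {l' \<in> ?U - {j}. l' < l}"
        unfolding rank_j[symmetric] using False by (intro card_mono) auto
      ultimately show ?thesis using nU len q by (simp add: assign_def U' nth_append qlen)
    qed
  qed
qed

text \<open>This is where a product $Q^{(k)}$ arises: the annihilated particle at position \<^term>\<open>q\<close> has
  passed the particles \<open>0, \<dots>, q - 1\<close> on its way to the front.\<close>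
lemma amplitude_insert:
  assumes len: "length xs = p"
  shows "amplitude (insert b \<xi>) t (assign (insert b \<xi>) t xs (u(b := x))) \<alpha> =
    (\<Sum>a\<in>UNIV. f' (Suc t) x a * foldr (\<lambda>i. list_pair (Q (fst x) (fst (xs ! i))) i) [0..<q]
      (amplitude \<xi> (Suc t) (assign \<xi> (Suc t) (take q xs @ x # drop q xs) u)) (a # \<alpha>))"
proof -
  let ?U = "unpaired m (Suc t) \<xi>" and ?x = "assign (insert b \<xi>) t xs (u(b := x))"
  have Min_b: "Min b = Suc t" and Max_b: "Max b = j"
    using j_gt by (auto simp: b_def min_def max_def)
  have Ix: "Ix (insert b \<xi>) = insert (Suc t) (Ix \<xi>)" by (simp add: Ix_def Min_b)
  \<comment> \<open>The new block contains \<open>Suc t\<close>, so \<open>unpaired\<close> ignores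
    it at all stages from \<open>Suc t\<close> on.\<close>
  have unp: "unpaired m k (insert b \<xi>) = unpaired m k \<xi>" if "k \<ge> Suc t" for k
    using that by (auto simp: unpaired_def b_def)
  have "amplitude (insert b \<xi>) (Suc t) ?x =
      amplitude \<xi> (Suc t) (assign \<xi> (Suc t) (take q xs @ x # drop q xs) u)"
  proof (rule amplitude_cong)
    fix k assume k: "k \<in> {Suc t<..m}"
    show "?x k = assign \<xi> (Suc t) (take q xs @ x # drop q xs) u k"
      by (rule assign_insert(2)[OF len k])
    show eq: "k \<in> Ix (insert b \<xi>) \<longleftrightarrow> k \<in> Ix \<xi>" using k by (simp add: Ix)
    assume "k \<in> Ix (insert b \<xi>)"
    then obtain c where "c \<in> \<xi>" "k = Min c" using eq by (auto simp: Ix_def)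
    moreover from this have "k \<in> c"
      using \<xi> by (auto simp: partial_pairings_def intro!: Min_in intro: finite_subset)
    ultimately show "Max (blk (insert b \<xi>) k) = Max (blk \<xi> k)" by (subst blk_insert_b) auto
  qed (use tm unp in auto)
  moreover have "foldr (\<lambda>i. list_pair (Q (fst x) (fst (?x (sorted_list_of_set ?U ! i)))) i) [0..<q] g =
      foldr (\<lambda>i. list_pair (Q (fst x) (fst (xs ! i))) i) [0..<q] g" for g
  proof (rule foldr_list_pair_cong)
    fix i assume "i \<in> set [0..<q]"
    then have i: "i < q" "i < card ?U" using q cardU by auto
    let ?l = "sorted_list_of_set ?U ! i"
    have l: "?l \<in> ?U"
      using bij_betw_nth_sorted_list_of_set[of ?U] i by (auto simp: bij_betw_def)
    then have "?x ?l = assign \<xi> (Suc t) (take q xs @ x # drop q xs) u ?l"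
      using unpaired_subset[of m "Suc t" \<xi>] by (intro assign_insert(2)[OF len]) auto
    also have "\<dots> = (take q xs @ x # drop q xs) ! i"
      using l card_less_nth_sorted_list_of_set[OF _ i(2)] by (simp add: assign_def unpaired_eq[OF \<xi>])
    also have "\<dots> = xs ! i" using i len q by (simp add: nth_append)
    finally show "Q (fst x) (fst (?x ?l)) = Q (fst x) (fst (xs ! i))" by simp
  qed
  moreover have "blk (insert b \<xi>) (Suc t) = b" by (rule blk_insert_b) (simp add: b_def)
  ultimately show ?thesis
    using tm by (simp add: amplitude_rec wick_step_def Ix unp assign_insert(1)[OF len] Max_b rank_j)
qed

text \<open>The matrices depend on \<open>x\<close> and \<open>xs\<close> but not on the old block
  variables, so they move inside the integral over \<open>u\<close>; Fubini then makes
  \<open>x\<close> the variable of the block \<open>b\<close>.\<close>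

lemma
  fixes \<alpha> :: "'r list"
  assumes len: "length xs = p"
  defines "K \<equiv> \<lambda>x. \<Sum>a\<in>UNIV. f' (Suc t) x a * Uword Q [0..<q] (pairing_integral \<xi> (Suc t)) (x # xs) (a # \<alpha>)"
  shows integrable_annihilate: "integrable lborel K"
    and integral_annihilate: "integral\<^sup>L lborel K = pairing_integral (insert b \<xi>) t xs \<alpha>"
proof -
  interpret product_sigma_finite "\<lambda>_::nat set. lborel :: 'e pt measure" by standard
  have K: "K = (\<lambda>x. \<integral>u. amplitude (insert b \<xi>) t (assign (insert b \<xi>) t xs (u(b := x))) \<alpha> \<partial>pair_measure \<xi>)"
  proof
    fix x
    have int: "integrable (pair_measure \<xi>) (\<lambda>u. amplitude \<xi> (Suc t) (assign \<xi> (Suc t) ys u) \<beta>)" for ys \<beta>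
      using tm \<xi> by (intro integrable_amplitude) auto
    have "Uword Q [0..<q] (pairing_integral \<xi> (Suc t)) (x # xs) \<beta> =
        (\<integral>u. foldr (\<lambda>i. list_pair (Q (fst x) (fst (xs ! i))) i) [0..<q]
          (amplitude \<xi> (Suc t) (assign \<xi> (Suc t) (take q xs @ x # drop q xs) u)) \<beta> \<partial>pair_measure \<xi>)" for \<beta>
      using q len by (simp add: Uword_upt_Cons pairing_integral_def[abs_def] integral_foldr_list_pair[OF int])
    then show "K x = (\<integral>u. amplitude (insert b \<xi>) t (assign (insert b \<xi>) t xs (u(b := x))) \<alpha> \<partial>pair_measure \<xi>)"
      by (simp add: K_def amplitude_insert[OF len] integrable_foldr_list_pair[OF int])
  qed
  note fubini = integrable_PiM_insert[OF partial_pairings_finite[OF \<xi>] b_notin]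
    product_integral_insert_rev[OF partial_pairings_finite[OF \<xi>] b_notin]
  have int: "integrable (pair_measure (insert b \<xi>)) (\<lambda>u. amplitude (insert b \<xi>) t (assign (insert b \<xi>) t xs u) \<alpha>)"
    using tm insert_b by (intro integrable_amplitude) auto
  show "integrable lborel K" unfolding K by (rule fubini(1)[OF int])
  show "integral\<^sup>L lborel K = pairing_integral (insert b \<xi>) t xs \<alpha>"
    unfolding K pairing_integral_def by (rule fubini(2)[OF int])
qed

end

text \<open>\<open>symmetrizer_Cons\<close> splits the vector by the position of the annihilated
  particle. Positions correspond to unpaired labels, hence to the possible new pairs, and the factor
  \<open>Suc p\<close> in \<open>ann\<close> turns 1/(p+1)! into 1/p!.\<close>

lemma annihilate_Pn:
  assumes fin: "finite S" and len: "length xs = p" "length \<alpha> = p" and tm: "t < m"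
    and S: "\<And>\<xi>. \<xi> \<in> S \<Longrightarrow> \<xi> \<in> partial_pairings m (Suc t) \<and> card (unpaired m (Suc t) \<xi>) = Suc p"
    and \<Phi>: "\<And>ys \<beta>. length ys = Suc p \<Longrightarrow> length \<beta> = Suc p \<Longrightarrow>
      \<Phi> (Suc p) ys \<beta> = Pn Q (Suc p) (\<lambda>xs \<alpha>. \<Sum>\<xi>\<in>S. pairing_integral \<xi> (Suc t) xs \<alpha>) ys \<beta>"
  shows "ann (f' (Suc t)) \<Phi> p xs \<alpha> =
    Pn Q p (\<lambda>xs \<alpha>. \<Sum>\<xi>\<in>S. \<Sum>j\<in>unpaired m (Suc t) \<xi>. pairing_integral (insert {Suc t, j} \<xi>) t xs \<alpha>) xs \<alpha>"
proof -
  let ?R = "\<lambda>xs \<alpha>. \<Sum>\<xi>\<in>S. pairing_integral \<xi> (Suc t) xs \<alpha>"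
  define K where "K \<xi> k x xs \<alpha> = (\<Sum>a\<in>UNIV. f' (Suc t) x a *
    Uword Q [0..<k] (pairing_integral \<xi> (Suc t)) (x # xs) (a # \<alpha>))" for \<xi> k x xs \<alpha>
  let ?L = "\<lambda>\<xi>. sorted_list_of_set (unpaired m (Suc t) \<xi>)"
  have int: "integrable lborel (\<lambda>x. K \<xi> k x ys \<beta>)"
    and eq: "(\<integral>x. K \<xi> k x ys \<beta> \<partial>lborel) = pairing_integral (insert {Suc t, ?L \<xi> ! k} \<xi>) t ys \<beta>"
    if "\<xi> \<in> S" "k \<le> p" "length ys = p" for \<xi> k ys \<beta>
    unfolding K_def using integrable_annihilate integral_annihilate that S tm by blast+
  have "(\<Sum>a\<in>UNIV. \<Phi> (Suc p) (x # xs) (a # \<alpha>) * f' (Suc t) x a) =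
      symmetrizer p (\<lambda>xs \<alpha>. \<Sum>\<xi>\<in>S. \<Sum>k\<le>p. K \<xi> k x xs \<alpha>) xs \<alpha> / fact (Suc p)" for x
  proof -
    have "(\<Sum>a\<in>UNIV. \<Phi> (Suc p) (x # xs) (a # \<alpha>) * f' (Suc t) x a) =
        (\<Sum>a\<in>UNIV. f' (Suc t) x a * symmetrizer p (\<lambda>xs \<alpha>. \<Sum>k\<le>p. Uword Q [0..<k] ?R (x # xs) (a # \<alpha>)) xs \<alpha>)
          / fact (Suc p)"
      using len by (simp add: \<Phi> Pn_eq_symmetrizer symmetrizer_Cons sum_divide_distrib mult.commute)
    also have "(\<Sum>a\<in>UNIV. f' (Suc t) x a * symmetrizer p (\<lambda>xs \<alpha>. \<Sum>k\<le>p. Uword Q [0..<k] ?R (x # xs) (a # \<alpha>)) xs \<alpha>) =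
        symmetrizer p (\<lambda>xs \<alpha>. \<Sum>a\<in>UNIV. f' (Suc t) x a * (\<Sum>k\<le>p. Uword Q [0..<k] ?R (x # xs) (a # \<alpha>))) xs \<alpha>"
      unfolding symmetrizer_def Uword_sum Uword_mult sum_distrib_left by (rule sum.swap)
    also have "\<dots> = symmetrizer p (\<lambda>xs \<alpha>. \<Sum>\<xi>\<in>S. \<Sum>k\<le>p. K \<xi> k x xs \<alpha>) xs \<alpha>"
    proof (rule symmetrizer_cong)
      fix ys \<beta>
      have "(\<Sum>a\<in>UNIV. f' (Suc t) x a * (\<Sum>k\<le>p. Uword Q [0..<k] ?R (x # ys) (a # \<beta>))) =
          (\<Sum>a\<in>UNIV. \<Sum>k\<le>p. \<Sum>\<xi>\<in>S. f' (Suc t) x a * Uword Q [0..<k] (pairing_integral \<xi> (Suc t)) (x # ys) (a # \<beta>))"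
        by (simp add: Uword_sum sum_distrib_left)
      also have "\<dots> = (\<Sum>k\<le>p. \<Sum>a\<in>UNIV. \<Sum>\<xi>\<in>S. f' (Suc t) x a * Uword Q [0..<k] (pairing_integral \<xi> (Suc t)) (x # ys) (a # \<beta>))"
        by (rule sum.swap)
      also have "\<dots> = (\<Sum>k\<le>p. \<Sum>\<xi>\<in>S. K \<xi> k x ys \<beta>)"
        unfolding K_def by (rule sum.cong[OF refl sum.swap])
      also have "\<dots> = (\<Sum>\<xi>\<in>S. \<Sum>k\<le>p. K \<xi> k x ys \<beta>)" by (rule sum.swap)
      finally show "(\<Sum>a\<in>UNIV. f' (Suc t) x a * (\<Sum>k\<le>p. Uword Q [0..<k] ?R (x # ys) (a # \<beta>))) =
        (\<Sum>\<xi>\<in>S. \<Sum>k\<le>p. K \<xi> k x ys \<beta>)" .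
    qed
    finally show ?thesis .
  qed
  moreover have "of_nat (Suc p) * (z / fact (Suc p)) = z / fact p" for z :: complex
    by (simp only: fact_Suc times_divide_eq_right) (simp del: of_nat_Suc)
  ultimately have "ann (f' (Suc t)) \<Phi> p xs \<alpha> =
      (\<integral>x. symmetrizer p (\<lambda>xs \<alpha>. \<Sum>\<xi>\<in>S. \<Sum>k\<le>p. K \<xi> k x xs \<alpha>) xs \<alpha> \<partial>lborel) / fact p"
    by (simp only: ann_def integral_divide_zero)
  also have "(\<integral>x. symmetrizer p (\<lambda>xs \<alpha>. \<Sum>\<xi>\<in>S. \<Sum>k\<le>p. K \<xi> k x xs \<alpha>) xs \<alpha> \<partial>lborel) =
      symmetrizer p (\<lambda>xs \<alpha>. \<integral>x. (\<Sum>\<xi>\<in>S. \<Sum>k\<le>p. K \<xi> k x xs \<alpha>) \<partial>lborel) xs \<alpha>"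
  proof -
    have i: "integrable lborel (\<lambda>x. \<Sum>\<xi>\<in>S. \<Sum>k\<le>p. K \<xi> k x ys \<beta>)" if "length ys = length xs" for ys \<beta>
      using that len by (intro Bochner_Integration.integrable_sum int) auto
    show ?thesis
      unfolding symmetrizer_def
      by (simp add: integral_Uword[OF i] integrable_Uword[OF i])
  qed
  also have "\<dots> = symmetrizer p (\<lambda>xs \<alpha>. \<Sum>\<xi>\<in>S. \<Sum>j\<in>unpaired m (Suc t) \<xi>.
      pairing_integral (insert {Suc t, j} \<xi>) t xs \<alpha>) xs \<alpha>"
  proof (rule symmetrizer_cong)
    fix ys :: "'e pt list" and \<beta> :: "'r list"
    assume "length ys = length xs"
    then have ys: "length ys = p" using len by simp
    have "(\<integral>x. (\<Sum>\<xi>\<in>S. \<Sum>k\<le>p. K \<xi> k x ys \<beta>) \<partial>lborel) =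
        (\<Sum>\<xi>\<in>S. \<integral>x. (\<Sum>k\<le>p. K \<xi> k x ys \<beta>) \<partial>lborel)"
      by (intro Bochner_Integration.integral_sum Bochner_Integration.integrable_sum int ys) auto
    also have "\<dots> = (\<Sum>\<xi>\<in>S. \<Sum>k\<le>p. \<integral>x. K \<xi> k x ys \<beta> \<partial>lborel)"
      by (rule sum.cong[OF refl], rule Bochner_Integration.integral_sum) (simp add: int ys)
    also have "\<dots> = (\<Sum>\<xi>\<in>S. \<Sum>k\<le>p. pairing_integral (insert {Suc t, ?L \<xi> ! k} \<xi>) t ys \<beta>)"
      by (rule sum.cong[OF refl], rule sum.cong[OF refl]) (simp add: eq ys)
    also have "\<dots> = (\<Sum>\<xi>\<in>S. \<Sum>j\<in>unpaired m (Suc t) \<xi>. pairing_integral (insert {Suc t, j} \<xi>) t ys \<beta>)"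
    proof (rule sum.cong[OF refl])
      fix \<xi> assume "\<xi> \<in> S"
      then have "{..p} = {..<card (unpaired m (Suc t) \<xi>)}" using S by auto
      then show "(\<Sum>k\<le>p. pairing_integral (insert {Suc t, ?L \<xi> ! k} \<xi>) t ys \<beta>) =
          (\<Sum>j\<in>unpaired m (Suc t) \<xi>. pairing_integral (insert {Suc t, j} \<xi>) t ys \<beta>)"
        by (simp add: sum.reindex_bij_betw[OF bij_betw_nth_sorted_list_of_set[OF finite_unpaired],
              of "\<lambda>j. pairing_integral (insert {Suc t, j} \<xi>) t ys \<beta>"])
    qed
    finally show "(\<integral>x. (\<Sum>\<xi>\<in>S. \<Sum>k\<le>p. K \<xi> k x ys \<beta>) \<partial>lborel) = \<dots>" .
  qed
  finally show ?thesis using len by (simp add: Pn_eq_symmetrizer)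
qed

text \<open>The particle number is generalised in the downward induction because creation refers to
  \<open>p - 1\<close> and annihilation to \<open>Suc p\<close>.\<close>

lemma field_product_vacuum:
  assumes "t \<le> m" "length xs = p" "length \<alpha> = p"
  shows "foldr (\<lambda>k. field_op Q (f k) (f' k)) [Suc t..<Suc m] vac p xs \<alpha> =
    Pn Q p (\<lambda>xs \<alpha>. \<Sum>\<xi>\<in>{\<xi>\<in>partial_pairings m t. card (unpaired m t \<xi>) = p}. pairing_integral \<xi> t xs \<alpha>) xs \<alpha>"
  using assms
proof (induction t arbitrary: p xs \<alpha> rule: inc_induct)
  case base
  have unp: "unpaired m m {} = {}" by (simp add: unpaired_def)
  show ?case
  proof (cases "p = 0")
    case True
    interpret product_sigma_finite "\<lambda>_::nat set. lborel :: 'e pt measure" by standard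
    have "{\<xi> \<in> partial_pairings m m. card (unpaired m m \<xi>) = p} = {{}}"
      using True unp by (auto simp: partial_pairings_top)
    then show ?thesis
      using base True
      by (simp add: vac_def Pn_eq_symmetrizer symmetrizer_def pairing_integral_def amplitude_top PiM_empty)
  next
    case False
    then have "{\<xi> \<in> partial_pairings m m. card (unpaired m m \<xi>) = p} = {}"
      using unp by (auto simp: partial_pairings_top)
    \<comment> \<open>\<open>Pn_sum\<close> over an empty family says that \<open>Pn\<close> maps
      the zero function to zero.\<close>
    then show ?thesis
      using False Pn_sum[of p "\<lambda>_. undefined" "{}" xs \<alpha>]
      by (simp only: sum.empty vac_def upt_rec[of "Suc m"] less_irrefl if_False foldr_Nil id_apply)
  qed
next
  case (step t)
  let ?\<Phi> = "foldr (\<lambda>k. field_op Q (f k) (f' k)) [Suc (Suc t)..<Suc m] vac"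
  let ?S = "\<lambda>p. {\<xi>\<in>partial_pairings m (Suc t). card (unpaired m (Suc t) \<xi>) = p}"
  let ?C = "{\<xi>\<in>partial_pairings m (Suc t). Suc (card (unpaired m (Suc t) \<xi>)) = p}"
  let ?A = "\<lambda>xs \<alpha>. \<Sum>\<xi>\<in>?S (Suc p). \<Sum>j\<in>unpaired m (Suc t) \<xi>. pairing_integral (insert {Suc t, j} \<xi>) t xs \<alpha>"
  have ann: "ann (f' (Suc t)) ?\<Phi> p xs \<alpha> = Pn Q p ?A xs \<alpha>"
    using step.prems step.hyps finite_partial_pairings[of m "Suc t"]
    by (intro annihilate_Pn step.IH) auto
  have cre: "cre Q (f (Suc t)) ?\<Phi> p xs \<alpha> = Pn Q p (\<lambda>xs \<alpha>. \<Sum>\<xi>\<in>?C. pairing_integral \<xi> t xs \<alpha>) xs \<alpha>"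
  proof (cases p)
    case 0
    then show ?thesis using Pn_sum[of p "\<lambda>_. undefined" "{}" xs \<alpha>] by (simp add: cre_def)
  next
    case (Suc p')
    let ?R = "\<lambda>xs \<alpha>. \<Sum>\<xi>\<in>?S p'. pairing_integral \<xi> (Suc t) xs \<alpha>"
    have "cre Q (f (Suc t)) ?\<Phi> p xs \<alpha> =
        Pn Q (Suc p') (\<lambda>xs \<alpha>. f (Suc t) (hd xs) (hd \<alpha>) * ?\<Phi> p' (tl xs) (tl \<alpha>)) xs \<alpha>"
      by (simp add: cre_def Suc)
    also have "\<dots> = Pn Q (Suc p') (\<lambda>xs \<alpha>. f (Suc t) (hd xs) (hd \<alpha>) * Pn Q p' ?R (tl xs) (tl \<alpha>)) xs \<alpha>"
    proof (rule Pn_cong)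
      fix ys :: "'e pt list" and \<beta> :: "'r list"
      assume "length ys = length xs" "length \<beta> = length \<alpha>"
      then have "?\<Phi> p' (tl ys) (tl \<beta>) = Pn Q p' ?R (tl ys) (tl \<beta>)"
        using step.prems Suc by (intro step.IH) simp_all
      then show "f (Suc t) (hd ys) (hd \<beta>) * ?\<Phi> p' (tl ys) (tl \<beta>) =
          f (Suc t) (hd ys) (hd \<beta>) * Pn Q p' ?R (tl ys) (tl \<beta>)" by (simp only:)
    qed
    also have "\<dots> = Pn Q p (\<lambda>xs \<alpha>. f (Suc t) (hd xs) (hd \<alpha>) * ?R (tl xs) (tl \<alpha>)) xs \<alpha>"
      using step.prems Suc by (simp add: Pn_tensor_Pn)
    also have "\<dots> = Pn Q p (\<lambda>xs \<alpha>. \<Sum>\<xi>\<in>?C. pairing_integral \<xi> t xs \<alpha>) xs \<alpha>"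
      using step.prems step.hyps Suc
      by (intro Pn_cong) (simp add: sum_distrib_left pairing_integral_create)
    finally show ?thesis .
  qed
  have "foldr (\<lambda>k. field_op Q (f k) (f' k)) [Suc t..<Suc m] vac = field_op Q (f (Suc t)) (f' (Suc t)) ?\<Phi>"
    using step.hyps by (simp add: upt_conv_Cons del: upt_Suc)
  then have "foldr (\<lambda>k. field_op Q (f k) (f' k)) [Suc t..<Suc m] vac p xs \<alpha> =
      Pn Q p (\<lambda>xs \<alpha>. \<Sum>\<xi>\<in>?C. pairing_integral \<xi> t xs \<alpha>) xs \<alpha> + Pn Q p ?A xs \<alpha>"
    by (simp only: field_op_def ann cre)
  also have "\<dots> = Pn Q p (\<lambda>xs \<alpha>. (\<Sum>\<xi>\<in>?C. pairing_integral \<xi> t xs \<alpha>) + ?A xs \<alpha>) xs \<alpha>"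
    by (rule Pn_add[symmetric])
  finally show ?case
    using step.hyps by (simp only: sum_partial_pairings_rec[of t m])
qed

lemma tau_prod_eq:
  "tau_prod Q f f' m = (\<Sum>\<xi>\<in>pair_partitions m. pairing_integral \<xi> 0 [] [])"
proof -
  have "{\<xi>\<in>partial_pairings m 0. card (unpaired m 0 \<xi>) = 0} = pair_partitions m"
    by (simp add: pair_partitions_eq)
  then show ?thesis
    using field_product_vacuum[of 0 "[]" 0 "[]"]
    by (simp add: tau_prod_def Pn_eq_symmetrizer symmetrizer_def)
qed

end

section \<open>Contraction of tensor slots\<close>

text \<open>Interpolates between the uncontracted tensor and the full index sum of
  \<open>Txi\<close>: indices outside \<open>A\<close> stay free.\<close>

definition sum_over :: "nat set \<Rightarrow> ((nat \<Rightarrow> 'r::finite) \<Rightarrow> complex) \<Rightarrow> (nat \<Rightarrow> 'r) \<Rightarrow> complex" where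
  "sum_over A G \<alpha> = (\<Sum>\<beta>\<in>PiE A (\<lambda>_. UNIV). G (override_on \<alpha> \<beta> A))"

lemma sum_over_empty [simp]: "sum_over {} G = G"
  by (simp add: sum_over_def fun_eq_iff)

lemma sum_over_insert:
  assumes "a \<notin> A"
  shows "sum_over (insert a A) G \<alpha> = (\<Sum>v\<in>UNIV. sum_over A G (\<alpha>(a := v)))"
proof -
  have inj: "inj_on (\<lambda>(y, g). g(a := y)) (UNIV \<times> PiE A (\<lambda>_. UNIV))"
    using inj_combinator[OF assms, of "\<lambda>_. UNIV"] by simp
  have "override_on \<alpha> (\<beta>(a := v)) (insert a A) = override_on (\<alpha>(a := v)) \<beta> A" for v \<beta>
    using assms by (auto simp: override_on_def fun_eq_iff)
  then show ?thesis
    unfolding sum_over_def PiE_insert_eq sum.reindex[OF inj]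
    by (simp add: case_prod_beta sum.cartesian_product comp_def)
qed

lemma sum_over_mult:
  assumes "\<And>\<gamma> \<beta>. c (override_on \<gamma> \<beta> A) = c \<gamma>"
  shows "sum_over A (\<lambda>\<gamma>. c \<gamma> * G \<gamma>) \<alpha> = c \<alpha> * sum_over A G \<alpha>"
  by (simp add: sum_over_def sum_distrib_left assms)

lemma sum_over_apply_pair:
  fixes C :: "'r::finite mat2"
  assumes "i \<notin> A" "j \<notin> A"
  shows "sum_over A (apply_pair C i j G) = apply_pair C i j (sum_over A G)"
proof
  fix \<alpha> :: "nat \<Rightarrow> 'r"
  have "(override_on \<alpha> \<beta> A)(i := v, j := w) = override_on (\<alpha>(i := v, j := w)) \<beta> A" for \<beta> v w
    using assms by (auto simp: override_on_def fun_eq_iff)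
  then show "sum_over A (apply_pair C i j G) \<alpha> = apply_pair C i j (sum_over A G) \<alpha>"
    using assms by (simp add: sum_over_def apply_pair_def sum_distrib_left sum.swap[of _ UNIV] override_on_def)
qed

lemma apply_pair_mult:
  assumes "\<And>\<gamma> v. c (\<gamma>(i := v)) = c \<gamma>" "\<And>\<gamma> v. c (\<gamma>(j := v)) = c \<gamma>"
  shows "apply_pair C i j (\<lambda>\<gamma>. c \<gamma> * G \<gamma>) = (\<lambda>\<gamma>. c \<gamma> * apply_pair C i j G \<gamma>)"
  by (simp add: apply_pair_def assms sum_distrib_left mult_ac)

lemma foldr_apply_pair_mult:
  assumes "\<And>p \<gamma> v. p \<in> set ps \<Longrightarrow> c (\<gamma>(i p := v)) = c \<gamma>" "\<And>p \<gamma> v. p \<in> set ps \<Longrightarrow> c (\<gamma>(j p := v)) = c \<gamma>"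
  shows "foldr (\<lambda>p. apply_pair (C p) (i p) (j p)) ps (\<lambda>\<gamma>. c \<gamma> * G \<gamma>) =
    (\<lambda>\<gamma>. c \<gamma> * foldr (\<lambda>p. apply_pair (C p) (i p) (j p)) ps G \<gamma>)"
  using assms by (induction ps) (simp_all add: apply_pair_mult)

lemma sum_over_foldr_apply_pair:
  assumes "\<And>p. p \<in> set ps \<Longrightarrow> i p \<notin> A \<and> j p \<notin> A"
  shows "sum_over A (foldr (\<lambda>p. apply_pair (C p) (i p) (j p)) ps G) =
    foldr (\<lambda>p. apply_pair (C p) (i p) (j p)) ps (sum_over A G)"
  using assms by (induction ps) (simp_all add: sum_over_apply_pair)

lemma map_fun_upd_nth:
  assumes "distinct L" "i < length L"
  shows "map (\<alpha>(L ! i := v)) L = (map \<alpha> L)[i := v]"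
  using assms by (intro nth_equalityI) (auto simp: nth_list_update nth_eq_iff_index_eq)

text \<open>Dictionary between slots named by labels, as in \<open>Qk\<close>, and slots named by
  positions, as in \<open>wick_step\<close>.\<close>

lemma foldr_apply_pair_map:
  assumes "distinct L" "\<forall>i\<in>set is. Suc i < length L"
  shows "foldr (\<lambda>i. apply_pair (C i) (L ! i) (L ! Suc i)) is (\<lambda>\<alpha>. g (map \<alpha> L)) =
    (\<lambda>\<alpha>. foldr (\<lambda>i. list_pair (C i) i) is g (map \<alpha> L))"
  using assms(2)
proof (induction "is")
  case (Cons i "is")
  then show ?case
    using assms(1) by (simp add: apply_pair_def list_pair_def map_fun_upd_nth fun_eq_iff)
qed simp

text \<open>Needed because \<open>Jsm\<close> is the initial segment of the unpaired labels that
  ends at the partner.\<close>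

lemma nth_sorted_list_of_set_initial:
  assumes "finite A" "i < card {l\<in>A. l \<le> (j::nat)}"
  shows "sorted_list_of_set {l\<in>A. l \<le> j} ! i = sorted_list_of_set A ! i"
proof -
  let ?A = "{l\<in>A. l \<le> j}" let ?l = "sorted_list_of_set ?A ! i"
  have l: "?l \<in> ?A"
    using bij_betw_nth_sorted_list_of_set[of ?A] assms by (auto simp: bij_betw_def)
  then have "{l'\<in>A. l' < ?l} = {l'\<in>?A. l' < ?l}" by auto
  then have "card {l'\<in>A. l' < ?l} = i"
    using card_less_nth_sorted_list_of_set[of ?A i] assms by simp
  then show ?thesis
    using nth_sorted_list_of_set_card_less[of A ?l] assms(1) l by simp
qed

lemma rev_sorted_list_of_set_nth:
  assumes "finite A" "i \<in> A"
  shows "rev (sorted_list_of_set A) ! card {i'\<in>A. (i::nat) < i'} = i"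
proof -
  have "A = {i'\<in>A. i' < i} \<union> insert i {i'\<in>A. i < i'}" using assms(2) by auto
  then have "card A = card {i'\<in>A. i' < i} + card (insert i {i'\<in>A. i < i'})"
    using assms(1) by (subst (1) \<open>A = _\<close>, intro card_Un_disjoint) auto
  then have "card A = card {i'\<in>A. i' < i} + Suc (card {i'\<in>A. i < i'})"
    using assms(1) by simp
  then show ?thesis
    using nth_sorted_list_of_set_card_less[OF assms] by (simp add: rev_nth)
qed

section \<open>Complete pairings\<close>

context
  fixes m :: nat and \<xi> :: "nat set set"
  assumes \<xi>: "\<xi> \<in> pair_partitions m"
begin

lemma pairing: "\<xi> \<in> partial_pairings m 0" "unpaired m 0 \<xi> = {}"
  using \<xi> by (simp_all add: pair_partitions_eq)

lemma Union_pairing: "\<Union>\<xi> = {0<..m}"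
  using \<xi> by (auto simp: pair_partitions_def partition_on_def)

lemma pairing_cases:
  assumes "l \<in> {0<..m}"
  obtains i j where "{i, j} \<in> \<xi>" "0 < i" "i < j" "j \<le> m" "blk \<xi> i = {i, j}" "blk \<xi> j = {i, j}"
    "i \<in> Ix \<xi>" "j \<in> Jx \<xi>" "l = i \<or> l = j"
proof -
  obtain b where b: "b \<in> \<xi>" "l \<in> b" using assms Union_pairing by blast
  obtain i j where ij: "b = {i, j}" "0 < i" "i < j" "j \<le> m"
    using partial_pairings_pair[OF pairing(1) b(1)] .
  then have "Min b = i" "Max b = j" by (auto simp: min_def max_def)
  then show thesis
    using b ij blk_eq[OF partial_pairings_disjoint[OF pairing(1)] b(1)]
    by (intro that[of i j]) (auto simp: Ix_def Jx_def intro: image_eqI[where x = b])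
qed

lemma Ix_blk: "i \<in> Ix \<xi> \<longleftrightarrow> i \<in> {0<..m} \<and> Min (blk \<xi> i) = i"
  and Jx_blk: "i \<in> Jx \<xi> \<longleftrightarrow> i \<in> {0<..m} \<and> Max (blk \<xi> i) = i"
proof -
  have *: "Min b \<in> b \<and> Max b \<in> b \<and> b \<subseteq> {0<..m} \<and> (\<forall>l\<in>b. blk \<xi> l = b)" if b: "b \<in> \<xi>" for b
  proof -
    obtain i j where "b = {i, j}" "0 < i" "i < j" "j \<le> m"
      using partial_pairings_pair[OF pairing(1) b] .
    then show ?thesis
      using blk_eq[OF partial_pairings_disjoint[OF pairing(1)] b] by (auto simp: min_def max_def)
  qed
  have blk: "blk \<xi> i \<in> \<xi>" if "i \<in> {0<..m}"
    using pairing_cases[OF that] by metis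
  show "i \<in> Ix \<xi> \<longleftrightarrow> i \<in> {0<..m} \<and> Min (blk \<xi> i) = i"
  proof
    assume "i \<in> Ix \<xi>"
    then obtain b where "b \<in> \<xi>" "i = Min b" unfolding Ix_def by blast
    then show "i \<in> {0<..m} \<and> Min (blk \<xi> i) = i" using *[of b] by (metis subsetD)
  next
    assume "i \<in> {0<..m} \<and> Min (blk \<xi> i) = i"
    then show "i \<in> Ix \<xi>" unfolding Ix_def using blk by (metis image_eqI)
  qed
  show "i \<in> Jx \<xi> \<longleftrightarrow> i \<in> {0<..m} \<and> Max (blk \<xi> i) = i"
  proof
    assume "i \<in> Jx \<xi>"
    then obtain b where "b \<in> \<xi>" "i = Max b" unfolding Jx_def by blast
    then show "i \<in> {0<..m} \<and> Max (blk \<xi> i) = i" using *[of b] by (metis subsetD)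
  next
    assume "i \<in> {0<..m} \<and> Max (blk \<xi> i) = i"
    then show "i \<in> Jx \<xi>" unfolding Jx_def using blk by (metis image_eqI)
  qed
qed

lemma Ix_Jx: "Ix \<xi> \<inter> Jx \<xi> = {}" "Ix \<xi> \<union> Jx \<xi> = {0<..m}"
proof -
  have "(l \<in> Ix \<xi>) \<noteq> (l \<in> Jx \<xi>)" if "l \<in> {0<..m}" for l
    using that
  proof (rule pairing_cases)
    fix i j assume "i < j" "blk \<xi> i = {i, j}" "blk \<xi> j = {i, j}" "l = i \<or> l = j"
    then show ?thesis using that by (auto simp: Ix_blk Jx_blk)
  qed
  moreover have "Ix \<xi> \<subseteq> {0<..m}" "Jx \<xi> \<subseteq> {0<..m}" by (auto simp: Ix_blk Jx_blk)
  ultimately show "Ix \<xi> \<inter> Jx \<xi> = {}" "Ix \<xi> \<union> Jx \<xi> = {0<..m}" by blast+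
qed

lemma Ix_le: "i \<in> Ix \<xi> \<Longrightarrow> 0 < i \<and> i \<le> m" and Jx_le: "i \<in> Jx \<xi> \<Longrightarrow> 0 < i \<and> i \<le> m"
  by (simp_all add: Ix_blk Jx_blk)

lemma finite_Ix_Jx [simp]: "finite (Ix \<xi>)" "finite (Jx \<xi>)"
  using finite_subset[of "Ix \<xi>" "{0<..m}"] finite_subset[of "Jx \<xi>" "{0<..m}"] Ix_Jx by auto

text \<open>Above \<open>t\<close> a label is unpaired exactly if it closes a block opened at or
  below \<open>t\<close>; in this form the set can be compared with \<open>Jsm\<close>.\<close>

lemma unpaired_pairing:
  "unpaired m t \<xi> = {j\<in>Jx \<xi>. t < j \<and> (\<forall>i\<in>Ix \<xi>. t < i \<longrightarrow> j \<noteq> Max (blk \<xi> i))}" (is "_ = ?R")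
proof (intro equalityI subsetI)
  fix l assume l: "l \<in> unpaired m t \<xi>"
  then have lt: "l \<in> {t<..m}" "\<And>b. b \<in> \<xi> \<Longrightarrow> l \<in> b \<Longrightarrow> \<not> b \<subseteq> {t<..}"
    by (auto simp: unpaired_def)
  then have "l \<in> {0<..m}" by auto
  then show "l \<in> ?R"
  proof (rule pairing_cases)
    fix i j assume ij: "{i, j} \<in> \<xi>" "0 < i" "i < j" "j \<le> m" "blk \<xi> i = {i, j}" "blk \<xi> j = {i, j}"
      "i \<in> Ix \<xi>" "j \<in> Jx \<xi>" "l = i \<or> l = j"
    have "\<not> t < i" using lt(2)[OF ij(1)] ij(3,9) by auto
    then have "l = j" using ij(9) lt(1) by auto
    moreover have "j \<noteq> Max (blk \<xi> i')" if "i' \<in> Ix \<xi>" "t < i'" for i'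
    proof
      assume j: "j = Max (blk \<xi> i')"
      have "i' \<in> {0<..m}" using that Ix_Jx by auto
      then show False
      proof (rule pairing_cases)
        fix k k' assume k: "{k, k'} \<in> \<xi>" "k < k'" "blk \<xi> k = {k, k'}" "blk \<xi> k' = {k, k'}"
          "k' \<in> Jx \<xi>" "i' = k \<or> i' = k'"
        have "i' = k" using k that(1) Ix_Jx(1) by auto
        then have "j = k'" using j k by (simp add: max_def)
        then have "i = k" using k ij by (auto simp: doubleton_eq_iff)
        then show False using \<open>i' = k\<close> that \<open>\<not> t < i\<close> by simp
      qed
    qed
    ultimately show "l \<in> ?R" using ij lt(1) by auto
  qed
next
  fix l assume l: "l \<in> ?R"
  then have lm: "l \<in> {0<..m}" using Ix_Jx by auto
  have False if b: "b \<in> \<xi>" "l \<in> b" "b \<subseteq> {t<..}" for b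
    using lm
  proof (rule pairing_cases)
    fix i j assume ij: "{i, j} \<in> \<xi>" "i < j" "blk \<xi> i = {i, j}" "i \<in> Ix \<xi>" "l = i \<or> l = j"
    have "b = {i, j}"
      using ij b blk_eq[OF partial_pairings_disjoint[OF pairing(1)]] by (metis insert_iff)
    moreover have "l = j" using ij l Ix_Jx(1) by auto
    ultimately show False using l ij b(3) by (auto simp: max_def)
  qed
  then show "l \<in> unpaired m t \<xi>" using l lm by (auto simp: unpaired_def)
qed

text \<open>Converts labels into the index k of \<open>ik\<close>, which counts openers from the
  largest down.\<close>

definition num_contracted :: "nat \<Rightarrow> nat" where
  "num_contracted t = card {i\<in>Ix \<xi>. t < i}"

text \<open>The tensor factors that are still uncontracted when the operators \<^term>\<open>Suc t\<close>, \dots, \<^term>\<open>m\<close>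
  have acted; the bold $J^{(k)}$ is \<open>slots (i_k)\<close>.\<close>
definition slots :: "nat \<Rightarrow> nat set" where
  "slots t = {j\<in>Jx \<xi>. t < j} - bexcl \<xi> (num_contracted t)"

lemma finite_slots [simp]: "finite (slots t)"
  by (simp add: slots_def)

lemma num_contracted_top: "num_contracted m = 0" and slots_top: "slots m = {}"
  by (auto simp: num_contracted_def slots_def dest: Ix_le Jx_le)

context
  fixes t assumes tm: "t < m"
begin

lemma Suc_cases: "Suc t \<in> Jx \<xi> \<and> Suc t \<notin> Ix \<xi> \<or> Suc t \<in> Ix \<xi> \<and> Suc t \<notin> Jx \<xi>"
proof -
  have "Suc t \<in> {0<..m}" using tm by simp
  then show ?thesis using Ix_Jx by blast
qed

lemma Jx_Suc:
  assumes "Suc t \<in> Jx \<xi>"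
  shows "num_contracted t = num_contracted (Suc t)"
    and "{j\<in>Jx \<xi>. t < j} = insert (Suc t) {j\<in>Jx \<xi>. Suc t < j}"
    and "unpaired m t \<xi> = insert (Suc t) (unpaired m (Suc t) \<xi>)"
proof -
  have gt: "t < i \<longleftrightarrow> Suc t < i" if "i \<in> Ix \<xi>" for i
    using that assms Ix_Jx(1) by (metis Suc_lessI disjoint_iff Suc_lessD)
  show "num_contracted t = num_contracted (Suc t)" unfolding num_contracted_def using gt by (intro arg_cong[where f=card]) auto
  show "{j\<in>Jx \<xi>. t < j} = insert (Suc t) {j\<in>Jx \<xi>. Suc t < j}" using assms by auto
  have "Suc t \<noteq> Max (blk \<xi> i)" if "i \<in> Ix \<xi>" "Suc t < i" for i
  proof -
    have "i \<in> {0<..m}" using that Ix_Jx by auto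
    then show ?thesis
      by (rule pairing_cases) (use that in \<open>auto simp: max_def\<close>)
  qed
  then show "unpaired m t \<xi> = insert (Suc t) (unpaired m (Suc t) \<xi>)"
    unfolding unpaired_pairing using assms gt by (auto intro: Suc_lessI)
qed

lemma Ix_Suc:
  assumes "Suc t \<in> Ix \<xi>"
  shows "num_contracted t = Suc (num_contracted (Suc t))"
    and "{j\<in>Jx \<xi>. t < j} = {j\<in>Jx \<xi>. Suc t < j}"
    and "unpaired m t \<xi> = unpaired m (Suc t) \<xi> - {Max (blk \<xi> (Suc t))}"
    and "Max (blk \<xi> (Suc t)) \<in> unpaired m (Suc t) \<xi>"
    and "ik \<xi> (num_contracted t) = Suc t"
    and "{i\<in>Ix \<xi>. t < i} = insert (Suc t) {i\<in>Ix \<xi>. Suc t < i}"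
proof -
  have gt: "t < j \<longleftrightarrow> Suc t < j" if "j \<in> Jx \<xi>" for j
    using that assms Ix_Jx(1) by (metis Suc_lessI disjoint_iff Suc_lessD)
  show I: "{i\<in>Ix \<xi>. t < i} = insert (Suc t) {i\<in>Ix \<xi>. Suc t < i}" using assms by auto
  show c: "num_contracted t = Suc (num_contracted (Suc t))" unfolding num_contracted_def I by simp
  show "{j\<in>Jx \<xi>. t < j} = {j\<in>Jx \<xi>. Suc t < j}" using gt by auto
  show "unpaired m t \<xi> = unpaired m (Suc t) \<xi> - {Max (blk \<xi> (Suc t))}"
    unfolding unpaired_pairing using assms gt by (auto intro: Suc_lessI)
  \<comment> \<open>Exactly \<open>num_contracted (Suc t)\<close> openers exceed
    \<open>Suc t\<close>; the extra \<open>Suc\<close> in \<open>c\<close> matches the one-based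
    index of \<open>ik\<close>.\<close>
  show "ik \<xi> (num_contracted t) = Suc t"
    unfolding ik_def c using rev_sorted_list_of_set_nth[OF _ assms] by (simp add: num_contracted_def)
  have "Suc t \<in> {0<..m}" using tm by simp
  then show "Max (blk \<xi> (Suc t)) \<in> unpaired m (Suc t) \<xi>"
  proof (rule pairing_cases)
    fix i j assume ij: "{i, j} \<in> \<xi>" "i < j" "blk \<xi> i = {i, j}" "blk \<xi> j = {i, j}" "j \<le> m" "j \<in> Jx \<xi>"
      "Suc t = i \<or> Suc t = j"
    have i: "Suc t = i" using ij assms Ix_Jx(1) by auto
    have "\<not> b \<subseteq> {Suc t<..}" if "b \<in> \<xi>" "j \<in> b" for b
    proof -
      have "b = {i, j}"
        using that ij blk_eq[OF partial_pairings_disjoint[OF pairing(1)]] by metis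
      then show ?thesis using i by auto
    qed
    then show ?thesis using ij i by (auto simp: unpaired_def max_def)
  qed
qed

end

lemma bexcl_Suc: "bexcl \<xi> (Suc k) = insert (Min (bJ \<xi> (Suc k))) (bexcl \<xi> k)"
  by (simp add: bJ_def)

text \<open>At a closer both sets gain \<open>Suc t\<close>; at an opener \<open>unpaired\<close>
  loses the partner and \<open>slots\<close> its minimum, so the sizes stay equal although the sets
  may drift apart.\<close>

lemma slots_invariant:
  assumes "t \<le> m"
  shows "ik \<xi> ` {1..num_contracted t} = {i\<in>Ix \<xi>. t < i} \<and> bexcl \<xi> (num_contracted t) \<subseteq> {j\<in>Jx \<xi>. t < j} \<and>
    card (slots t) = card (unpaired m t \<xi>) \<and> (\<forall>k\<in>{1..num_contracted t}. bj \<xi> k 1 \<in> bexcl \<xi> (num_contracted t))"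
  using assms
proof (induction t rule: inc_induct)
  case base
  show ?case
    by (auto simp: num_contracted_top slots_top unpaired_def dest: Ix_le)
next
  case (step t)
  note IH = step.IH
  have fin: "finite (unpaired m (Suc t) \<xi>)" by simp
  have nS: "Suc t \<notin> slots (Suc t)" "Suc t \<notin> unpaired m (Suc t) \<xi>"
    using unpaired_subset[of m "Suc t" \<xi>] by (auto simp: slots_def)
  show ?case
  proof (cases "Suc t \<in> Jx \<xi>")
    case True
    note J = Jx_Suc[OF step.hyps(2) True]
    have "slots t = insert (Suc t) (slots (Suc t))"
      unfolding slots_def J using IH by auto
    then have "card (slots t) = card (unpaired m t \<xi>)"
      using IH nS J(3) by simp
    moreover have "{i\<in>Ix \<xi>. t < i} = {i\<in>Ix \<xi>. Suc t < i}"
      using True Ix_Jx(1) by (auto intro: Suc_lessI)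
    ultimately show ?thesis using IH J(1,2) by auto
  next
    case False
    then have I: "Suc t \<in> Ix \<xi>" using Suc_cases[OF step.hyps(2)] by auto
    note I = Ix_Suc[OF step.hyps(2) I]
    have bJ: "bJ \<xi> (num_contracted t) = slots (Suc t)"
      unfolding bJ_def slots_def I(5) by (auto simp: I(1))
    \<comment> \<open>The partner of \<open>Suc t\<close> is unpaired, so equality of sizes makes
      the minimum of the slots meaningful.\<close>
    have "card (slots (Suc t)) > 0"
      using IH I(4) fin by (metis card_gt_0_iff empty_iff)
    then have Min: "Min (slots (Suc t)) \<in> slots (Suc t)" "slots (Suc t) \<noteq> {}"
      by (auto intro!: Min_in simp: card_gt_0_iff)
    have b: "bexcl \<xi> (num_contracted t) = insert (Min (slots (Suc t))) (bexcl \<xi> (num_contracted (Suc t)))"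
      using bexcl_Suc[of "num_contracted (Suc t)"] bJ I(1) by simp
    then have "slots t = slots (Suc t) - {Min (slots (Suc t))}"
      unfolding slots_def[of t] slots_def[of "Suc t"] I(2) by auto
    then have "card (slots t) = card (unpaired m t \<xi>)"
      using IH I(3,4) Min(1) by simp
    moreover have "bj \<xi> (num_contracted t) 1 = Min (slots (Suc t))"
      using Min(2) by (simp add: bj_def bJ sorted_list_of_set_nonempty)
    moreover have "{1..num_contracted t} = insert (num_contracted t) {1..num_contracted (Suc t)}" using I(1) by auto
    moreover have "Min (slots (Suc t)) \<in> {j\<in>Jx \<xi>. t < j}"
      using Min(1) I(2) by (auto simp: slots_def)
    ultimately show ?thesis using IH b I(2,5,6) by auto
  qed
qed

lemma slots_Suc_Jx:
  assumes "t < m" "Suc t \<in> Jx \<xi>"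
  shows "slots t = insert (Suc t) (slots (Suc t))"
  unfolding slots_def Jx_Suc[OF assms] using slots_invariant[of "Suc t"] assms(1) by auto

context
  fixes t assumes tm: "t < m" and opener: "Suc t \<in> Ix \<xi>"
begin

lemma bJ_num_contracted: "bJ \<xi> (num_contracted t) = slots (Suc t)"
  unfolding bJ_def slots_def Ix_Suc(5)[OF tm opener] by (auto simp: Ix_Suc(1)[OF tm opener])

lemma slots_nonempty: "slots (Suc t) \<noteq> {}"
  using slots_invariant[of "Suc t"] tm Ix_Suc(4)[OF tm opener]
  by (metis Suc_leI card_eq_0_iff empty_iff finite_unpaired finite_slots)

lemma slots_Suc_Ix: "slots t = slots (Suc t) - {Min (slots (Suc t))}"
  using bexcl_Suc[of "num_contracted (Suc t)"] bJ_num_contracted Ix_Suc(1,2)[OF tm opener]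
  unfolding slots_def[of t] slots_def[of "Suc t"] by auto

text \<open>The labels excluded in \<open>Jsm\<close> are the partners of the openers above
  \<open>Suc t\<close>, that is, those already paired.\<close>

lemma Jsm_num_contracted: "Jsm \<xi> (num_contracted t) = {l\<in>unpaired m (Suc t) \<xi>. l \<le> Max (blk \<xi> (Suc t))}"
proof -
  have "{1..<num_contracted t} = {1..num_contracted (Suc t)}" using Ix_Suc(1)[OF tm opener] by auto
  moreover have "jk \<xi> ` {1..num_contracted (Suc t)} = (\<lambda>i. Max (blk \<xi> i)) ` (ik \<xi> ` {1..num_contracted (Suc t)})"
    by (simp add: jk_def image_image)
  ultimately have "jk \<xi> ` {1..<num_contracted t} = (\<lambda>i. Max (blk \<xi> i)) ` {i\<in>Ix \<xi>. Suc t < i}"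
    using slots_invariant[of "Suc t"] tm by simp
  then show ?thesis
    unfolding Jsm_def unpaired_pairing using Ix_Suc(5)[OF tm opener] by (auto simp: jk_def)
qed

lemma card_Jsm_num_contracted:
  "card (Jsm \<xi> (num_contracted t)) = Suc (card {l\<in>unpaired m (Suc t) \<xi>. l < Max (blk \<xi> (Suc t))})"
proof -
  have "Jsm \<xi> (num_contracted t) = insert (Max (blk \<xi> (Suc t))) {l\<in>unpaired m (Suc t) \<xi>. l < Max (blk \<xi> (Suc t))}"
    unfolding Jsm_num_contracted using Ix_Suc(4)[OF tm opener] by auto
  then show ?thesis by simp
qed

lemma card_Jsm_num_contracted_le: "card (Jsm \<xi> (num_contracted t)) \<le> card (slots (Suc t))"
  using slots_invariant[of "Suc t"] tm unfolding Jsm_num_contracted by (auto intro: card_mono)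

lemma Qk_num_contracted:
  "Qk Q \<xi> (num_contracted t) x G = foldr (\<lambda>i. apply_pair
     (Q (fst (x (Suc t))) (fst (x (sorted_list_of_set (unpaired m (Suc t) \<xi>) ! i))))
     (sorted_list_of_set (slots (Suc t)) ! i) (sorted_list_of_set (slots (Suc t)) ! Suc i))
   [0..<card {l\<in>unpaired m (Suc t) \<xi>. l < Max (blk \<xi> (Suc t))}] G"
proof -
  let ?q = "card {l\<in>unpaired m (Suc t) \<xi>. l < Max (blk \<xi> (Suc t))}"
  have "[1..<card (Jsm \<xi> (num_contracted t))] = map Suc [0..<?q]"
    unfolding card_Jsm_num_contracted map_Suc_upt by simp
  moreover have "jsm \<xi> (num_contracted t) (Suc i) = sorted_list_of_set (unpaired m (Suc t) \<xi>) ! i" if "i < ?q" for i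
    unfolding jsm_def Jsm_num_contracted using that card_Jsm_num_contracted unfolding Jsm_num_contracted
    by (simp add: nth_sorted_list_of_set_initial)
  ultimately show ?thesis
    unfolding Qk_def Ix_Suc(5)[OF tm opener]
    by (simp only: foldr_map comp_def) (auto intro!: foldr_cong simp: bj_def bJ_num_contracted)
qed

end

end

context field_product
begin

context
  fixes \<xi> :: "nat set set" and x :: "nat \<Rightarrow> 'e pt"
  assumes \<xi>: "\<xi> \<in> pair_partitions m"
begin

section \<open>Partial contractions of the integrand of \<open>rhs_term\<close>\<close>

definition tensor :: "nat \<Rightarrow> (nat \<Rightarrow> 'r) \<Rightarrow> complex" where
  "tensor t \<alpha> = (\<Prod>l\<in>{t<..m}. (if l \<in> Ix \<xi> then f' l else f l) (x l) (\<alpha> l))"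

definition Qprod :: "nat \<Rightarrow> ((nat \<Rightarrow> 'r) \<Rightarrow> complex) \<Rightarrow> (nat \<Rightarrow> 'r) \<Rightarrow> complex" where
  "Qprod k G = foldr (\<lambda>k. Qk Q \<xi> k x) (rev [1..<Suc k]) G"

definition deltas :: "nat \<Rightarrow> (nat \<Rightarrow> 'r) \<Rightarrow> complex" where
  "deltas k \<alpha> = (\<Prod>k'\<in>{1..k}. if \<alpha> (ik \<xi> k') = \<alpha> (bj \<xi> k' 1) then 1 else 0)"

lemma Qprod_simps: "Qprod 0 G = G" "Qprod (Suc k) G = Qk Q \<xi> (Suc k) x (Qprod k G)"
  by (simp_all add: Qprod_def)

lemma tensor_rec:
  "t < m \<Longrightarrow> tensor t \<alpha> =
    (if Suc t \<in> Ix \<xi> then f' (Suc t) else f (Suc t)) (x (Suc t)) (\<alpha> (Suc t)) * tensor (Suc t) \<alpha>"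
proof -
  assume "t < m"
  then have "{t<..m} = insert (Suc t) {Suc t<..m}" by auto
  then show ?thesis by (simp add: tensor_def)
qed

lemma slots_gt: "l \<in> slots \<xi> t \<Longrightarrow> t < l \<and> l \<le> m \<and> l \<in> Jx \<xi>"
  using Jx_le[OF \<xi>] by (auto simp: slots_def[OF \<xi>])

lemma nth_slots:
  assumes "t < m" "Suc t \<in> Ix \<xi>" "i < card {l\<in>unpaired m (Suc t) \<xi>. l < Max (blk \<xi> (Suc t))}"
  shows "sorted_list_of_set (slots \<xi> (Suc t)) ! i \<in> slots \<xi> (Suc t)"
    "sorted_list_of_set (slots \<xi> (Suc t)) ! Suc i \<in> slots \<xi> (Suc t)"
    "Suc i < card (slots \<xi> (Suc t))"
proof -
  show "Suc i < card (slots \<xi> (Suc t))"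
    using assms card_Jsm_num_contracted[OF \<xi> assms(1,2)] card_Jsm_num_contracted_le[OF \<xi> assms(1,2)]
    by linarith
  then show "sorted_list_of_set (slots \<xi> (Suc t)) ! i \<in> slots \<xi> (Suc t)"
    "sorted_list_of_set (slots \<xi> (Suc t)) ! Suc i \<in> slots \<xi> (Suc t)"
    using bij_betw_nth_sorted_list_of_set[OF finite_slots[OF \<xi>], of "Suc t"] by (auto simp: bij_betw_def)
qed

lemma Qk_mult:
  assumes "t < m" "Suc t \<in> Ix \<xi>" "\<And>l \<gamma> v. l \<in> slots \<xi> (Suc t) \<Longrightarrow> c (\<gamma>(l := v)) = c \<gamma>"
  shows "Qk Q \<xi> (num_contracted \<xi> t) x (\<lambda>\<gamma>. c \<gamma> * G \<gamma>) = (\<lambda>\<gamma>. c \<gamma> * Qk Q \<xi> (num_contracted \<xi> t) x G \<gamma>)"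
  unfolding Qk_num_contracted[OF \<xi> assms(1,2)]
  by (rule foldr_apply_pair_mult; rule assms(3)) (simp_all add: nth_slots[OF assms(1,2)])

text \<open>The products formed so far act on slots above \<open>t\<close> only, so factors at
  labels up to \<open>t\<close> are scalars for them.\<close>

lemma Qprod_mult:
  assumes "t \<le> m" "\<And>l \<gamma> v. t < l \<Longrightarrow> c (\<gamma>(l := v)) = c \<gamma>"
  shows "Qprod (num_contracted \<xi> t) (\<lambda>\<gamma>. c \<gamma> * G \<gamma>) = (\<lambda>\<gamma>. c \<gamma> * Qprod (num_contracted \<xi> t) G \<gamma>)"
  using assms
proof (induction t rule: inc_induct)
  case base
  show ?case by (simp add: num_contracted_top[OF \<xi>] Qprod_simps)
next
  case (step t)
  have IH: "Qprod (num_contracted \<xi> (Suc t)) (\<lambda>\<gamma>. c \<gamma> * G \<gamma>) =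
      (\<lambda>\<gamma>. c \<gamma> * Qprod (num_contracted \<xi> (Suc t)) G \<gamma>)"
    using step by simp
  show ?case
  proof (cases "Suc t \<in> Ix \<xi>")
    case False
    then have "Suc t \<in> Jx \<xi>" using Suc_cases[OF \<xi> step.hyps(2)] by blast
    then show ?thesis using IH Jx_Suc(1)[OF \<xi> step.hyps(2)] by simp
  next
    case True
    have "c (\<gamma>(l := v)) = c \<gamma>" if "l \<in> slots \<xi> (Suc t)" for l \<gamma> v
      by (rule step.prems) (use slots_gt[OF that] in simp)
    from Qk_mult[OF step.hyps(2) True this] show ?thesis
      using IH Ix_Suc(1)[OF \<xi> step.hyps(2) True] by (simp add: Qprod_simps)
  qed
qed

text \<open>Earlier contractions involve openers and slots in \<open>bexcl\<close>, both disjoint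
  from the remaining slots. This allows contraction before the later \<open>Qk\<close> act.\<close>

lemma deltas_upd:
  assumes "t \<le> m" "l \<in> slots \<xi> t"
  shows "deltas (num_contracted \<xi> t) (\<gamma>(l := v)) = deltas (num_contracted \<xi> t) \<gamma>"
  unfolding deltas_def
proof (rule prod.cong[OF refl])
  fix k assume k: "k \<in> {1..num_contracted \<xi> t}"
  have "ik \<xi> k \<in> Ix \<xi>" "bj \<xi> k 1 \<in> bexcl \<xi> (num_contracted \<xi> t)"
    using slots_invariant[OF \<xi> assms(1)] k by auto
  moreover have "l \<in> Jx \<xi>" "l \<notin> bexcl \<xi> (num_contracted \<xi> t)"
    using assms(2) by (auto simp: slots_def[OF \<xi>])
  ultimately have "l \<noteq> ik \<xi> k" "l \<noteq> bj \<xi> k 1" using Ix_Jx(1)[OF \<xi>] by auto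
  then show "(if (\<gamma>(l := v)) (ik \<xi> k) = (\<gamma>(l := v)) (bj \<xi> k 1) then 1 else 0) =
      (if \<gamma> (ik \<xi> k) = \<gamma> (bj \<xi> k 1) then 1 else 0 :: complex)"
    by simp
qed

text \<open>Core of the comparison: once the indices of all openers and used slots above
  \<open>t\<close> are summed, the free indices, read off in increasing order of the slots, are the
  positions in the amplitude.\<close>

lemma sum_over_contraction:
  assumes "t \<le> m"
  shows "sum_over ({t<..m} - slots \<xi> t)
      (\<lambda>\<gamma>. deltas (num_contracted \<xi> t) \<gamma> * Qprod (num_contracted \<xi> t) (tensor t) \<gamma>) \<alpha> =
    amplitude \<xi> t x (map \<alpha> (sorted_list_of_set (slots \<xi> t)))"
  using assms
proof (induction t arbitrary: \<alpha> rule: inc_induct)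
  case base
  show ?case
    by (simp add: num_contracted_top[OF \<xi>] Qprod_simps deltas_def tensor_def amplitude_top)
next
  case (step t)
  let ?s = "Suc t" and ?C = "{Suc t<..m} - slots \<xi> (Suc t)"
  let ?G = "\<lambda>\<gamma>. deltas (num_contracted \<xi> (Suc t)) \<gamma> * Qprod (num_contracted \<xi> (Suc t)) (tensor (Suc t)) \<gamma>"
  have interval: "{t<..m} = insert ?s {?s<..m}" using step.hyps by auto
  have s: "?s \<notin> slots \<xi> ?s" using slots_gt by blast
  show ?case
  proof (cases "?s \<in> Ix \<xi>")
    case False
    then have J: "?s \<in> Jx \<xi>" using Suc_cases[OF \<xi> step.hyps(2)] by blast
    have slots: "slots \<xi> t = insert ?s (slots \<xi> ?s)" by (rule slots_Suc_Jx[OF \<xi> step.hyps(2) J])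
    have C: "{t<..m} - slots \<xi> t = ?C" unfolding interval slots by auto
    have "Min (insert ?s (slots \<xi> ?s)) = ?s"
      using slots_gt[of _ ?s] by (intro Min_eqI) (auto simp: finite_slots[OF \<xi>] intro: less_imp_le)
    then have L: "sorted_list_of_set (slots \<xi> t) = ?s # sorted_list_of_set (slots \<xi> ?s)"
      unfolding slots using sorted_list_of_set_nonempty[of "insert ?s (slots \<xi> ?s)"] s
      by (simp add: finite_slots[OF \<xi>])
    have "tensor t = (\<lambda>\<gamma>. f ?s (x ?s) (\<gamma> ?s) * tensor ?s \<gamma>)"
      using False by (simp add: tensor_rec[OF step.hyps(2)] fun_eq_iff)
    then have "Qprod (num_contracted \<xi> ?s) (tensor t) =
        (\<lambda>\<gamma>. f ?s (x ?s) (\<gamma> ?s) * Qprod (num_contracted \<xi> ?s) (tensor ?s) \<gamma>)"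
      using step.hyps by (simp add: Qprod_mult)
    then have "sum_over ({t<..m} - slots \<xi> t)
        (\<lambda>\<gamma>. deltas (num_contracted \<xi> t) \<gamma> * Qprod (num_contracted \<xi> t) (tensor t) \<gamma>) \<alpha> =
        sum_over ?C (\<lambda>\<gamma>. f ?s (x ?s) (\<gamma> ?s) * ?G \<gamma>) \<alpha>"
      by (simp add: C Jx_Suc(1)[OF \<xi> step.hyps(2) J] mult.left_commute)
    also have "\<dots> = f ?s (x ?s) (\<alpha> ?s) * sum_over ?C ?G \<alpha>"
      by (rule sum_over_mult) (simp add: override_on_def)
    finally show ?thesis
      using False step.hyps by (simp add: step.IH amplitude_rec wick_step_def L)
  next
    case True
    define b where "b = Min (slots \<xi> ?s)"
    let ?L = "sorted_list_of_set (slots \<xi> ?s)" and ?U = "sorted_list_of_set (unpaired m ?s \<xi>)"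
    let ?q = "card {l\<in>unpaired m ?s \<xi>. l < Max (blk \<xi> ?s)}"
    note fin = finite_slots[OF \<xi>, of ?s]
    have b: "b \<in> slots \<xi> ?s" unfolding b_def by (rule Min_in[OF fin slots_nonempty[OF \<xi> step.hyps(2) True]])
    have slots: "slots \<xi> t = slots \<xi> ?s - {b}"
      unfolding b_def by (rule slots_Suc_Ix[OF \<xi> step.hyps(2) True])
    \<comment> \<open>The contracted slot is the least one and therefore the head position that
      \<open>wick_step\<close> contracts.\<close>
    have L: "?L = b # sorted_list_of_set (slots \<xi> t)"
      unfolding slots b_def by (rule sorted_list_of_set_nonempty[OF fin slots_nonempty[OF \<xi> step.hyps(2) True]])
    have C: "{t<..m} - slots \<xi> t = insert ?s (insert b ?C)"
      unfolding interval slots using s b slots_gt[OF b] by auto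
    have notin: "?s \<notin> insert b ?C" "b \<notin> ?C" using s b by auto
    have override: "override_on \<gamma> \<beta> ?C ?s = \<gamma> ?s" "override_on \<gamma> \<beta> ?C b = \<gamma> b" for \<gamma> \<beta> :: "nat \<Rightarrow> 'r"
      using b by (simp_all add: override_on_def)
    note k = Ix_Suc(1)[OF \<xi> step.hyps(2) True]
    let ?Qk = "Qk Q \<xi> (num_contracted \<xi> t) x"
    let ?c = "\<lambda>\<gamma>. (if \<gamma> ?s = \<gamma> b then 1 else 0) * f' ?s (x ?s) (\<gamma> ?s)"
    have "bj \<xi> (num_contracted \<xi> t) 1 = b"
      using L by (simp add: bj_def bJ_num_contracted[OF \<xi> step.hyps(2) True])
    then have deltas: "deltas (num_contracted \<xi> t) \<gamma> =
        (if \<gamma> ?s = \<gamma> b then 1 else 0) * deltas (num_contracted \<xi> ?s) \<gamma>" for \<gamma>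
      using Ix_Suc(5)[OF \<xi> step.hyps(2) True] unfolding k deltas_def
      by (simp add: prod.nat_ivl_Suc' del: One_nat_def)
    have "tensor t = (\<lambda>\<gamma>. f' ?s (x ?s) (\<gamma> ?s) * tensor ?s \<gamma>)"
      using True by (simp add: tensor_rec[OF step.hyps(2)] fun_eq_iff)
    then have "Qprod (num_contracted \<xi> t) (tensor t) =
        ?Qk (\<lambda>\<gamma>. f' ?s (x ?s) (\<gamma> ?s) * Qprod (num_contracted \<xi> ?s) (tensor ?s) \<gamma>)"
      using step.hyps by (simp add: Qprod_mult Qprod_simps k)
    also have "\<dots> = (\<lambda>\<gamma>. f' ?s (x ?s) (\<gamma> ?s) * ?Qk (Qprod (num_contracted \<xi> ?s) (tensor ?s)) \<gamma>)"
      using s by (intro Qk_mult[OF step.hyps(2) True]) auto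
    finally have "(\<lambda>\<gamma>. deltas (num_contracted \<xi> t) \<gamma> * Qprod (num_contracted \<xi> t) (tensor t) \<gamma>) =
        (\<lambda>\<gamma>. ?c \<gamma> * (deltas (num_contracted \<xi> ?s) \<gamma> * ?Qk (Qprod (num_contracted \<xi> ?s) (tensor ?s)) \<gamma>))"
      by (simp add: deltas fun_eq_iff)
    \<comment> \<open>The earlier deltas go inside the new product, which rebuilds the expression
      \<open>?G\<close> of the induction hypothesis.\<close>
    also have "\<dots> = (\<lambda>\<gamma>. ?c \<gamma> * ?Qk ?G \<gamma>)"
      using step.hyps by (subst Qk_mult[OF step.hyps(2) True]) (auto simp: deltas_upd)
    finally have "sum_over ({t<..m} - slots \<xi> t)
        (\<lambda>\<gamma>. deltas (num_contracted \<xi> t) \<gamma> * Qprod (num_contracted \<xi> t) (tensor t) \<gamma>) \<alpha> =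
        (\<Sum>v\<in>UNIV. \<Sum>w\<in>UNIV. sum_over ?C (\<lambda>\<gamma>. ?c \<gamma> * ?Qk ?G \<gamma>) (\<alpha>(?s := v, b := w)))"
      by (simp add: C sum_over_insert[OF notin(1)] sum_over_insert[OF notin(2)])
    also have "\<dots> = (\<Sum>v\<in>UNIV. \<Sum>w\<in>UNIV. (if v = w then 1 else 0) * f' ?s (x ?s) v *
        sum_over ?C (?Qk ?G) (\<alpha>(?s := v, b := w)))"
    proof (rule sum.cong[OF refl], rule sum.cong[OF refl])
      fix v w
      have "sum_over ?C (\<lambda>\<gamma>. ?c \<gamma> * ?Qk ?G \<gamma>) (\<alpha>(?s := v, b := w)) =
          ?c (\<alpha>(?s := v, b := w)) * sum_over ?C (?Qk ?G) (\<alpha>(?s := v, b := w))"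
        by (rule sum_over_mult) (simp only: override)
      then show "sum_over ?C (\<lambda>\<gamma>. ?c \<gamma> * ?Qk ?G \<gamma>) (\<alpha>(?s := v, b := w)) =
          (if v = w then 1 else 0) * f' ?s (x ?s) v * sum_over ?C (?Qk ?G) (\<alpha>(?s := v, b := w))"
        using notin(1) by auto
    qed
    also have "\<dots> = (\<Sum>v\<in>UNIV. f' ?s (x ?s) v * sum_over ?C (?Qk ?G) (\<alpha>(?s := v, b := v)))"
      by (simp add: mult_if_zero)
    \<comment> \<open>\<open>Qk\<close> touches only slots outside \<open>?C\<close>, so the index
      sum passes through it.\<close>
    also have "sum_over ?C (?Qk ?G) = ?Qk (sum_over ?C ?G)"
      unfolding Qk_num_contracted[OF \<xi> step.hyps(2) True]
      using nth_slots[OF step.hyps(2) True] by (intro sum_over_foldr_apply_pair) auto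
    also have "sum_over ?C ?G = (\<lambda>\<alpha>. amplitude \<xi> ?s x (map \<alpha> ?L))"
      by (intro ext step.IH)
    also have "?Qk \<dots> = (\<lambda>\<alpha>. foldr (\<lambda>i. list_pair (Q (fst (x ?s)) (fst (x (?U ! i)))) i) [0..<?q]
        (amplitude \<xi> ?s x) (map \<alpha> ?L))"
      unfolding Qk_num_contracted[OF \<xi> step.hyps(2) True]
      using nth_slots(3)[OF step.hyps(2) True] by (intro foldr_apply_pair_map) auto
    finally have "sum_over ({t<..m} - slots \<xi> t)
        (\<lambda>\<gamma>. deltas (num_contracted \<xi> t) \<gamma> * Qprod (num_contracted \<xi> t) (tensor t) \<gamma>) \<alpha> =
        (\<Sum>v\<in>UNIV. f' ?s (x ?s) v * foldr (\<lambda>i. list_pair (Q (fst (x ?s)) (fst (x (?U ! i)))) i) [0..<?q]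
          (amplitude \<xi> ?s x) (map (\<alpha>(?s := v, b := v)) ?L))" .
    moreover have "map (\<alpha>(?s := v, b := v)) ?L = v # map \<alpha> (sorted_list_of_set (slots \<xi> t))" for v
      unfolding L using s slots fin by (auto simp: finite_slots[OF \<xi>])
    ultimately show ?thesis
      using True step.hyps by (simp add: amplitude_rec wick_step_def)
  qed
qed

lemma Txi_eq_amplitude:
  assumes "m = 2 * n"
  shows "Txi \<xi> n (Qxi Q \<xi> n x (htensor \<xi> n f f' x)) = amplitude \<xi> 0 x []"
proof -
  have "inj_on Min \<xi>"
  proof (rule inj_onI)
    fix b c assume bc: "b \<in> \<xi>" "c \<in> \<xi>" "Min b = Min c"
    have "Min d \<in> d" if "d \<in> \<xi>" for d
      using that pairing(1)[OF \<xi>] by (auto simp: partial_pairings_def intro!: Min_in intro: finite_subset)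
    then have "Min b \<in> b" "Min c \<in> c" using bc by blast+
    then show "b = c"
      using bc blk_eq[OF partial_pairings_disjoint[OF pairing(1)[OF \<xi>]]] by metis
  qed
  then have "card (Ix \<xi>) = card \<xi>" by (simp add: Ix_def card_image)
  moreover have "2 * card \<xi> = m"
    using card_partial_pairing[OF pairing(1)[OF \<xi>]] pairing(2)[OF \<xi>] by simp
  moreover have "{i\<in>Ix \<xi>. 0 < i} = Ix \<xi>" using Ix_le[OF \<xi>] by auto
  ultimately have n: "num_contracted \<xi> 0 = n"
    using assms by (simp add: num_contracted_def[OF \<xi>])
  have "card (slots \<xi> 0) = 0" using slots_invariant[OF \<xi>, of 0] pairing(2)[OF \<xi>] by simp
  then have slots: "slots \<xi> 0 = {}" using finite_slots[OF \<xi>] by simp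
  have ivl: "{1..2 * n} = {0<..m}" using assms by auto
  \<comment> \<open>Overriding the constant \<open>undefined\<close> on the whole label set gives
    back the extensional function summed in \<open>Txi\<close>.\<close>
  have "Txi \<xi> n F = sum_over {0<..m} (\<lambda>\<gamma>. deltas n \<gamma> * F \<gamma>) (\<lambda>_. undefined)" for F
    unfolding Txi_def sum_over_def deltas_def ivl
    by (intro sum.cong refl) (auto simp: override_on_def PiE_def extensional_def fun_eq_iff intro!: arg_cong2[where f="(*)"] arg_cong[where f=F] prod.cong)
  moreover have "htensor \<xi> n f f' x = tensor 0"
    by (intro ext) (simp only: htensor_def tensor_def ivl)
  ultimately show ?thesis
    using sum_over_contraction[of 0 "\<lambda>_. undefined"] by (simp add: n slots Qxi_def Qprod_def)
qed

end

lemma pairing_integral_eq_rhs_term: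
  assumes "\<xi> \<in> pair_partitions m" "m = 2 * n"
  shows "pairing_integral \<xi> 0 [] [] = rhs_term Q \<xi> n f f'"
proof -
  have "amplitude \<xi> 0 (assign \<xi> 0 [] u) = amplitude \<xi> 0 (\<lambda>l. u (blk \<xi> l))" for u
    using Union_pairing[OF assms(1)] by (intro amplitude_cong) (auto simp: assign_def)
  then show ?thesis
    by (simp add: pairing_integral_def rhs_term_def Txi_eq_amplitude[OF assms])
qed

end

theorem theorem4p2:
  fixes Q :: "real \<Rightarrow> real \<Rightarrow> ('r::finite \<times> 'r) \<Rightarrow> ('r \<times> 'r) \<Rightarrow> complex"
    and f f' :: "nat \<Rightarrow> real \<times> (real ^ 'e::finite) \<Rightarrow> 'r \<Rightarrow> complex"
    and n :: nat
  assumes Q_cont: "\<And>a b. continuous_on UNIV (\<lambda>p::real \<times> real. Q (fst p) (snd p) a b)"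
    and Q_unitary1: "\<And>y1 y2. mm (adjm (Q y1 y2)) (Q y1 y2) = idm"
    and Q_unitary2: "\<And>y1 y2. mm (Q y1 y2) (adjm (Q y1 y2)) = idm"
    and Q_adj: "\<And>y1 y2. adjm (Q y1 y2) = Q y2 y1"
    and Q_braid: "\<And>y1 y2 y3. mm (mm (op1 (Q y1 y2)) (op2 (Q y1 y3))) (op1 (Q y2 y3))
                              = mm (mm (op2 (Q y2 y3)) (op1 (Q y1 y3))) (op2 (Q y1 y2))"
    and f_meas: "\<And>k a. k \<in> {1..2*n} \<Longrightarrow> (\<lambda>x. f k x a) \<in> borel_measurable lborel"
    and f_L2: "\<And>k a. k \<in> {1..2*n} \<Longrightarrow> integrable lborel (\<lambda>x. (cmod (f k x a))\<^sup>2)"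
    and f'_meas: "\<And>k a. k \<in> {1..2*n} \<Longrightarrow> (\<lambda>x. f' k x a) \<in> borel_measurable lborel"
    and f'_L2: "\<And>k a. k \<in> {1..2*n} \<Longrightarrow> integrable lborel (\<lambda>x. (cmod (f' k x a))\<^sup>2)"
    and n_pos: "n \<ge> 1"
  shows "tau_prod Q f f' (2*n - 1) = 0
       \<and> tau_prod Q f f' (2*n) = (\<Sum>\<xi>\<in>pair_partitions (2*n). rhs_term Q \<xi> n f f')"
proof
  interpret braided_kernel Q
    by unfold_locales (rule Q_cont Q_unitary1 Q_unitary2 Q_adj Q_braid)+
  have field_product: "field_product Q f f' m" if m: "m \<le> 2 * n" for m
  proof -
    have "k \<in> {1..2 * n}" if "k \<in> {1..m}" for k using that m by simp
    then show ?thesis by unfold_locales (rule f_meas f_L2 f'_meas f'_L2, simp)+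
  qed
  interpret odd: field_product Q f f' "2 * n - 1" by (rule field_product) simp
  interpret even: field_product Q f f' "2 * n" by (rule field_product) simp
  \<comment> \<open>Parity: a complete pairing covers an even number of labels.\<close>
  have "pair_partitions (2 * n - 1) = {}"
  proof (rule ccontr)
    assume "pair_partitions (2 * n - 1) \<noteq> {}"
    then obtain \<xi> where "\<xi> \<in> pair_partitions (2 * n - 1)" by blast
    then have "2 * card \<xi> = 2 * n - 1"
      using card_partial_pairing[of \<xi> "2 * n - 1" 0] by (simp add: pair_partitions_eq)
    then show False using n_pos by presburger
  qed
  then show "tau_prod Q f f' (2 * n - 1) = 0" by (simp only: odd.tau_prod_eq sum.empty)
  show "tau_prod Q f f' (2 * n) = (\<Sum>\<xi>\<in>pair_partitions (2 * n). rhs_term Q \<xi> n f f')"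
    by (simp add: even.tau_prod_eq even.pairing_integral_eq_rhs_term)
qed

end
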